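(* Let $\mathfrak g_{r,s}$ and $\mathfrak g'_{r',s'}$ be Banach Lie algebras, each coming from some root datum (with $r,s,r',s'>0$, $1\le rs$, $1\le r's'$). Let $1>\varepsilon>0$. Suppose we have two morphisms of $k\{\frac\hslash\varepsilon\}$-algebras $$\alpha,\alpha':U(\mathfrak g)^{\mathrm{an}}_{r,s}\{\tfrac\hslash\varepsilon\}\to U(\mathfrak g')^{\mathrm{an}}_{r',s'}\{\tfrac\hslash\varepsilon\}$$ such that $\alpha\equiv\alpha'$ modulo $\hslash$ and $\|\alpha\|\le1$, $\|\alpha'\|\le1$. Suppose that $C_b^\bullet(\mathfrak g_{r,s},U(\mathfrak g')^{\mathrm{an}}_{r',s'})$ is strictly exact at $C_b^1(\mathfrak g_{r,s},U(\mathfrak g')^{\mathrm{an}}_{r',s'})$ and that the isomorphism $$\mathrm{Ker}(\delta_1)=\mathrm{Im}(\delta_0)\xrightarrow{\ \sim\ }U(\mathfrak g')^{\mathrm{an}}_{r',s'}/\mathrm{Ker}(\delta_0)$$ is contracting. Then, for any $\varepsilon>\varepsilon'>0$, there exists an invertible $F\in U(\mathfrak g')^{\mathrm{an}}_{r',s'}\{\frac\hslash{\varepsilon'}\}$ such that $\alpha'(x)=F\alpha(x)F^{-1}$ for all $x\in U(\mathfrak g)^{\mathrm{an}}_{r,s}\{\frac\hslash{\varepsilon'}\}$, where $\alpha$ and $\alpha'$ are now viewed as maps $U(\mathfrak g)^{\mathrm{an}}_{r,s}\{\frac\hslash{\varepsilon'}\}\to U(\mathfrak g')^{\mathrm{an}}_{r',s'}\{\frac\hslash{\varepsilon'}\}$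 by applying $-\hat\otimes_{k\{\frac\hslash\varepsilon\}}k\{\frac\hslash{\varepsilon'}\}$.
   Context: $k$ is a field of characteristic $0$ complete for a non-Archimedean absolute value; Banach spaces have ultrametric norms; $\hat\otimes$ is the completed projective tensor product; $\coprod_i^{\le1}V_i=\{(v_i):\lim\|v_i\|=0\}$ with sup norm; "contracting" means of norm at most $1$. Root datum: a free $\mathbb Z$-module $\Phi$, a submodule $\Psi\subset\Phi$ with basis $\{\alpha_i\}_{i\in I}$, a symmetric bilinear form $(\cdot,\cdot):\Phi\times\Phi\to\mathbb Q$ with $(\alpha_i,\alpha_i)\in2\mathbb N$ (nonzero), $(\alpha_i,\alpha_j)\le0$ for $i\ne j$, and $\lambda_i\in\mathrm{Hom}(\Phi,\mathbb Z)$ with $\lambda_i(\alpha)=2(\alpha_i,\alpha)/(\alpha_i,\alpha_i)$. $\mathscr H_0$: the Banach Hopf algebra $\coprod^{\le1}_{\underline n}k\,H^{\underline n}$, $\underline n$ ranging over finitely supported elements of $\mathbb N^I$ (Tate algebra in commuting variables $H_i$ of norm 1), with each $H_i$ primitive. $V_0=\coprod_{i\in I}^{\le1}k\,v_i$, $T_r(V_0)=\coprod_{n\ge0}^{\le1}(V_0^{\hat\otimes n})_{r^n}$ (norm on degree $n$ scaled by $r^n$). $U^-(\mathfrak g)_r^{\mathrm{an}}=U^+(\mathfrak g)_r^{\mathrm{an}}$ is the quotient of $T_r(V_0)$ by the closed two-sided ideal generated by $\sum_{m=0}^{1-\lambda_i(\alpha_j)}(-1)^m\binom{1-\lambda_i(\alpha_j)}{m}v_i^{1-\lambda_i(\alpha_j)-m}v_jv_i^m$,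 $i\ne j$. For $1\le rs$, $U(\mathfrak g)^{\mathrm{an}}_{r,s}=U^-(\mathfrak g)_r^{\mathrm{an}}\hat\otimes\mathscr H_0\hat\otimes U^+(\mathfrak g)_s^{\mathrm{an}}$ is the Banach algebra in which the three factors are subalgebras, $y\otimes h\otimes x=yhx$, and with $F_i=v_i\otimes1\otimes1$, $E_i=1\otimes1\otimes v_i$: $[H_i,E_j]=\lambda_i(\alpha_j)E_j$, $[H_i,F_j]=-\lambda_i(\alpha_j)F_j$, $[E_i,F_j]=\delta_{ij}H_i$. $\mathfrak g_{r,s}$ is the closed Lie subalgebra of $U(\mathfrak g)^{\mathrm{an}}_{r,s}$ (commutator bracket) generated by all $F_i,H_i,E_i$. For a Banach space (or algebra) $X$, $X\{\frac\hslash\varepsilon\}=\{\sum_{n\ge0}a_n\hslash^n:a_n\in X,\ \|a_n\|\varepsilon^n\to0\}$ with norm $\sup_n\|a_n\|\varepsilon^n$; morphisms of $k\{\frac\hslash\varepsilon\}$-algebras are bounded and $k\{\frac\hslash\varepsilon\}$-linear. Reducing modulo $\hslash$, $\alpha$ gives $\alpha_0:U(\mathfrak g)^{\mathrm{an}}_{r,s}\to U(\mathfrak g')^{\mathrm{an}}_{r',s'}$ (equal to the reduction of $\alpha'$), and $\mathfrak g_{r,s}$ acts on $U(\mathfrak g')^{\mathrm{an}}_{r',s'}$ by $x\cdot u=[\alpha_0(x),u]$. For a Banach $\mathfrak g_{r,s}$-module $M$ with $\|x m\|\le\|x\|\|m\|$, $C_b^n(\mathfrak g_{r,s},M)$ is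 the Banach space of bounded alternating $n$-linear maps $\mathfrak g_{r,s}^n\to M$ ($C_b^0=M$) and $\delta_n(f)(x_1,\dots,x_{n+1})=\sum_{i<j}(-1)^{i+j}f([x_i,x_j],x_1,..,\hat x_i,..,\hat x_j,..,x_{n+1})+\sum_i(-1)^{i+1}x_if(x_1,..,\hat x_i,..,x_{n+1})$. The complex is strictly exact at $C_b^n$ if $\mathrm{Ker}(\delta_n)=\mathrm{Im}(\delta_{n-1})$ and the induced map $C_b^{n-1}/\mathrm{Ker}(\delta_{n-1})\to\mathrm{Im}(\delta_{n-1})=\mathrm{Ker}(\delta_n)$ (quotient and subspace norms) is an isomorphism of Banach spaces. *)

theory Defs
  imports
    Complex_Main
    "HOL-Library.Function_Algebras"
    "HOL-Library.Poly_Mapping"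
    "HOL-Computational_Algebra.Formal_Power_Series"
begin

section \<open>Ultrametric Banach spaces\<close>

locale complete_nonarch_field =
  fixes av :: "'k::field_char_0 \<Rightarrow> real"
  assumes av_nonneg: "0 \<le> av x"
    and av_eq_0_iff: "av x = 0 \<longleftrightarrow> x = 0"
    and av_mult: "av (x * y) = av x * av y"
    and av_ultra: "av (x + y) \<le> max (av x) (av y)"
    and av_complete:
      "(\<forall>e>0. \<exists>N. \<forall>m\<ge>N. \<forall>n\<ge>N. av (X m - X n) < e) \<Longrightarrow>
         \<exists>l. (\<lambda>n. av (X n - l)) \<longlonglongrightarrow> 0"

text \<open>
  A normed space is a set of vectors inside a type of class \<^class>\<open>ab_group_add\<close>, with its
  scalar multiplication and its norm.
\<close>

record ('k, 'a) nspace =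
  carr :: "'a set"
  scl :: "'k \<Rightarrow> 'a \<Rightarrow> 'a"
  nrm :: "'a \<Rightarrow> real"

definition banach_space ::
    "('k::field_char_0 \<Rightarrow> real) \<Rightarrow> ('k, 'a::ab_group_add, 'z) nspace_scheme \<Rightarrow> bool" where
  "banach_space av V \<longleftrightarrow>
     vector_space (scl V) \<and> module.subspace (scl V) (carr V) \<and>
     (\<forall>x\<in>carr V. 0 \<le> nrm V x) \<and>
     (\<forall>x\<in>carr V. nrm V x = 0 \<longleftrightarrow> x = 0) \<and>
     (\<forall>x\<in>carr V. \<forall>y\<in>carr V. nrm V (x + y) \<le> max (nrm V x) (nrm V y)) \<and>
     (\<forall>c. \<forall>x\<in>carr V. nrm V (scl V c x) = av c * nrm V x) \<and>
     (\<forall>X. (\<forall>n. X n \<in> carr V) \<and> (\<forall>e>0. \<exists>N. \<forall>m\<ge>N. \<forall>n\<ge>N. nrm V (X m - X n) < e) \<longrightarrow>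
        (\<exists>x\<in>carr V. (\<lambda>n. nrm V (X n - x)) \<longlonglongrightarrow> 0))"

definition norm_closed :: "('k, 'a::ab_group_add, 'z) nspace_scheme \<Rightarrow> 'a set \<Rightarrow> bool" where
  "norm_closed V S \<longleftrightarrow>
     (\<forall>X. \<forall>x\<in>carr V. (\<forall>n::nat. X n \<in> S) \<and> (\<lambda>n. nrm V (X n - x)) \<longlonglongrightarrow> 0 \<longrightarrow> x \<in> S)"

definition subsp :: "('k, 'a, 'z) nspace_scheme \<Rightarrow> 'a set \<Rightarrow> ('k, 'a) nspace" where
  "subsp V S = \<lparr>carr = S, scl = scl V, nrm = nrm V\<rparr>"

definition quot_norm :: "('k, 'a::ab_group_add, 'z) nspace_scheme \<Rightarrow> 'a set \<Rightarrow> 'a \<Rightarrow> real" where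
  "quot_norm V J x = Inf {nrm V (x + j) |j. j \<in> J}"

definition ground :: "('k::field_char_0 \<Rightarrow> real) \<Rightarrow> ('k, 'k) nspace" where
  "ground av = \<lparr>carr = UNIV, scl = (*), nrm = av\<rparr>"

definition rescale :: "real \<Rightarrow> ('k, 'a) nspace \<Rightarrow> ('k, 'a) nspace" where
  "rescale r V = V\<lparr>nrm := \<lambda>x. r * nrm V x\<rparr>"

text \<open>
  The contracting coproduct of a family of spaces indexed by a set: null families with the
  supremum norm. The inserted \<open>0\<close> only matters for an empty index set.
\<close>

definition coprod1 :: "'n set \<Rightarrow> ('n \<Rightarrow> ('k, 'a::ab_group_add) nspace) \<Rightarrow> ('k, 'n \<Rightarrow> 'a) nspace" where
  "coprod1 N V =
     \<lparr>carr = {f. (\<forall>n\<in>N. f n \<in> carr (V n)) \<and> (\<forall>n. n \<notin> N \<longrightarrow> f n = 0) \<and>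
                 (\<forall>e>0. finite {n \<in> N. e \<le> nrm (V n) (f n)})},
      scl = (\<lambda>c f n. scl (V n) c (f n)),
      nrm = (\<lambda>f. Sup (insert 0 ((\<lambda>n. nrm (V n) (f n)) ` N)))\<rparr>"


section \<open>Completed projective tensor products\<close>

text \<open>
  The factors \<open>Vs\<close> share one vector type, and a pure tensor is a list. The algebraic tensor
  product is the free \<open>k\<close>-module on such lists modulo the multilinearity relations.
\<close>

definition tens_dom :: "('k, 'x) nspace list \<Rightarrow> 'x list set" where
  "tens_dom Vs = {xs. length xs = length Vs \<and> (\<forall>i<length Vs. xs ! i \<in> carr (Vs ! i))}"

definition tens_rel ::
    "('k::field_char_0, 'x::ab_group_add) nspace list \<Rightarrow> ('x list \<Rightarrow>\<^sub>0 'k) set" where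
  "tens_rel Vs = module.span (\<lambda>c. Poly_Mapping.map ((*) c))
     ({Poly_Mapping.single (xs[i := x + y]) 1 - Poly_Mapping.single (xs[i := x]) 1
         - Poly_Mapping.single (xs[i := y]) 1 |xs i x y.
         xs \<in> tens_dom Vs \<and> i < length Vs \<and> x \<in> carr (Vs ! i) \<and> y \<in> carr (Vs ! i)} \<union>
      {Poly_Mapping.single (xs[i := scl (Vs ! i) c x]) 1 - Poly_Mapping.single (xs[i := x]) c |xs i x c.
         xs \<in> tens_dom Vs \<and> i < length Vs \<and> x \<in> carr (Vs ! i)})"

text \<open>The ultrametric projective seminorm: infimum over all representing sums of the maximum of the terms.\<close>

definition rep_size ::
    "('k::field_char_0 \<Rightarrow> real) \<Rightarrow> ('k, 'x) nspace list \<Rightarrow> ('x list \<Rightarrow>\<^sub>0 'k) \<Rightarrow> real" where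
  "rep_size av Vs y =
     Max (insert 0 ((\<lambda>xs. av (Poly_Mapping.lookup y xs) * (\<Prod>i<length Vs. nrm (Vs ! i) (xs ! i)))
                      ` Poly_Mapping.keys y))"

definition proj_seminorm ::
    "('k::field_char_0 \<Rightarrow> real) \<Rightarrow> ('k, 'x::ab_group_add) nspace list \<Rightarrow> ('x list \<Rightarrow>\<^sub>0 'k) \<Rightarrow> real" where
  "proj_seminorm av Vs z =
     Inf {rep_size av Vs y |y. Poly_Mapping.keys y \<subseteq> tens_dom Vs \<and> z - y \<in> tens_rel Vs}"

definition tens_ext ::
    "('k::field_char_0, 'y::ab_group_add, 'z) nspace_scheme \<Rightarrow> ('x list \<Rightarrow> 'y) \<Rightarrow> ('x list \<Rightarrow>\<^sub>0 'k) \<Rightarrow> 'y" where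
  "tens_ext X t z = (\<Sum>xs\<in>Poly_Mapping.keys z. scl X (Poly_Mapping.lookup z xs) (t xs))"

text \<open>
  \<open>X\<close>, with \<open>t [x\<^sub>1, \<dots>, x\<^sub>n]\<close> in the role of the pure tensors, is the separated completion of
  the algebraic tensor product of \<open>Vs\<close> for the projective seminorm. Multilinearity of \<open>t\<close>
  is implied, because the seminorm vanishes on the relations.
\<close>

definition is_completed_tensor ::
    "('k::field_char_0 \<Rightarrow> real) \<Rightarrow> ('k, 'x::ab_group_add) nspace list \<Rightarrow>
       ('k, 'y::ab_group_add, 'z) nspace_scheme \<Rightarrow> ('x list \<Rightarrow> 'y) \<Rightarrow> bool" where
  "is_completed_tensor av Vs X t \<longleftrightarrow>
     banach_space av X \<and>
     (\<forall>xs\<in>tens_dom Vs. t xs \<in> carr X) \<and>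
     (\<forall>z. Poly_Mapping.keys z \<subseteq> tens_dom Vs \<longrightarrow> nrm X (tens_ext X t z) = proj_seminorm av Vs z) \<and>
     (\<forall>x\<in>carr X. \<forall>e>0. \<exists>z. Poly_Mapping.keys z \<subseteq> tens_dom Vs \<and> nrm X (x - tens_ext X t z) < e)"


section \<open>Root data\<close>

definition zmul :: "int \<Rightarrow> 'p::ab_group_add \<Rightarrow> 'p" where
  "zmul n x = (\<Sum>_<nat n. x) - (\<Sum>_<nat (- n). x)"

lemma module_zmul: "module (zmul :: int \<Rightarrow> 'p::ab_group_add \<Rightarrow> 'p)"
proof -
  define d :: "nat \<Rightarrow> 'p \<Rightarrow> 'p" where "d = (\<lambda>n x. \<Sum>_<n. x)"
  have add: "d n x - d m x = zmul (int n - int m) x" for n m x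
  proof (cases "m \<le> n")
    case True
    have "d (m + k) x = d m x + d k x" for k
      by (induction k) (simp_all add: d_def algebra_simps)
    from this[of "n - m"] True show ?thesis
      by (simp add: zmul_def d_def nat_diff_distrib flip: of_nat_diff)
  next
    case False
    have "d (n + k) x = d n x + d k x" for k
      by (induction k) (simp_all add: d_def algebra_simps)
    from this[of "m - n"] False have "d m x = d n x + d (m - n) x" by simp
    moreover have "nat (int n - int m) = 0" "nat (- (int n - int m)) = m - n"
      using False by auto
    ultimately show ?thesis by (simp only: zmul_def d_def[symmetric]) (simp add: d_def)
  qed
  have dadd: "d (m + k) x = d m x + d k x" for m k x
    by (induction k) (simp_all add: d_def algebra_simps)
  have daddx: "d m (x + y) = d m x + d m y" for m x y
    by (simp add: d_def sum.distrib)
  have dminus: "d m (x - y) = d m x - d m y" for m x y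
    by (simp add: d_def sum_subtractf)
  have dmult: "d m (d k x) = d (m * k) x" for m k x
    by (induction m) (simp_all add: d_def dadd[unfolded d_def] algebra_simps)
  have z: "\<exists>n m. a = int n - int m" for a :: int
    by (intro exI[of _ "nat a"] exI[of _ "nat (- a)"]) simp
  show ?thesis
  proof
    fix a b :: int and x y :: 'p
    obtain n m p q where ab: "a = int n - int m" "b = int p - int q" using z by metis
    show "zmul a (x + y) = zmul a x + zmul a y"
      by (simp add: ab daddx flip: add)
    have "a + b = int (n + p) - int (m + q)" by (simp add: ab)
    then show "zmul (a + b) x = zmul a x + zmul b x"
      by (simp only: ab dadd flip: add) (simp add: algebra_simps)
    have "a * b = int (n * p + m * q) - int (n * q + m * p)" by (simp add: ab algebra_simps)
    then show "zmul a (zmul b x) = zmul (a * b) x"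
      by (simp only: ab dadd dminus dmult flip: add) (simp add: algebra_simps)
    show "zmul 1 x = x" by (simp add: zmul_def)
  qed
qed

text \<open>\<open>\<Phi>\<close> is the whole type, \<open>psi\<close> is \<open>\<Psi>\<close>, \<open>simple_root i\<close> is \<open>\<alpha>\<^sub>i\<close>, \<open>lam i\<close> is \<open>\<lambda>\<^sub>i\<close>.\<close>

record ('i, 'p) root_datum =
  idx :: "'i set"
  psi :: "'p set"
  simple_root :: "'i \<Rightarrow> 'p"
  form :: "'p \<Rightarrow> 'p \<Rightarrow> rat"
  lam :: "'i \<Rightarrow> 'p \<Rightarrow> int"

definition is_root_datum :: "('i, 'p::ab_group_add) root_datum \<Rightarrow> bool" where
  "is_root_datum R \<longleftrightarrow>
     (\<exists>B. \<not> module.dependent zmul B \<and> module.span zmul B = (UNIV :: 'p set)) \<and>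
     inj_on (simple_root R) (idx R) \<and> \<not> module.dependent zmul (simple_root R ` idx R) \<and>
     psi R = module.span zmul (simple_root R ` idx R) \<and>
     (\<forall>x y. form R x y = form R y x) \<and>
     (\<forall>x y z. form R (x + y) z = form R x z + form R y z) \<and>
     (\<forall>i\<in>idx R. \<exists>n::nat. n > 0 \<and> form R (simple_root R i) (simple_root R i) = 2 * of_nat n) \<and>
     (\<forall>i\<in>idx R. \<forall>j\<in>idx R. i \<noteq> j \<longrightarrow> form R (simple_root R i) (simple_root R j) \<le> 0) \<and>
     (\<forall>i\<in>idx R. \<forall>x y. lam R i (x + y) = lam R i x + lam R i y) \<and>
     (\<forall>i\<in>idx R. \<forall>x. of_int (lam R i x) = 2 * form R (simple_root R i) x / form R (simple_root R i) (simple_root R i))"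

text \<open>The integer \<open>\<lambda>\<^sub>i(\<alpha>\<^sub>j)\<close>.\<close>

definition cartan :: "('i, 'p) root_datum \<Rightarrow> 'i \<Rightarrow> 'i \<Rightarrow> int" where
  "cartan R i j = lam R i (simple_root R j)"


section \<open>The Banach algebras \<open>\<H>\<^sub>0\<close>, \<open>T\<^sub>r(V\<^sub>0)\<close> and \<open>U\<^sup>\<plusminus>\<close>\<close>

record ('k, 'a) nalgebra = "('k, 'a) nspace" +
  mlt :: "'a \<Rightarrow> 'a \<Rightarrow> 'a"
  unt :: "'a"

text \<open>
  \<open>f n\<close> is the coefficient of \<open>H\<^sup>n\<close>; \<open>'i \<Rightarrow>\<^sub>0 nat\<close> is the type of finitely supported exponents.
\<close>

definition H0_alg :: "('k::field_char_0 \<Rightarrow> real) \<Rightarrow> 'i set \<Rightarrow> ('k, ('i \<Rightarrow>\<^sub>0 nat) \<Rightarrow> 'k) nalgebra" where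
  "H0_alg av I =
     nspace.extend (coprod1 {n. Poly_Mapping.keys n \<subseteq> I} (\<lambda>_. ground av))
       \<lparr>mlt = (\<lambda>f g n. \<Sum>(a, b)\<in>{(a, b). a + b = n}. f a * g b),
        unt = (\<lambda>n. if n = 0 then 1 else 0)\<rparr>"

definition H0_gen :: "'i \<Rightarrow> ('i \<Rightarrow>\<^sub>0 nat) \<Rightarrow> 'k::field_char_0" where
  "H0_gen i n = (if n = Poly_Mapping.single i 1 then 1 else 0)"

definition V0 :: "('k::field_char_0 \<Rightarrow> real) \<Rightarrow> 'i set \<Rightarrow> ('k, 'i \<Rightarrow> 'k) nspace" where
  "V0 av I = coprod1 I (\<lambda>_. ground av)"

text \<open>
  The \<open>n\<close>-fold completed tensor power of \<open>V0\<close>, on the basis of words of length \<open>n\<close>; that this is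
  the completed projective tensor product is the lemma \<open>V0_pow_is_completed_tensor\<close> below.
\<close>

definition V0_pow :: "('k::field_char_0 \<Rightarrow> real) \<Rightarrow> 'i set \<Rightarrow> nat \<Rightarrow> ('k, 'i list \<Rightarrow> 'k) nspace" where
  "V0_pow av I n = coprod1 {w. length w = n \<and> set w \<subseteq> I} (\<lambda>_. ground av)"

definition V0_tensor :: "('i \<Rightarrow> 'k::field_char_0) list \<Rightarrow> 'i list \<Rightarrow> 'k" where
  "V0_tensor fs w = (if length w = length fs then \<Prod>i<length fs. (fs ! i) (w ! i) else 0)"

text \<open>\<open>f n\<close> is the component in degree \<open>n\<close>; the product extends the concatenation of tensors.\<close>

definition T_alg ::
    "('k::field_char_0 \<Rightarrow> real) \<Rightarrow> 'i set \<Rightarrow> real \<Rightarrow> ('k, nat \<Rightarrow> 'i list \<Rightarrow> 'k) nalgebra" where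
  "T_alg av I r =
     nspace.extend (coprod1 UNIV (\<lambda>n. rescale (r ^ n) (V0_pow av I n)))
       \<lparr>mlt = (\<lambda>f g n w. \<Sum>m\<le>n. f m (take m w) * g (n - m) (drop m w)),
        unt = (\<lambda>n w. if n = 0 \<and> w = [] then 1 else 0)\<rparr>"

definition T_word :: "'i list \<Rightarrow> nat \<Rightarrow> 'i list \<Rightarrow> 'k::field_char_0" where
  "T_word u n w = (if n = length u \<and> w = u then 1 else 0)"

definition serre :: "('i, 'p) root_datum \<Rightarrow> 'i \<Rightarrow> 'i \<Rightarrow> nat \<Rightarrow> 'i list \<Rightarrow> 'k::field_char_0" where
  "serre R i j = (let N = nat (1 - cartan R i j) in
     \<Sum>m\<le>N. (\<lambda>n w. (- 1) ^ m * of_nat (N choose m) *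
                     T_word (replicate (N - m) i @ [j] @ replicate m i) n w))"

definition closed_ideal :: "('k::field_char_0, 'a::ab_group_add, 'z) nalgebra_scheme \<Rightarrow> 'a set \<Rightarrow> 'a set" where
  "closed_ideal A S = \<Inter>{J. J \<subseteq> carr A \<and> module.subspace (scl A) J \<and> norm_closed A J \<and>
     (\<forall>a\<in>carr A. \<forall>j\<in>J. mlt A a j \<in> J \<and> mlt A j a \<in> J) \<and> S \<subseteq> J}"

definition serre_ideal ::
    "('k::field_char_0 \<Rightarrow> real) \<Rightarrow> ('i, 'p) root_datum \<Rightarrow> real \<Rightarrow> (nat \<Rightarrow> 'i list \<Rightarrow> 'k) set" where
  "serre_ideal av R r =
     closed_ideal (T_alg av (idx R) r) {serre R i j |i j. i \<in> idx R \<and> j \<in> idx R \<and> i \<noteq> j}"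


section \<open>The analytic enveloping algebra and its Banach Lie algebra\<close>

definition banach_algebra ::
    "('k::field_char_0 \<Rightarrow> real) \<Rightarrow> ('k, 'u::ring_1, 'z) nspace_scheme \<Rightarrow> bool" where
  "banach_algebra av U \<longleftrightarrow>
     banach_space av U \<and> carr U = UNIV \<and>
     (\<forall>c x y. scl U c (x * y) = scl U c x * y \<and> scl U c (x * y) = x * scl U c y) \<and>
     (\<forall>x y. nrm U (x * y) \<le> nrm U x * nrm U y) \<and> nrm U 1 \<le> 1"

definition alg_hom ::
    "('k, 'a::ab_group_add, 'y) nalgebra_scheme \<Rightarrow> ('k, 'u::ring_1, 'z) nspace_scheme \<Rightarrow> ('a \<Rightarrow> 'u) \<Rightarrow> bool" where
  "alg_hom A U h \<longleftrightarrow>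
     (\<forall>x\<in>carr A. \<forall>y\<in>carr A. h (x + y) = h x + h y \<and> h (mlt A x y) = h x * h y) \<and>
     (\<forall>c. \<forall>x\<in>carr A. h (scl A c x) = scl U c (h x)) \<and> h (unt A) = 1"

text \<open>
  \<open>h\<close> induces an isometric isomorphism of the Banach algebra \<open>A/J\<close>, with the quotient norm, onto
  the subalgebra \<open>h ` carr A\<close> of \<open>U\<close>.
\<close>

definition embeds_quotient ::
    "('k, 'a::ab_group_add, 'y) nalgebra_scheme \<Rightarrow> 'a set \<Rightarrow> ('k, 'u::ring_1, 'z) nspace_scheme \<Rightarrow>
       ('a \<Rightarrow> 'u) \<Rightarrow> bool" where
  "embeds_quotient A J U h \<longleftrightarrow> alg_hom A U h \<and>
     (\<forall>x\<in>carr A. h x = 0 \<longleftrightarrow> x \<in> J) \<and> (\<forall>x\<in>carr A. nrm U (h x) = quot_norm A J x)"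

record ('k, 'u, 'i) envelope = "('k, 'u) nspace" +
  genF :: "'i \<Rightarrow> 'u"
  genH :: "'i \<Rightarrow> 'u"
  genE :: "'i \<Rightarrow> 'u"

definition lie_bracket :: "'u::ring_1 \<Rightarrow> 'u \<Rightarrow> 'u" where
  "lie_bracket x y = x * y - y * x"

text \<open>
  \<open>U\<close> is the Banach algebra \<open>U\<^sup>-\<^sub>r \<otimes> \<H>\<^sub>0 \<otimes> U\<^sup>+\<^sub>s\<close> (completed) with its generators. The three
  factors are given by their images in \<open>U\<close>, and the pure tensor of \<open>y, h, x\<close> is the product \<open>y h x\<close>.
  These conditions determine \<open>U\<close> up to a unique isometric isomorphism respecting the generators.
\<close>

definition is_U_an ::
    "('k::field_char_0 \<Rightarrow> real) \<Rightarrow> ('i, 'p) root_datum \<Rightarrow> real \<Rightarrow> real \<Rightarrow> ('k, 'u::ring_1, 'i) envelope \<Rightarrow> bool" where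
  "is_U_an av R r s U \<longleftrightarrow>
     banach_algebra av U \<and>
     (\<exists>hm h0 hp.
        embeds_quotient (T_alg av (idx R) r) (serre_ideal av R r) U hm \<and>
        embeds_quotient (H0_alg av (idx R)) {0} U h0 \<and>
        embeds_quotient (T_alg av (idx R) s) (serre_ideal av R s) U hp \<and>
        (\<forall>i\<in>idx R. genF U i = hm (T_word [i]) \<and> genH U i = h0 (H0_gen i) \<and> genE U i = hp (T_word [i])) \<and>
        is_completed_tensor av
          [subsp U (hm ` carr (T_alg av (idx R) r)), subsp U (h0 ` carr (H0_alg av (idx R))),
           subsp U (hp ` carr (T_alg av (idx R) s))] U prod_list) \<and>
     (\<forall>i\<in>idx R. \<forall>j\<in>idx R.
        lie_bracket (genH U i) (genE U j) = scl U (of_int (cartan R i j)) (genE U j) \<and>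
        lie_bracket (genH U i) (genF U j) = scl U (- of_int (cartan R i j)) (genF U j) \<and>
        lie_bracket (genE U i) (genF U j) = (if i = j then genH U i else 0))"

definition closed_lie_span :: "('k::field_char_0, 'u::ring_1, 'z) nspace_scheme \<Rightarrow> 'u set \<Rightarrow> 'u set" where
  "closed_lie_span U S = \<Inter>{L. module.subspace (scl U) L \<and> norm_closed U L \<and>
     (\<forall>x\<in>L. \<forall>y\<in>L. lie_bracket x y \<in> L) \<and> S \<subseteq> L}"

definition g_an :: "('i, 'p) root_datum \<Rightarrow> ('k::field_char_0, 'u::ring_1, 'i) envelope \<Rightarrow> ('k, 'u) nspace" where
  "g_an R U = subsp U (closed_lie_span U (genF U ` idx R \<union> genH U ` idx R \<union> genE U ` idx R))"


section \<open>Power series in \<open>\<hbar>\<close>\<close>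

text \<open>\<open>X{\<hbar>/\<epsilon>}\<close>; the product is the one of formal power series, with \<open>\<hbar>\<close> central.\<close>

definition hser :: "('k, 'a::ab_group_add, 'z) nspace_scheme \<Rightarrow> real \<Rightarrow> 'a fps set" where
  "hser X \<epsilon> = {a. (\<forall>n. fps_nth a n \<in> carr X) \<and> (\<lambda>n. nrm X (fps_nth a n) * \<epsilon> ^ n) \<longlonglongrightarrow> 0}"

definition hnorm :: "('k, 'a::ab_group_add, 'z) nspace_scheme \<Rightarrow> real \<Rightarrow> 'a fps \<Rightarrow> real" where
  "hnorm X \<epsilon> a = (SUP n. nrm X (fps_nth a n) * \<epsilon> ^ n)"

definition hscl :: "('k, 'a::ab_group_add, 'z) nspace_scheme \<Rightarrow> 'k fps \<Rightarrow> 'a fps \<Rightarrow> 'a fps" where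
  "hscl X c a = Abs_fps (\<lambda>n. \<Sum>i\<le>n. scl X (fps_nth c i) (fps_nth a (n - i)))"

text \<open>Morphisms \<open>U{\<hbar>/\<epsilon>} \<rightarrow> U'{\<hbar>/\<epsilon>}\<close> of \<open>k{\<hbar>/\<epsilon>}\<close>-algebras.\<close>

definition h_morphism ::
    "('k::field_char_0 \<Rightarrow> real) \<Rightarrow> ('k, 'u::ring_1, 'y) nspace_scheme \<Rightarrow> ('k, 'v::ring_1, 'z) nspace_scheme \<Rightarrow>
       real \<Rightarrow> ('u fps \<Rightarrow> 'v fps) \<Rightarrow> bool" where
  "h_morphism av U U' \<epsilon> \<alpha> \<longleftrightarrow>
     \<alpha> ` hser U \<epsilon> \<subseteq> hser U' \<epsilon> \<and>
     (\<forall>a\<in>hser U \<epsilon>. \<forall>b\<in>hser U \<epsilon>. \<alpha> (a + b) = \<alpha> a + \<alpha> b \<and> \<alpha> (a * b) = \<alpha> a * \<alpha> b) \<and>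
     (\<forall>c\<in>hser (ground av) \<epsilon>. \<forall>a\<in>hser U \<epsilon>. \<alpha> (hscl U c a) = hscl U' c (\<alpha> a)) \<and> \<alpha> 1 = 1 \<and>
     (\<exists>C. \<forall>a\<in>hser U \<epsilon>. hnorm U' \<epsilon> (\<alpha> a) \<le> C * hnorm U \<epsilon> a)"

definition h_contracting ::
    "('k, 'u::ring_1, 'y) nspace_scheme \<Rightarrow> ('k, 'v::ring_1, 'z) nspace_scheme \<Rightarrow> real \<Rightarrow> ('u fps \<Rightarrow> 'v fps) \<Rightarrow> bool" where
  "h_contracting U U' \<epsilon> \<alpha> \<longleftrightarrow> (\<forall>a\<in>hser U \<epsilon>. hnorm U' \<epsilon> (\<alpha> a) \<le> hnorm U \<epsilon> a)"

definition h_congruent :: "('k, 'u::ring_1, 'z) nspace_scheme \<Rightarrow> real \<Rightarrow> ('u fps \<Rightarrow> 'v::ring_1 fps) \<Rightarrow> ('u fps \<Rightarrow> 'v fps) \<Rightarrow> bool" where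
  "h_congruent U \<epsilon> \<alpha> \<alpha>' \<longleftrightarrow> (\<forall>a\<in>hser U \<epsilon>. fps_nth (\<alpha> a) 0 = fps_nth (\<alpha>' a) 0)"

text \<open>The map \<open>\<alpha>\<^sub>0 : U \<rightarrow> U'\<close> that \<open>\<alpha>\<close> induces modulo \<open>\<hbar>\<close>.\<close>

definition h_reduction :: "('u::ring_1 fps \<Rightarrow> 'v::ring_1 fps) \<Rightarrow> 'u \<Rightarrow> 'v" where
  "h_reduction \<alpha> u = fps_nth (\<alpha> (fps_const u)) 0"

text \<open>
  \<open>\<beta>\<close> is the base change of \<open>\<alpha>\<close> from \<open>k{\<hbar>/\<epsilon>}\<close> to \<open>k{\<hbar>/\<epsilon>'}\<close>, when the pure tensor of
  \<open>a\<close> and \<open>c\<close> is identified with \<open>c a\<close>. These products span a dense subspace of \<open>U{\<hbar>/\<epsilon>'}\<close>, so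
  there is at most one such morphism.
\<close>

definition is_base_change ::
    "('k::field_char_0 \<Rightarrow> real) \<Rightarrow> ('k, 'u::ring_1, 'y) nspace_scheme \<Rightarrow> ('k, 'v::ring_1, 'z) nspace_scheme \<Rightarrow>
       real \<Rightarrow> real \<Rightarrow> ('u fps \<Rightarrow> 'v fps) \<Rightarrow> ('u fps \<Rightarrow> 'v fps) \<Rightarrow> bool" where
  "is_base_change av U U' \<epsilon> \<epsilon>' \<alpha> \<beta> \<longleftrightarrow> h_morphism av U U' \<epsilon>' \<beta> \<and>
     (\<forall>a\<in>hser U \<epsilon>. \<forall>c\<in>hser (ground av) \<epsilon>'. \<beta> (hscl U c a) = hscl U' c (\<alpha> a))"


section \<open>Bounded Lie algebra cochains\<close>

text \<open>
  A cochain takes a list of \<open>n\<close> arguments from the Lie algebra \<open>G\<close> and is \<open>0\<close> on all other lists;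
  for \<open>n = 0\<close> it is its value at \<open>[]\<close>, an element of \<open>M\<close>. The action is \<open>act\<close>.
\<close>

definition tuples :: "('k, 'u, 'y) nspace_scheme \<Rightarrow> nat \<Rightarrow> 'u list set" where
  "tuples G n = {xs. length xs = n \<and> set xs \<subseteq> carr G}"

definition cochain_norm ::
    "('k, 'u, 'y) nspace_scheme \<Rightarrow> ('k, 'm, 'z) nspace_scheme \<Rightarrow> nat \<Rightarrow> ('u list \<Rightarrow> 'm) \<Rightarrow> real" where
  "cochain_norm G M n f =
     Inf {C. 0 \<le> C \<and> (\<forall>xs\<in>tuples G n. nrm M (f xs) \<le> C * (\<Prod>i<n. nrm G (xs ! i)))}"

definition cochains ::
    "('k, 'u::ab_group_add, 'y) nspace_scheme \<Rightarrow> ('k, 'm::ab_group_add, 'z) nspace_scheme \<Rightarrow> nat \<Rightarrow>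
       ('k, 'u list \<Rightarrow> 'm) nspace" where
  "cochains G M n =
     \<lparr>carr = {f. (\<forall>xs. xs \<notin> tuples G n \<longrightarrow> f xs = 0) \<and> (\<forall>xs\<in>tuples G n. f xs \<in> carr M) \<and>
         (\<forall>xs\<in>tuples G n. \<forall>i<n. \<forall>x\<in>carr G. \<forall>y\<in>carr G. f (xs[i := x + y]) = f (xs[i := x]) + f (xs[i := y])) \<and>
         (\<forall>xs\<in>tuples G n. \<forall>i<n. \<forall>x\<in>carr G. \<forall>c. f (xs[i := scl G c x]) = scl M c (f (xs[i := x]))) \<and>
         (\<forall>xs\<in>tuples G n. \<forall>i<n. \<forall>j<n. i \<noteq> j \<and> xs ! i = xs ! j \<longrightarrow> f xs = 0) \<and>
         (\<exists>C. \<forall>xs\<in>tuples G n. nrm M (f xs) \<le> C * (\<Prod>i<n. nrm G (xs ! i)))},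
      scl = (\<lambda>c f xs. scl M c (f xs)),
      nrm = cochain_norm G M n\<rparr>"

definition alt_sign :: "nat \<Rightarrow> 'm::ab_group_add \<Rightarrow> 'm" where
  "alt_sign n m = (if even n then m else - m)"

text \<open>
  Positions are counted from \<open>0\<close>, so \<open>(-1)\<^sup>i\<^sup>+\<^sup>1\<close> becomes \<open>(-1)\<^sup>i\<close>; \<open>nths xs (- A)\<close> omits the
  entries at the positions in \<open>A\<close>.
\<close>

definition cobound ::
    "('k, 'u::ring_1, 'y) nspace_scheme \<Rightarrow> ('u \<Rightarrow> 'm::ab_group_add \<Rightarrow> 'm) \<Rightarrow> nat \<Rightarrow> ('u list \<Rightarrow> 'm) \<Rightarrow> 'u list \<Rightarrow> 'm" where
  "cobound G act n f xs = (if xs \<in> tuples G (Suc n) then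
       (\<Sum>(i, j)\<in>{(i, j). i < j \<and> j < Suc n}. alt_sign (i + j) (f (lie_bracket (xs ! i) (xs ! j) # nths xs (- {i, j})))) +
       (\<Sum>i<Suc n. alt_sign i (act (xs ! i) (f (nths xs (- {i})))))
     else 0)"

definition cocycles ::
    "('k, 'u::ring_1, 'y) nspace_scheme \<Rightarrow> ('k, 'm::ab_group_add, 'z) nspace_scheme \<Rightarrow> ('u \<Rightarrow> 'm \<Rightarrow> 'm) \<Rightarrow> nat \<Rightarrow>
       ('u list \<Rightarrow> 'm) set" where
  "cocycles G M act n = {f \<in> carr (cochains G M n). cobound G act n f = 0}"

text \<open>
  Strict exactness at the term of degree \<open>n \<ge> 1\<close>. The induced map sends the class of \<open>f\<close> to
  \<open>cobound G act (n - 1) f\<close>; being a bijection onto the image, it is an isomorphism of Banach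
  spaces when it and its inverse are bounded.
\<close>

definition strictly_exact_at ::
    "('k, 'u::ring_1, 'y) nspace_scheme \<Rightarrow> ('k, 'm::ab_group_add, 'z) nspace_scheme \<Rightarrow> ('u \<Rightarrow> 'm \<Rightarrow> 'm) \<Rightarrow> nat \<Rightarrow> bool" where
  "strictly_exact_at G M act n \<longleftrightarrow>
     cocycles G M act n = cobound G act (n - 1) ` carr (cochains G M (n - 1)) \<and>
     (\<exists>C. \<forall>f\<in>carr (cochains G M (n - 1)).
        nrm (cochains G M n) (cobound G act (n - 1) f)
          \<le> C * quot_norm (cochains G M (n - 1)) (cocycles G M act (n - 1)) f) \<and>
     (\<exists>C. \<forall>f\<in>carr (cochains G M (n - 1)).
        quot_norm (cochains G M (n - 1)) (cocycles G M act (n - 1)) f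
          \<le> C * nrm (cochains G M n) (cobound G act (n - 1) f))"

text \<open>The inverse of that isomorphism has norm at most 1.\<close>

definition inverse_contracting ::
    "('k, 'u::ring_1, 'y) nspace_scheme \<Rightarrow> ('k, 'm::ab_group_add, 'z) nspace_scheme \<Rightarrow> ('u \<Rightarrow> 'm \<Rightarrow> 'm) \<Rightarrow> nat \<Rightarrow> bool" where
  "inverse_contracting G M act n \<longleftrightarrow>
     (\<forall>f\<in>carr (cochains G M (n - 1)).
        quot_norm (cochains G M (n - 1)) (cocycles G M act (n - 1)) f
          \<le> nrm (cochains G M n) (cobound G act (n - 1) f))"


section \<open>\<open>V0_pow\<close> is the completed tensor power of \<open>V0\<close>\<close>

lemma module_pm: "module (\<lambda>c::'k::field_char_0. Poly_Mapping.map ((*) c) :: ('x \<Rightarrow>\<^sub>0 'k) \<Rightarrow> _)"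
proof -
  have l: "Poly_Mapping.lookup (Poly_Mapping.map ((*) c) z) x = c * Poly_Mapping.lookup z x" for c :: 'k and z :: "'x \<Rightarrow>\<^sub>0 'k" and x
    by (auto simp: Poly_Mapping.map.rep_eq when_def)
  show ?thesis
    by standard (auto intro!: poly_mapping_eqI simp: l lookup_add algebra_simps)
qed

lemma lookup_pm_scale: "Poly_Mapping.lookup (Poly_Mapping.map ((*) c) z) x = c * Poly_Mapping.lookup z x" for c :: "'k::field_char_0"
  by (auto simp: Poly_Mapping.map.rep_eq when_def)

context complete_nonarch_field
begin

lemma av_0: "av 0 = 0" by (simp add: av_eq_0_iff)
lemma av_1: "av 1 = 1"
proof -
  have "av 1 * av 1 = av 1 * 1" using av_mult[of 1 1] by simp
  then show ?thesis by (subst (asm) mult_cancel_left) (simp add: av_eq_0_iff)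
qed
lemma av_minus: "av (- x) = av x"
proof -
  have "av (-1) * av (-1) = 1" using av_mult[of "-1" "-1"] by (simp add: av_1)
  then have "(av (-1))\<^sup>2 = 1" by (simp add: power2_eq_square)
  then have "av (-1) = 1" using av_nonneg[of "-1"] by (auto simp: power2_eq_1_iff)
  then show ?thesis using av_mult[of "-1" x] by simp
qed
lemma av_diff_le: "av (x - y) \<le> max (av x) (av y)"
  using av_ultra[of x "- y"] by (simp add: av_minus)
lemma av_sum_le: "finite S \<Longrightarrow> 0 \<le> B \<Longrightarrow> (\<And>i. i \<in> S \<Longrightarrow> av (f i) \<le> B) \<Longrightarrow> av (sum f S) \<le> B"
proof (induction S rule: finite_induct)
  case empty then show ?case by (simp add: av_0)
next
  case (insert i S)
  then show ?case using av_ultra[of "f i" "sum f S"] by (auto simp: max_def split: if_splits intro: order_trans)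
qed
lemma av_prod: "av (prod f S) = (\<Prod>i\<in>S. av (f i))"
  by (induction S rule: infinite_finite_induct) (simp_all add: av_1 av_mult)

abbreviation (input) c0 :: "'n set \<Rightarrow> ('k, 'n \<Rightarrow> 'k) nspace" where
  "c0 N \<equiv> coprod1 N (\<lambda>_. ground av)"

lemma c0_carr: "f \<in> carr (c0 N) \<longleftrightarrow> (\<forall>n. n \<notin> N \<longrightarrow> f n = 0) \<and> (\<forall>e>0. finite {n \<in> N. e \<le> av (f n)})"
  and c0_scl: "scl (c0 N) = (\<lambda>c f n. c * f n)"
  by (simp_all add: coprod1_def ground_def)

lemma c0_nrm_ge:
  assumes "f \<in> carr (c0 N)" shows "av (f n) \<le> nrm (c0 N) f" and "0 \<le> nrm (c0 N) f"
proof -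
  have fin: "finite {n \<in> N. 1 \<le> av (f n)}" using assms by (simp add: c0_carr)
  have "(\<lambda>n. av (f n)) ` N \<subseteq> (\<lambda>n. av (f n)) ` {n \<in> N. 1 \<le> av (f n)} \<union> {0..1}"
    using av_nonneg by auto
  then have bdd: "bdd_above (insert 0 ((\<lambda>n. av (f n)) ` N))"
    using bdd_above_mono[of "(\<lambda>n. av (f n)) ` {n \<in> N. 1 \<le> av (f n)} \<union> {0..1}"] fin by simp
  show *: "0 \<le> nrm (c0 N) f"
    using bdd by (simp add: coprod1_def ground_def cSup_upper)
  show "av (f n) \<le> nrm (c0 N) f"
  proof (cases "n \<in> N")
    case True then show ?thesis using bdd by (auto simp: coprod1_def ground_def intro!: cSup_upper)
  next
    case False then show ?thesis using assms * by (simp add: c0_carr av_0)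
  qed
qed

lemma c0_nrm_le: "0 \<le> B \<Longrightarrow> (\<And>n. n \<in> N \<Longrightarrow> av (f n) \<le> B) \<Longrightarrow> nrm (c0 N) f \<le> B"
  by (auto simp: coprod1_def ground_def intro!: cSup_least)

lemma c0_vs: "vector_space (scl (c0 N))"
  by standard (auto simp: c0_scl algebra_simps fun_eq_iff)

lemma c0_subspace: "module.subspace (scl (c0 N)) (carr (c0 N))"
proof -
  interpret vector_space "scl (c0 N)" by (rule c0_vs)
  show ?thesis
  proof (rule subspaceI)
    show "0 \<in> carr (c0 N)" by (auto simp: c0_carr av_0)
    fix x y assume x: "x \<in> carr (c0 N)" and y: "y \<in> carr (c0 N)"
    have "finite {n \<in> N. e \<le> av (x n + y n)}" if "e > 0" for e
      by (rule finite_subset[of _ "{n \<in> N. e \<le> av (x n)} \<union> {n \<in> N. e \<le> av (y n)}"])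
        (use x y that in \<open>auto simp: c0_carr\<close>, smt (verit) av_ultra)
    then show "x + y \<in> carr (c0 N)" using x y by (simp add: c0_carr)
    fix c
    show "scl (c0 N) c x \<in> carr (c0 N)"
    proof (cases "c = 0")
      case True then show ?thesis by (auto simp: c0_carr c0_scl av_0)
    next
      case False
      then have pos: "av c > 0" using av_nonneg[of c] av_eq_0_iff[of c] by linarith
      have "{n \<in> N. e \<le> av (c * x n)} = {n \<in> N. e / av c \<le> av (x n)}" for e
        using pos by (auto simp: av_mult field_simps)
      then show ?thesis using x pos by (simp add: c0_carr c0_scl)
    qed
  qed
qed

lemma c0_complete:
  assumes X: "\<And>n. X n \<in> carr (c0 N)"
    and C: "\<forall>e>0. \<exists>M. \<forall>m\<ge>M. \<forall>n\<ge>M. nrm (c0 N) (X m - X n) < e"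
  shows "\<exists>x\<in>carr (c0 N). (\<lambda>n. nrm (c0 N) (X n - x)) \<longlonglongrightarrow> 0"
proof -
  interpret vector_space "scl (c0 N)" by (rule c0_vs)
  have sub: "X m - X n \<in> carr (c0 N)" for m n
    by (rule subspace_diff[OF c0_subspace X X])
  have pt: "av (X m w - X n w) \<le> nrm (c0 N) (X m - X n)" for m n w
    using c0_nrm_ge(1)[OF sub, of m n w] by simp
  have "\<exists>l. (\<lambda>n. av (X n w - l)) \<longlonglongrightarrow> 0" for w
  proof (rule av_complete, intro allI impI)
    fix e :: real assume "e > 0"
    then obtain M where M: "\<forall>m\<ge>M. \<forall>n\<ge>M. nrm (c0 N) (X m - X n) < e" using C by blast
    show "\<exists>M. \<forall>m\<ge>M. \<forall>n\<ge>M. av (X m w - X n w) < e"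
      using M pt by (meson le_less_trans)
  qed
  then obtain l where l: "\<And>w. (\<lambda>n. av (X n w - l w)) \<longlonglongrightarrow> 0" by metis
  have unif: "\<exists>M. \<forall>m\<ge>M. \<forall>w. av (X m w - l w) \<le> e" if epos: "e > 0" for e
  proof -
    obtain M where M: "\<forall>m\<ge>M. \<forall>n\<ge>M. nrm (c0 N) (X m - X n) < e" using C epos by blast
    have "av (X m w - l w) \<le> e" if "m \<ge> M" for m w
    proof -
      have "\<forall>\<^sub>F n in sequentially. av (X n w - l w) < e"
        using order_tendstoD(2)[OF l \<open>e > 0\<close>] .
      then obtain n0 where "\<forall>n\<ge>n0. av (X n w - l w) < e" by (auto simp: eventually_sequentially)
      then have n: "max M n0 \<ge> M" "av (X (max M n0) w - l w) < e" by auto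
      define n where "n = max M n0"
      note n = n[folded n_def]
      have "av (X m w - X n w) < e" using M pt that n(1) by (meson le_less_trans)
      then show ?thesis using av_ultra[of "X m w - X n w" "X n w - l w"] n(2) by simp
    qed
    then show ?thesis by blast
  qed
  have lc: "l \<in> carr (c0 N)"
    unfolding c0_carr
  proof (intro conjI allI impI)
    fix w assume w: "w \<notin> N"
    then have "\<And>n. X n w = 0" using X by (simp add: c0_carr)
    then have "(\<lambda>n::nat. av (l w)) \<longlonglongrightarrow> 0" using l[of w] by (simp add: av_minus)
    then show "l w = 0" by (simp add: LIMSEQ_const_iff av_eq_0_iff)
  next
    fix e :: real assume e: "e > 0"
    then obtain M where M: "\<And>w. av (X M w - l w) \<le> e / 2" using unif[of "e / 2"] by force
    have "e \<le> av (X M w)" if "e \<le> av (l w)" for w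
      using that M[of w] e av_diff_le[of "X M w" "X M w - l w"] by (auto simp: max_def split: if_splits)
    then have "{n \<in> N. e \<le> av (l n)} \<subseteq> {n \<in> N. e \<le> av (X M n)}" by auto
    then show "finite {n \<in> N. e \<le> av (l n)}"
      using X[of M] e by (auto simp: c0_carr intro: finite_subset)
  qed
  have "(\<lambda>n. nrm (c0 N) (X n - l)) \<longlonglongrightarrow> 0"
  proof (rule LIMSEQ_I)
    fix e :: real assume e: "e > 0"
    then obtain M where M: "\<forall>m\<ge>M. \<forall>w. av (X m w - l w) \<le> e / 2" using unif[of "e / 2"] by force
    have "norm (nrm (c0 N) (X n - l) - 0) < e" if "n \<ge> M" for n
    proof -
      have "nrm (c0 N) (X n - l) \<le> e / 2" by (rule c0_nrm_le) (use M that e in auto)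
      moreover have "0 \<le> nrm (c0 N) (X n - l)"
        by (rule c0_nrm_ge(2)[OF subspace_diff[OF c0_subspace X lc]])
      ultimately show ?thesis using e by simp
    qed
    then show "\<exists>M. \<forall>n\<ge>M. norm (nrm (c0 N) (X n - l) - 0) < e" by blast
  qed
  with lc show ?thesis by blast
qed

lemma banach_c0: "banach_space av (c0 N)"
  unfolding banach_space_def
proof (intro conjI ballI allI impI c0_vs c0_subspace)
  interpret vector_space "scl (c0 N)" by (rule c0_vs)
  fix x assume x: "x \<in> carr (c0 N)"
  show "0 \<le> nrm (c0 N) x" by (rule c0_nrm_ge(2)[OF x])
  show "nrm (c0 N) x = 0 \<longleftrightarrow> x = 0"
  proof
    assume "nrm (c0 N) x = 0"
    then have "av (x n) = 0" for n using c0_nrm_ge(1)[OF x, of n] av_nonneg[of "x n"] by simp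
    then show "x = 0" by (auto simp: av_eq_0_iff)
  next
    assume "x = 0"
    then show "nrm (c0 N) x = 0" using c0_nrm_le[of 0 N x] c0_nrm_ge(2)[OF x] by (simp add: av_0)
  qed
  fix c
  have cx: "scl (c0 N) c x \<in> carr (c0 N)" using c0_subspace x by (rule subspace_scale)
  show "nrm (c0 N) (scl (c0 N) c x) = av c * nrm (c0 N) x"
  proof (rule antisym)
    show "nrm (c0 N) (scl (c0 N) c x) \<le> av c * nrm (c0 N) x"
      by (rule c0_nrm_le) (auto simp: c0_scl av_mult c0_nrm_ge[OF x] av_nonneg intro!: mult_left_mono)
    show "av c * nrm (c0 N) x \<le> nrm (c0 N) (scl (c0 N) c x)"
    proof (cases "c = 0")
      case True then show ?thesis using c0_nrm_ge(2)[OF cx] by (simp add: av_0)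
    next
      case False
      then have pos: "av c > 0" using av_nonneg[of c] av_eq_0_iff[of c] by linarith
      have "nrm (c0 N) x \<le> nrm (c0 N) (scl (c0 N) c x) / av c"
        by (rule c0_nrm_le) (use pos c0_nrm_ge[OF cx] in \<open>auto simp: c0_scl av_mult field_simps\<close>)
      then show ?thesis using pos by (simp add: field_simps)
    qed
  qed
next
  fix x y assume x: "x \<in> carr (c0 N)" and y: "y \<in> carr (c0 N)"
  show "nrm (c0 N) (x + y) \<le> max (nrm (c0 N) x) (nrm (c0 N) y)"
  proof (rule c0_nrm_le)
    fix n
    show "av ((x + y) n) \<le> max (nrm (c0 N) x) (nrm (c0 N) y)"
      using av_ultra[of "x n" "y n"] c0_nrm_ge(1)[OF x, of n] c0_nrm_ge(1)[OF y, of n] by auto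
  qed (use c0_nrm_ge(2)[OF x] in auto)
next
  fix X :: "nat \<Rightarrow> _"
  assume "(\<forall>n. X n \<in> carr (c0 N)) \<and> (\<forall>e>0. \<exists>M. \<forall>m\<ge>M. \<forall>n\<ge>M. nrm (c0 N) (X m - X n) < e)"
  then show "\<exists>x\<in>carr (c0 N). (\<lambda>n. nrm (c0 N) (X n - x)) \<longlonglongrightarrow> 0"
    using c0_complete by blast
qed

end

lemma tens_ext_finite:
  assumes "module (scl X)" "finite S" "Poly_Mapping.keys z \<subseteq> S"
  shows "tens_ext X t z = (\<Sum>xs\<in>S. scl X (Poly_Mapping.lookup z xs) (t xs))"
proof -
  interpret module "scl X" by fact
  show ?thesis unfolding tens_ext_def
    by (rule sum.mono_neutral_left) (use assms in \<open>auto simp: in_keys_iff\<close>)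
qed

lemma tens_ext_add:
  assumes "module (scl X)"
  shows "tens_ext X t (y + z) = tens_ext X t y + tens_ext X t z"
proof -
  interpret module "scl X" by fact
  let ?S = "Poly_Mapping.keys y \<union> Poly_Mapping.keys z"
  have "Poly_Mapping.keys (y + z) \<subseteq> ?S" by (rule Poly_Mapping.keys_add)
  then show ?thesis
    using tens_ext_finite[OF assms, of ?S] by (simp add: lookup_add scale_left_distrib sum.distrib)
qed

lemma tens_ext_scale:
  assumes "module (scl X)"
  shows "tens_ext X t (Poly_Mapping.map ((*) c) z) = scl X c (tens_ext X t z)"
proof -
  interpret module "scl X" by fact
  have "Poly_Mapping.keys (Poly_Mapping.map ((*) c) z) \<subseteq> Poly_Mapping.keys z"
    by (auto simp: in_keys_iff lookup_pm_scale)
  then show ?thesis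
    using tens_ext_finite[OF assms, of "Poly_Mapping.keys z"]
    by (simp add: lookup_pm_scale scale_sum_right)
qed

lemma tens_ext_single:
  assumes "module (scl X)"
  shows "tens_ext X t (Poly_Mapping.single xs c) = scl X c (t xs)"
proof -
  interpret module "scl X" by fact
  show ?thesis
    using tens_ext_finite[OF assms, of "{xs}" "Poly_Mapping.single xs c"] by (simp add: )
qed

lemma tens_ext_diff:
  assumes "module (scl X)"
  shows "tens_ext X t (y - z) = tens_ext X t y - tens_ext X t z"
  using tens_ext_add[OF assms, of t "y - z" z] by (simp add: algebra_simps)

lemma tens_ext_sum:
  assumes "module (scl X)"
  shows "tens_ext X t (sum f S) = (\<Sum>i\<in>S. tens_ext X t (f i))"
proof -
  have "tens_ext X t 0 = 0" by (simp add: tens_ext_def)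
  then show ?thesis
    by (induction S rule: infinite_finite_induct) (simp_all add: tens_ext_add[OF assms])
qed

lemma V0_tensor_update:
  assumes "i < length xs"
  shows "V0_tensor (xs[i := x]) w =
    (if length w = length xs then x (w ! i) * (\<Prod>j\<in>{..<length xs} - {i}. (xs ! j) (w ! j)) else 0)"
proof -
  have "(\<Prod>j<length xs. (xs[i := x] ! j) (w ! j)) =
        (xs[i := x] ! i) (w ! i) * (\<Prod>j\<in>{..<length xs} - {i}. (xs[i := x] ! j) (w ! j))"
    using assms by (intro prod.remove) auto
  also have "(\<Prod>j\<in>{..<length xs} - {i}. (xs[i := x] ! j) (w ! j)) = (\<Prod>j\<in>{..<length xs} - {i}. (xs ! j) (w ! j))"
    by (rule prod.cong) auto
  finally show ?thesis using assms by (simp add: V0_tensor_def)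
qed

lemma V0_tensor_append:
  assumes "length w = length fs + length gs"
  shows "V0_tensor (fs @ gs) w = V0_tensor fs (take (length fs) w) * V0_tensor gs (drop (length fs) w)"
proof -
  have "(\<Prod>i<length fs + length gs. ((fs @ gs) ! i) (w ! i)) =
        (\<Prod>i<length fs. (fs ! i) (w ! i)) * (\<Prod>i<length gs. (gs ! i) (w ! (length fs + i)))"
    (is "?l (length gs) = ?r (length gs)")
  proof -
    have "m \<le> length gs \<Longrightarrow> ?l m = ?r m" for m
      by (induction m) (simp_all add: nth_append mult.assoc)
    then show ?thesis by simp
  qed
  then show ?thesis using assms by (simp add: V0_tensor_def)
qed

context complete_nonarch_field
begin

lemma mod_pow: "module (scl (V0_pow av I n))"
  unfolding V0_pow_def module_iff_vector_space by (rule c0_vs)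

lemma tens_dom_V0:
  "fs \<in> tens_dom (replicate n (V0 av I)) \<longleftrightarrow> length fs = n \<and> set fs \<subseteq> carr (V0 av I)"
  by (auto simp: tens_dom_def in_set_conv_nth subset_iff)

lemma V0_tensor_carr:
  "set fs \<subseteq> carr (V0 av I) \<Longrightarrow> V0_tensor fs \<in> carr (V0_pow av I (length fs))"
proof (induction fs)
  case Nil
  have "{n. n = [] \<and> set n \<subseteq> I \<and> e \<le> av (V0_tensor [] n)} \<subseteq> {[]}" for e by auto
  then have "finite {n. n = [] \<and> set n \<subseteq> I \<and> e \<le> av (V0_tensor [] n)}" for e
    using finite_subset by blast
  then show ?case unfolding V0_pow_def c0_carr by (simp add: V0_tensor_def)
next
  case (Cons f fs)
  let ?n = "length fs"
  let ?P = "c0 {w. length w = ?n \<and> set w \<subseteq> I}"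
  have f: "f \<in> carr (c0 I)" and t: "V0_tensor fs \<in> carr ?P"
    using Cons by (auto simp: V0_def V0_pow_def)
  have cons: "V0_tensor (f # fs) (i # w) = f i * V0_tensor fs w" for i w
    by (simp add: V0_tensor_def prod.lessThan_Suc_shift del: prod.lessThan_Suc)
  define A where "A = nrm (c0 I) f + 1"
  define B where "B = nrm ?P (V0_tensor fs) + 1"
  have A: "A > 0" "\<And>i. av (f i) \<le> A" using c0_nrm_ge[OF f] by (auto simp: A_def add_increasing2 intro: add_nonneg_pos)
  have B: "B > 0" "\<And>i. av (V0_tensor fs i) \<le> B" using c0_nrm_ge[OF t] by (auto simp: B_def add_increasing2 intro: add_nonneg_pos)
  show ?case
    unfolding V0_pow_def c0_carr
  proof (intro conjI allI impI)
    fix w assume w: "w \<notin> {w. length w = length (f # fs) \<and> set w \<subseteq> I}"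
    show "V0_tensor (f # fs) w = 0"
    proof (cases "length w = length (f # fs)")
      case True
      then obtain i v where iv: "w = i # v" by (cases w) auto
      from w True iv have "i \<notin> I \<or> \<not> set v \<subseteq> I" by auto
      then show ?thesis using f t unfolding iv cons c0_carr by auto
    qed (simp add: V0_tensor_def)
  next
    fix e :: real assume e: "e > 0"
    have "{w \<in> {w. length w = length (f # fs) \<and> set w \<subseteq> I}. e \<le> av (V0_tensor (f # fs) w)}
      \<subseteq> (\<lambda>(i, w). i # w) ` ({i \<in> I. e / B \<le> av (f i)} \<times> {w \<in> {w. length w = ?n \<and> set w \<subseteq> I}. e / A \<le> av (V0_tensor fs w)})"
    proof safe
      fix w assume w: "length w = length (f # fs)" "set w \<subseteq> I" "e \<le> av (V0_tensor (f # fs) w)"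
      then obtain i v where iv: "w = i # v" by (cases w) auto
      have le: "e \<le> av (f i) * av (V0_tensor fs v)" using w(3) by (simp add: iv cons av_mult)
      have "av (f i) * av (V0_tensor fs v) \<le> av (f i) * B" "av (f i) * av (V0_tensor fs v) \<le> A * av (V0_tensor fs v)"
        using A B av_nonneg by (auto intro: mult_left_mono mult_right_mono)
      with le A B have "e / B \<le> av (f i)" "e / A \<le> av (V0_tensor fs v)" by (auto simp: field_simps)
      then show "w \<in> (\<lambda>(i, w). i # w) ` ({i \<in> I. e / B \<le> av (f i)} \<times> {w \<in> {w. length w = ?n \<and> set w \<subseteq> I}. e / A \<le> av (V0_tensor fs w)})"
        using w iv by auto
    qed
    moreover have "finite {i \<in> I. e / B \<le> av (f i)}" "finite {w \<in> {w. length w = ?n \<and> set w \<subseteq> I}. e / A \<le> av (V0_tensor fs w)}"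
      using f t e A(1) B(1) unfolding c0_carr by (auto simp del: mem_Collect_eq)
    ultimately show "finite {w \<in> {w. length w = length (f # fs) \<and> set w \<subseteq> I}. e \<le> av (V0_tensor (f # fs) w)}"
      by (rule finite_subset[OF _ finite_imageI[OF finite_cartesian_product]])
  qed
qed

lemma V0_tensor_norm:
  assumes "set fs \<subseteq> carr (V0 av I)"
  shows "av (V0_tensor fs w) \<le> (\<Prod>i<length fs. nrm (V0 av I) (fs ! i))"
proof (cases "length w = length fs")
  case True
  then show ?thesis using assms
    by (auto simp: V0_tensor_def av_prod V0_def subset_iff av_nonneg intro!: prod_mono c0_nrm_ge)
next
  case False
  then show ?thesis using assms
    by (auto simp: V0_tensor_def av_0 V0_def subset_iff intro!: prod_nonneg c0_nrm_ge)
qed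

lemma tens_ext_rel:
  assumes "z \<in> tens_rel (replicate n (V0 av I))"
  shows "tens_ext (V0_pow av I n) V0_tensor z = 0"
proof -
  interpret pm: module "\<lambda>c::'k. Poly_Mapping.map ((*) c) :: (('i \<Rightarrow> 'k) list \<Rightarrow>\<^sub>0 'k) \<Rightarrow> _" by (rule module_pm)
  note M = mod_pow[of I n]
  interpret M: module "scl (V0_pow av I n)" by (rule M)
  have s0: "scl (V0_pow av I n) c (\<lambda>_. 0) = (\<lambda>_. 0)" for c
    by (simp add: V0_pow_def c0_scl)
  show ?thesis
    using assms unfolding tens_rel_def
  proof (induction rule: pm.span_induct)
    case base
    show ?case
      by (rule pm.subspaceI) (simp_all add: tens_ext_add[OF M] tens_ext_scale[OF M] tens_ext_def[of _ _ 0] zero_fun_def times_fun_def s0)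
  next
    case (step z)
    then show ?case
      unfolding Un_iff mem_Collect_eq tens_dom_V0 length_replicate
    proof (elim disjE exE conjE, goal_cases)
      case (1 xs i x y)
      then have "V0_tensor (xs[i := x + y]) w = V0_tensor (xs[i := x]) w + V0_tensor (xs[i := y]) w" for w
        by (simp add: V0_tensor_update algebra_simps)
      then show ?thesis
        unfolding 1(1) tens_ext_diff[OF M] tens_ext_single[OF M]
        by (simp add: V0_pow_def c0_scl fun_eq_iff)
    next
      case (2 xs i x c)
      then have "V0_tensor (xs[i := scl (V0 av I) c x]) w = c * V0_tensor (xs[i := x]) w" for w
        by (simp add: V0_tensor_update V0_def c0_scl)
      then show ?thesis
        using 2(4) unfolding 2(1) tens_ext_diff[OF M] tens_ext_single[OF M]
        by (simp add: V0_pow_def c0_scl fun_eq_iff)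
    qed
  qed
qed

definition basis_vec :: "'i \<Rightarrow> 'i \<Rightarrow> 'k" where
  "basis_vec i = (\<lambda>j. if j = i then 1 else 0)"

lemma V0_tensor_basis: "V0_tensor (map basis_vec w) v = (if v = w then 1 else 0)"
proof (cases "length v = length w")
  case True
  show ?thesis
  proof (cases "v = w")
    case True
    have "(\<Prod>i<length w. (map basis_vec w ! i) (w ! i)) = 1"
      by (rule prod.neutral) (simp add: basis_vec_def)
    with True show ?thesis by (simp add: V0_tensor_def)
  next
    case False
    then obtain i where i: "i < length w" "v ! i \<noteq> w ! i"
      using nth_equalityI[of v w] \<open>length v = length w\<close> by auto
    have "(\<Prod>i<length w. (map basis_vec w ! i) (v ! i)) = 0"
      by (rule prod_zero) (use i in \<open>simp, intro bexI[of _ i], simp_all add: basis_vec_def\<close>)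
    with False show ?thesis by (simp add: V0_tensor_def)
  qed
next
  case False
  then have "v \<noteq> w" by auto
  with False show ?thesis by (simp add: V0_tensor_def)
qed

lemma basis_vec_carr: "i \<in> I \<Longrightarrow> basis_vec i \<in> carr (V0 av I)"
  and basis_vec_norm: "nrm (V0 av I) (basis_vec i) \<le> 1"
proof -
  assume i: "i \<in> I"
  have "finite {n \<in> I. e \<le> av (basis_vec i n)}" if "e > 0" for e
    by (rule finite_subset[of _ "{i}"]) (use that in \<open>auto simp: basis_vec_def av_0 split: if_splits\<close>)
  then show "basis_vec i \<in> carr (V0 av I)" using i unfolding V0_def c0_carr by (auto simp: basis_vec_def)
next
  show "nrm (V0 av I) (basis_vec i) \<le> 1"
    unfolding V0_def by (rule c0_nrm_le) (auto simp: basis_vec_def av_0 av_1)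
qed

end

context complete_nonarch_field
begin

lemma rep_size_le_iff:
  "rep_size av Vs y \<le> B \<longleftrightarrow> 0 \<le> B \<and>
     (\<forall>xs\<in>Poly_Mapping.keys y. av (Poly_Mapping.lookup y xs) * (\<Prod>i<length Vs. nrm (Vs ! i) (xs ! i)) \<le> B)"
  unfolding rep_size_def by (subst Max_le_iff) auto

lemma rep_size_nonneg: "0 \<le> rep_size av Vs y"
  using rep_size_le_iff[of Vs y "rep_size av Vs y"] by simp

end

locale V0_power = complete_nonarch_field av for av :: "'k::field_char_0 \<Rightarrow> real" +
  fixes I :: "'i set" and n :: nat
begin

abbreviation "Vs \<equiv> replicate n (V0 av I)"
abbreviation "D \<equiv> tens_dom Vs"
abbreviation "N \<equiv> tens_rel Vs"
abbreviation "P \<equiv> V0_pow av I n"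
abbreviation "W \<equiv> {w. length w = n \<and> set w \<subseteq> I}"
abbreviation "ext \<equiv> tens_ext P V0_tensor"

sublocale pm: module "\<lambda>c::'k. Poly_Mapping.map ((*) c) :: (('i \<Rightarrow> 'k) list \<Rightarrow>\<^sub>0 'k) \<Rightarrow> _"
  by (rule module_pm)

lemma N_subspace: "pm.subspace N"
  unfolding tens_rel_def by (rule pm.subspace_span)

lemmas N_add = pm.subspace_add[OF N_subspace] and N_diff = pm.subspace_diff[OF N_subspace]
  and N_0 = pm.subspace_0[OF N_subspace] and N_scale = pm.subspace_scale[OF N_subspace]

lemma map_single: "Poly_Mapping.map ((*) c) (Poly_Mapping.single x d) = Poly_Mapping.single x (c * d)" for c d :: 'k
  by (rule poly_mapping_eqI) (simp add: lookup_pm_scale lookup_single when_def)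

lemma rel_add:
  assumes "xs \<in> D" "i < n" "x \<in> carr (V0 av I)" "y \<in> carr (V0 av I)"
  shows "Poly_Mapping.single (xs[i := x + y]) c - Poly_Mapping.single (xs[i := x]) c - Poly_Mapping.single (xs[i := y]) c \<in> N"
proof -
  have "Poly_Mapping.single (xs[i := x + y]) 1 - Poly_Mapping.single (xs[i := x]) 1 - Poly_Mapping.single (xs[i := y]) 1 \<in> N"
    unfolding tens_rel_def by (rule pm.span_base, rule UnI1, rule CollectI, intro exI conjI, rule refl) (use assms in auto)
  from N_scale[OF this, of c] show ?thesis by (simp add: pm.scale_right_diff_distrib map_single)
qed

lemma rel_scale:
  assumes "xs \<in> D" "i < n" "x \<in> carr (V0 av I)"
  shows "Poly_Mapping.single (xs[i := scl (V0 av I) a x]) c - Poly_Mapping.single (xs[i := x]) (c * a) \<in> N"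
proof -
  have "Poly_Mapping.single (xs[i := scl (Vs ! i) a x]) 1 - Poly_Mapping.single (xs[i := x]) a \<in> N"
    unfolding tens_rel_def by (rule pm.span_base, rule UnI2, rule CollectI, intro exI conjI, rule refl) (use assms in auto)
  from N_scale[OF this, of c] show ?thesis using assms by (simp add: pm.scale_right_diff_distrib map_single)
qed

lemma V0_subspace: "module.subspace (scl (V0 av I)) (carr (V0 av I))"
  and V0_module: "module (scl (V0 av I))"
  unfolding V0_def module_iff_vector_space by (rule c0_subspace, rule c0_vs)

lemma D_update: "xs \<in> D \<Longrightarrow> x \<in> carr (V0 av I) \<Longrightarrow> xs[i := x] \<in> D"
  using set_update_subset_insert[of xs i x] by (auto simp: tens_dom_V0)

lemma rel_sum:
  assumes xs: "xs \<in> D" and i: "i < n" and "finite S" and x: "\<And>j. j \<in> S \<Longrightarrow> x j \<in> carr (V0 av I)"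
  shows "Poly_Mapping.single (xs[i := \<Sum>j\<in>S. scl (V0 av I) (a j) (x j)]) c
           - (\<Sum>j\<in>S. Poly_Mapping.single (xs[i := x j]) (c * a j)) \<in> N"
proof -
  interpret V: module "scl (V0 av I)" by (rule V0_module)
  show ?thesis using \<open>finite S\<close> x
  proof (induction S rule: finite_induct)
    case empty
    show ?case
      using rel_scale[OF xs i V.subspace_0[OF V0_subspace], of 0 c] by (simp add: zero_fun_def)
  next
    case (insert j S)
    let ?s = "\<Sum>j\<in>S. scl (V0 av I) (a j) (x j)" and ?y = "scl (V0 av I) (a j) (x j)"
    have s: "?s \<in> carr (V0 av I)"
      by (intro V.subspace_sum[OF V0_subspace] V.subspace_scale[OF V0_subspace] insert.prems) auto
    have xj: "x j \<in> carr (V0 av I)" using insert.prems by auto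
    have y: "?y \<in> carr (V0 av I)" using V.subspace_scale[OF V0_subspace xj] .
    have 1: "Poly_Mapping.single (xs[i := ?s]) c - (\<Sum>j\<in>S. Poly_Mapping.single (xs[i := x j]) (c * a j)) \<in> N"
      using insert by auto
    have "(Poly_Mapping.single (xs[i := ?y + ?s]) c - Poly_Mapping.single (xs[i := ?y]) c - Poly_Mapping.single (xs[i := ?s]) c)
       + (Poly_Mapping.single (xs[i := ?y]) c - Poly_Mapping.single (xs[i := x j]) (c * a j))
       + (Poly_Mapping.single (xs[i := ?s]) c - (\<Sum>j\<in>S. Poly_Mapping.single (xs[i := x j]) (c * a j))) \<in> N"
      by (intro N_add rel_add rel_scale xs i y s xj 1)
    moreover have "(x - a' - d) + (a' - b') + (d - t) = x - (b' + t)" for x a' b' d t :: "('i \<Rightarrow> 'k) list \<Rightarrow>\<^sub>0 'k"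
      by (simp add: algebra_simps)
    ultimately show ?case by (simp only: sum.insert[OF insert.hyps(1,2)])
  qed
qed

definition small :: "real \<Rightarrow> (('i \<Rightarrow> 'k) list \<Rightarrow>\<^sub>0 'k) \<Rightarrow> bool" where
  "small e y \<longleftrightarrow> Poly_Mapping.keys y \<subseteq> D \<and> rep_size av Vs y \<le> e"

lemma V0_nrm_nonneg: "x \<in> carr (V0 av I) \<Longrightarrow> 0 \<le> nrm (V0 av I) x"
  unfolding V0_def by (rule c0_nrm_ge)

lemma prod_nrm: "(\<Prod>i<length Vs. nrm (Vs ! i) (xs ! i)) = (\<Prod>i<n. nrm (V0 av I) (xs ! i))"
  by (auto intro: prod.cong)

lemma prod_nrm_nonneg: "xs \<in> D \<Longrightarrow> 0 \<le> (\<Prod>i<n. nrm (V0 av I) (xs ! i))"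
  by (auto simp: tens_dom_V0 subset_iff intro!: prod_nonneg V0_nrm_nonneg)

lemma small_add:
  assumes "small e y" "small e z" shows "small e (y + z)"
proof -
  have e: "0 \<le> e" using assms(1) rep_size_nonneg by (auto simp: small_def intro: order_trans)
  have k: "Poly_Mapping.keys (y + z) \<subseteq> D"
    using assms Poly_Mapping.keys_add[of y z] by (auto simp: small_def)
  have b: "av (Poly_Mapping.lookup u xs) * (\<Prod>i<n. nrm (V0 av I) (xs ! i)) \<le> e" if "small e u" for u xs
    using that e by (cases "xs \<in> Poly_Mapping.keys u")
      (auto simp: small_def rep_size_le_iff prod_nrm in_keys_iff av_0)
  have "av (Poly_Mapping.lookup (y + z) xs) * (\<Prod>i<n. nrm (V0 av I) (xs ! i)) \<le> e" if "xs \<in> D" for xs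
  proof -
    have "av (Poly_Mapping.lookup (y + z) xs) \<le> av (Poly_Mapping.lookup y xs) \<or> av (Poly_Mapping.lookup (y + z) xs) \<le> av (Poly_Mapping.lookup z xs)"
      using av_ultra[of "Poly_Mapping.lookup y xs" "Poly_Mapping.lookup z xs"] by (auto simp: lookup_add max_def split: if_splits)
    then show ?thesis
      by (elim disjE) (erule order_trans[OF mult_right_mono[OF _ prod_nrm_nonneg[OF that]]], rule b, rule assms)+
  qed
  then show ?thesis using k e by (auto simp: small_def rep_size_le_iff prod_nrm)
qed

lemma small_0: "0 \<le> e \<Longrightarrow> small e 0"
  by (simp add: small_def rep_size_le_iff)

definition "bas = {p. Poly_Mapping.keys p \<subseteq> map basis_vec ` W}"

lemma bas_add: "p \<in> bas \<Longrightarrow> q \<in> bas \<Longrightarrow> p + q \<in> bas"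
  using Poly_Mapping.keys_add[of p q] by (auto simp: bas_def)

lemma bas_D: "map basis_vec ` W \<subseteq> D"
  by (auto simp: tens_dom_V0 subset_iff intro!: basis_vec_carr)

definition Q :: "(('i \<Rightarrow> 'k) list \<Rightarrow>\<^sub>0 'k) \<Rightarrow> bool" where
  "Q z \<longleftrightarrow> (\<forall>e>0. \<exists>p\<in>bas. \<exists>y. small e y \<and> z - p - y \<in> N)"

lemma Q_limit:
  assumes "\<And>e. e > 0 \<Longrightarrow> \<exists>z'. Q z' \<and> (\<exists>y. small e y \<and> z - z' - y \<in> N)"
  shows "Q z"
  unfolding Q_def
proof (intro allI impI)
  fix e :: real assume e: "e > 0"
  from assms[OF e] obtain z' y where z: "Q z'" "small e y" "z - z' - y \<in> N" by blast
  from z(1) e obtain p y' where p: "p \<in> bas" "small e y'" "z' - p - y' \<in> N" unfolding Q_def by blast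
  have "(z - z' - y) + (z' - p - y') \<in> N" by (intro N_add z p)
  then have "z - p - (y + y') \<in> N" by (simp add: algebra_simps)
  then show "\<exists>p\<in>bas. \<exists>y. small e y \<and> z - p - y \<in> N" using p(1) small_add[OF z(2) p(2)] by blast
qed

lemma Q_add: assumes "Q y" "Q z" shows "Q (y + z)"
  unfolding Q_def
proof (intro allI impI)
  fix e :: real assume e: "e > 0"
  from assms(1) e obtain p u where p: "p \<in> bas" "small e u" "y - p - u \<in> N" unfolding Q_def by blast
  from assms(2) e obtain q v where q: "q \<in> bas" "small e v" "z - q - v \<in> N" unfolding Q_def by blast
  have "(y - p - u) + (z - q - v) \<in> N" by (intro N_add p q)
  then have "y + z - (p + q) - (u + v) \<in> N" by (simp add: algebra_simps)
  then show "\<exists>p\<in>bas. \<exists>w. small e w \<and> y + z - p - w \<in> N"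
    using bas_add[OF p(1) q(1)] small_add[OF p(2) q(2)] by blast
qed

lemma Q_bas: "p \<in> bas \<Longrightarrow> Q p"
  unfolding Q_def by (intro allI impI bexI[of _ p] exI[of _ 0]) (auto simp: small_0 N_0)

lemma Q_0: "Q 0" by (rule Q_bas) (simp add: bas_def)

lemma Q_sum: "(\<And>i. i \<in> S \<Longrightarrow> Q (f i)) \<Longrightarrow> Q (sum f S)"
  by (induction S rule: infinite_finite_induct) (auto simp: Q_0 intro: Q_add)

lemma Q_single:
  "fs \<in> D \<Longrightarrow> (\<And>i. k \<le> i \<Longrightarrow> i < n \<Longrightarrow> fs ! i \<in> basis_vec ` I) \<Longrightarrow> Q (Poly_Mapping.single fs c)"
proof (induction k arbitrary: fs c)
  case 0
  then have "\<forall>i\<in>{..<n}. \<exists>j. j \<in> I \<and> fs ! i = basis_vec j" by auto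
  from bchoice[OF this] obtain w where w: "\<And>i. i < n \<Longrightarrow> w i \<in> I \<and> fs ! i = basis_vec (w i)"
    by auto
  have "fs = map basis_vec (map w [0..<n])"
    using w 0(1) by (intro nth_equalityI) (auto simp: tens_dom_V0)
  moreover have "map w [0..<n] \<in> W" using w by auto
  ultimately have "fs \<in> map basis_vec ` W" by blast
  then have "Poly_Mapping.single fs c \<in> bas" by (auto simp: bas_def)
  then show ?case by (rule Q_bas)
next
  case (Suc k)
  show ?case
  proof (cases "k < n")
    case False
    then show ?thesis by (intro Suc.IH Suc.prems) auto
  next
    case k: True
    have len: "length fs = n" using Suc.prems(1) by (simp add: tens_dom_V0)
    define f where "f = fs ! k"
    have f: "f \<in> carr (V0 av I)" using Suc.prems(1) k by (auto simp: tens_dom_V0 f_def)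
    let ?R = "\<Prod>j\<in>{..<n} - {k}. nrm (V0 av I) (fs ! j)"
    have R: "0 \<le> ?R" using Suc.prems(1)
      by (auto simp: tens_dom_V0 subset_iff intro!: prod_nonneg V0_nrm_nonneg)
    show ?thesis
    proof (rule Q_limit)
      fix e :: real assume e: "e > 0"
      define d where "d = e / (av c * ?R + 1)"
      have den: "av c * ?R + 1 > 0" using R av_nonneg[of c] by (simp add: add_nonneg_pos)
      have d: "d > 0" using e den by (simp add: d_def)
      have dle: "av c * (d * ?R) \<le> e"
      proof -
        have "av c * (d * ?R) \<le> d * (av c * ?R + 1)" using d by (simp add: algebra_simps)
        also have "\<dots> = e" using den by (simp add: d_def)
        finally show ?thesis .
      qed
      define S where "S = {i \<in> I. d \<le> av (f i)}"
      have S: "finite S" "S \<subseteq> I" using f d by (auto simp: S_def V0_def c0_carr)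
      define g where "g = (\<lambda>i. if i \<in> S then 0 else f i)"
      define h where "h = (\<Sum>i\<in>S. scl (V0 av I) (f i) (basis_vec i))"
      have ev: "(\<Sum>i\<in>T. F i) j = (\<Sum>i\<in>T. F i j)" for T :: "'i set" and F :: "'i \<Rightarrow> 'i \<Rightarrow> 'k" and j
        by (induction T rule: infinite_finite_induct) auto
      have hj: "h j = (if j \<in> S then f j else 0)" for j
      proof -
        have "h j = (\<Sum>i\<in>S. if j = i then f j else 0)"
          unfolding h_def ev by (rule sum.cong) (auto simp: V0_def c0_scl basis_vec_def)
        then show ?thesis using S(1) by simp
      qed
      have fhg: "f = h + g" by (auto simp: fun_eq_iff hj g_def)
      have g: "g \<in> carr (V0 av I)"
        unfolding V0_def c0_carr
      proof (intro conjI allI impI)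
        fix e' :: real assume e': "e' > 0"
        have "finite {i \<in> I. e' \<le> av (f i)}" using f e' by (auto simp: V0_def c0_carr)
        then show "finite {i \<in> I. e' \<le> av (g i)}"
          by (rule rev_finite_subset) (use e' in \<open>auto simp: g_def av_0 split: if_splits\<close>)
      next
        fix j assume "j \<notin> I"
        then have "f j = 0" using f by (simp add: V0_def c0_carr)
        then show "g j = 0" by (simp add: g_def)
      qed
      have gd: "nrm (V0 av I) g \<le> d"
        unfolding V0_def by (rule c0_nrm_le) (use d in \<open>auto simp: g_def S_def av_0\<close>)
      have b: "basis_vec i \<in> carr (V0 av I)" if "i \<in> S" for i
        by (rule basis_vec_carr[OF subsetD[OF S(2) that]])
      have h: "h \<in> carr (V0 av I)"
        unfolding h_def
        by (rule module.subspace_sum[OF V0_module V0_subspace],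
            rule module.subspace_scale[OF V0_module V0_subspace], rule b)
      let ?z = "\<Sum>i\<in>S. Poly_Mapping.single (fs[k := basis_vec i]) (c * f i)"
      let ?y = "Poly_Mapping.single (fs[k := g]) c"
      have "Q ?z"
      proof (rule Q_sum, rule Suc.IH)
        fix i assume i: "i \<in> S"
        show "fs[k := basis_vec i] \<in> D" by (rule D_update[OF Suc.prems(1) b[OF i]])
        fix j assume j: "k \<le> j" "j < n"
        show "fs[k := basis_vec i] ! j \<in> basis_vec ` I"
          using j i S Suc.prems(2)[of j] len by (cases "j = k") auto
      qed
      moreover have "small e ?y"
      proof -
        have "(\<Prod>j<n. nrm (V0 av I) (fs[k := g] ! j)) = nrm (V0 av I) g * (\<Prod>j\<in>{..<n} - {k}. nrm (V0 av I) (fs[k := g] ! j))"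
          using k len by (subst prod.remove[of _ k]) auto
        also have "(\<Prod>j\<in>{..<n} - {k}. nrm (V0 av I) (fs[k := g] ! j)) = ?R"
          by (rule prod.cong) auto
        also have "nrm (V0 av I) g * ?R \<le> d * ?R" using gd R by (rule mult_right_mono)
        finally have "av c * (\<Prod>j<n. nrm (V0 av I) (fs[k := g] ! j)) \<le> e"
          by (rule order_trans[OF mult_left_mono[OF _ av_nonneg] dle])
        then show ?thesis
          using e D_update[OF Suc.prems(1) g, of k] by (auto simp: small_def rep_size_le_iff prod_nrm)
      qed
      moreover have "Poly_Mapping.single fs c - ?z - ?y \<in> N"
      proof -
        have upd: "fs[k := h + g] = fs" unfolding fhg[symmetric] f_def by (simp only: list_update_id)
        have "(Poly_Mapping.single (fs[k := h + g]) c - Poly_Mapping.single (fs[k := h]) c - ?y)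
            + (Poly_Mapping.single (fs[k := h]) c - ?z) \<in> N"
          unfolding h_def
          by (intro N_add rel_add rel_sum Suc.prems(1) k g h[unfolded h_def] S(1) b)
        moreover have "(x - u - v) + (u - t) = x - t - v" for x u v t :: "('i \<Rightarrow> 'k) list \<Rightarrow>\<^sub>0 'k"
          by (simp add: algebra_simps)
        ultimately show ?thesis by (simp only: upd)
      qed
      ultimately show "\<exists>z'. Q z' \<and> (\<exists>y. small e y \<and> Poly_Mapping.single fs c - z' - y \<in> N)"
        by (intro exI[of _ ?z] exI[of _ ?y] conjI)
    qed
  qed
qed

lemma pm_expand: "z = (\<Sum>x\<in>Poly_Mapping.keys z. Poly_Mapping.single x (Poly_Mapping.lookup z x))"
  by (rule poly_mapping_eqI) (simp add: lookup_sum lookup_single when_def in_keys_iff)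

lemma Q_all: "Poly_Mapping.keys z \<subseteq> D \<Longrightarrow> Q z"
  by (subst pm_expand, rule Q_sum, rule Q_single[of _ n]) auto

lemma ext_carr: "Poly_Mapping.keys z \<subseteq> D \<Longrightarrow> ext z \<in> carr P"
proof -
  assume z: "Poly_Mapping.keys z \<subseteq> D"
  interpret X: module "scl P" by (rule mod_pow)
  have s: "X.subspace (carr P)" unfolding V0_pow_def by (rule c0_subspace)
  have "V0_tensor xs \<in> carr P" if "xs \<in> D" for xs
    using V0_tensor_carr[of xs I] that by (auto simp: tens_dom_V0)
  then show ?thesis unfolding tens_ext_def
    using z by (intro X.subspace_sum[OF s] X.subspace_scale[OF s]) auto
qed

lemma ext_apply: "ext z w = (\<Sum>xs\<in>Poly_Mapping.keys z. Poly_Mapping.lookup z xs * V0_tensor xs w)"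
proof -
  have ev: "(\<Sum>i\<in>T. F i) j = (\<Sum>i\<in>T. F i j)" for T and F :: "('i \<Rightarrow> 'k) list \<Rightarrow> 'i list \<Rightarrow> 'k" and j
    by (induction T rule: infinite_finite_induct) auto
  show ?thesis by (simp add: tens_ext_def ev V0_pow_def c0_scl)
qed

lemma ext_le: "small e y \<Longrightarrow> av (ext y w) \<le> e"
  unfolding ext_apply
proof (rule av_sum_le)
  assume y: "small e y"
  show "0 \<le> e" using y rep_size_nonneg by (auto simp: small_def intro: order_trans)
  fix xs assume xs: "xs \<in> Poly_Mapping.keys y"
  then have "xs \<in> D" using y by (auto simp: small_def)
  then have "av (V0_tensor xs w) \<le> (\<Prod>i<n. nrm (V0 av I) (xs ! i))"
    using V0_tensor_norm[of xs I w] by (simp add: tens_dom_V0)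
  then show "av (Poly_Mapping.lookup y xs * V0_tensor xs w) \<le> e"
    using y xs mult_left_mono[OF _ av_nonneg[of "Poly_Mapping.lookup y xs"]]
    unfolding small_def rep_size_le_iff prod_nrm av_mult by (meson order_trans)
qed simp

lemma ext_bas:
  assumes p: "p \<in> bas" shows "Poly_Mapping.lookup p (map basis_vec w) = ext p w"
proof -
  have inj: "map basis_vec v = map basis_vec w \<longleftrightarrow> v = w" for v
    using V0_tensor_basis[of v v] V0_tensor_basis[of w v] by (auto split: if_splits)
  have "ext p w = (\<Sum>xs\<in>Poly_Mapping.keys p. if xs = map basis_vec w then Poly_Mapping.lookup p xs else 0)"
    unfolding ext_apply
  proof (rule sum.cong[OF refl])
    fix xs assume "xs \<in> Poly_Mapping.keys p"
    then obtain v where v: "xs = map basis_vec v" using p by (auto simp: bas_def)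
    show "Poly_Mapping.lookup p xs * V0_tensor xs w = (if xs = map basis_vec w then Poly_Mapping.lookup p xs else 0)"
      unfolding v inj V0_tensor_basis by auto
  qed
  then show ?thesis by (simp add: in_keys_iff)
qed

lemma ext_rel: "z \<in> N \<Longrightarrow> ext z = 0"
  by (rule tens_ext_rel)

lemma norm_ext:
  assumes z: "Poly_Mapping.keys z \<subseteq> D"
  shows "nrm P (ext z) = proj_seminorm av Vs z"
proof -
  let ?A = "{rep_size av Vs y |y. Poly_Mapping.keys y \<subseteq> D \<and> z - y \<in> N}"
  have sem: "proj_seminorm av Vs z = Inf ?A" by (simp add: proj_seminorm_def)
  note M = mod_pow[of I n]
  have ez: "ext z \<in> carr P" by (rule ext_carr[OF z])
  have nn: "0 \<le> nrm P (ext z)" "av (ext z w) \<le> nrm P (ext z)" for w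
    using ez unfolding V0_pow_def by (rule c0_nrm_ge)+
  have "nrm P (ext z) \<le> Inf ?A"
  proof (rule cInf_greatest)
    show "?A \<noteq> {}" using z N_0 by auto
    fix a assume "a \<in> ?A"
    then obtain y where y: "Poly_Mapping.keys y \<subseteq> D" "z - y \<in> N" "a = rep_size av Vs y" by blast
    have "ext z = ext y" using ext_rel[OF y(2)] by (simp add: tens_ext_diff[OF M])
    moreover have "small a y" using y by (simp add: small_def)
    ultimately show "nrm P (ext z) \<le> a"
      unfolding V0_pow_def using ext_le[of a y, unfolded V0_pow_def] rep_size_nonneg[of Vs y] y(3)
      by (intro c0_nrm_le) auto
  qed
  moreover have "Inf ?A \<le> nrm P (ext z)"
  proof (rule field_le_epsilon)
    fix e :: real assume e: "e > 0"
    obtain p y where p: "p \<in> bas" "small e y" "z - p - y \<in> N"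
      using Q_all[OF z] e unfolding Q_def by blast
    have "ext z - ext p = ext y" using ext_rel[OF p(3)] by (simp add: tens_ext_diff[OF M])
    from this[symmetric] have ext_p: "ext p = ext z - ext y" by simp
    let ?B = "nrm P (ext z) + e"
    have "small ?B p"
      unfolding small_def rep_size_le_iff prod_nrm
    proof (intro conjI ballI)
      show "Poly_Mapping.keys p \<subseteq> D" using p(1) bas_D by (auto simp: bas_def)
      show "0 \<le> ?B" using nn e by simp
      fix xs assume "xs \<in> Poly_Mapping.keys p"
      then obtain w where w: "xs = map basis_vec w" "w \<in> W" using p(1) by (auto simp: bas_def)
      have "av (ext z w - ext y w) \<le> ?B"
        using av_diff_le[of "ext z w" "ext y w"] nn ext_le[OF p(2), of w] e
        by (smt (verit))
      then have "av (Poly_Mapping.lookup p xs) \<le> ?B" unfolding w ext_bas[OF p(1)] ext_p by simp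
      moreover have "(\<Prod>i<n. nrm (V0 av I) (xs ! i)) \<le> 1"
        by (rule prod_le_1) (use w in \<open>auto simp: subset_iff intro!: basis_vec_norm basis_vec_carr V0_nrm_nonneg\<close>)
      moreover have "0 \<le> (\<Prod>i<n. nrm (V0 av I) (xs ! i))"
        using prod_nrm_nonneg w bas_D by blast
      ultimately show "av (Poly_Mapping.lookup p xs) * (\<Prod>i<n. nrm (V0 av I) (xs ! i)) \<le> ?B"
        using mult_mono[of "av (Poly_Mapping.lookup p xs)" ?B "\<Prod>i<n. nrm (V0 av I) (xs ! i)" 1] nn(1) e by simp
    qed
    moreover have "small ?B y" using p(2) nn(1) by (auto simp: small_def)
    ultimately have s: "small ?B (p + y)" by (rule small_add)
    have "z - (p + y) \<in> N" using p(3) by (simp add: algebra_simps)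
    then have "rep_size av Vs (p + y) \<in> ?A" using s by (auto simp: small_def)
    then have "Inf ?A \<le> rep_size av Vs (p + y)"
      by (rule cInf_lower) (auto intro!: bdd_belowI[of _ 0] rep_size_nonneg)
    then show "Inf ?A \<le> ?B" using s by (simp add: small_def)
  qed
  ultimately show ?thesis by (simp add: sem)
qed

lemma ext_dense:
  assumes x: "x \<in> carr P" and e: "e > 0"
  shows "\<exists>z. Poly_Mapping.keys z \<subseteq> D \<and> nrm P (x - ext z) < e"
proof -
  note M = mod_pow[of I n]
  define A where "A = {w \<in> W. e / 2 \<le> av (x w)}"
  have A: "finite A" "A \<subseteq> W" using x[unfolded V0_pow_def c0_carr] half_gt_zero[OF e] unfolding A_def by blast+
  define z where "z = (\<Sum>w\<in>A. Poly_Mapping.single (map basis_vec w) (x w))"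
  have "Poly_Mapping.keys z \<subseteq> map basis_vec ` A"
    unfolding z_def by (rule order_trans[OF Poly_Mapping.keys_sum]) (auto split: if_splits)
  then have "Poly_Mapping.keys z \<subseteq> D" using bas_D A(2) by blast
  moreover have "ext z w = (if w \<in> A then x w else 0)" for w
  proof -
    have ev: "(\<Sum>i\<in>T. F i) j = (\<Sum>i\<in>T. F i j)" for T and F :: "'i list \<Rightarrow> 'i list \<Rightarrow> 'k" and j
      by (induction T rule: infinite_finite_induct) auto
    have "ext z = (\<Sum>v\<in>A. scl P (x v) (V0_tensor (map basis_vec v)))"
      by (simp add: z_def tens_ext_sum[OF M] tens_ext_single[OF M])
    then have "ext z w = (\<Sum>v\<in>A. scl P (x v) (V0_tensor (map basis_vec v)) w)"
      by (simp only: ev)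
    also have "\<dots> = (\<Sum>v\<in>A. if w = v then x w else 0)"
      by (rule sum.cong) (auto simp: V0_pow_def c0_scl V0_tensor_basis)
    finally show ?thesis using A(1) by simp
  qed
  then have "nrm P (x - ext z) \<le> e / 2"
    unfolding V0_pow_def
    by (intro c0_nrm_le) (use e in \<open>auto simp: A_def av_0 V0_pow_def\<close>)
  ultimately show ?thesis using e by (intro exI[of _ z]) auto
qed

end

theorem (in complete_nonarch_field) V0_pow_is_completed_tensor:
  fixes I :: "'i set"
  shows "is_completed_tensor av (replicate n (V0 av I)) (V0_pow av I n) V0_tensor"
proof -
  interpret V0_power av I n by unfold_locales
  show ?thesis
    unfolding is_completed_tensor_def
    using norm_ext ext_dense V0_tensor_carr[of _ I]
    by (auto simp: tens_dom_V0 banach_c0[folded V0_pow_def] V0_pow_def[symmetric] intro: banach_c0[of "{w. length w = n \<and> set w \<subseteq> I}", folded V0_pow_def])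
qed

end

theory Submission
  imports Defs
begin

text \<open>
  Write \<open>\<Phi> u = \<alpha> u\<close> and \<open>\<Phi>' u = \<alpha>' u\<close> for \<open>u\<close> in \<open>U\<close>; these power series determine \<open>\<alpha>\<close> and \<open>\<alpha>'\<close>.
  The conjugating element \<open>F = 1 + F\<^sub>1 \<hbar> + F\<^sub>2 \<hbar>\<^sup>2 + \<dots>\<close> is found one coefficient at a time. If
  \<open>P = 1 + \<dots> + F\<^sub>n\<^sub>-\<^sub>1 \<hbar>\<^sup>n\<^sup>-\<^sup>1\<close> satisfies \<open>\<Phi>' u P = P \<Phi> u\<close> modulo \<open>\<hbar>\<^sup>n\<close>, then the coefficient of \<open>\<hbar>\<^sup>n\<close> in
  \<open>P \<Phi> u - \<Phi>' u P\<close> is a bounded derivation of \<open>U\<close> with values in \<open>U'\<close>. Its restriction to the Lie algebra is a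
  1-cocycle, hence \<open>u \<mapsto> [\<alpha>\<^sub>0 u, F\<^sub>n]\<close> for some \<open>F\<^sub>n\<close>, and the two derivations agree on all of \<open>U\<close>
  because the generators of the Lie algebra generate a dense subalgebra. If \<open>\<parallel>F\<^sub>i\<parallel> \<le> \<rho>\<^sup>-\<^sup>i\<close> for \<open>i < n\<close>, the cocycle has
  norm at most \<open>\<rho>\<^sup>-\<^sup>n\<close>, so \<open>F\<^sub>n\<close> can be chosen with \<open>\<parallel>F\<^sub>n\<parallel> \<le> \<sigma>\<^sup>-\<^sup>n\<close> for any \<open>\<sigma> < \<rho>\<close>. Letting the radii
  decrease from \<open>\<epsilon>\<close> to a limit above \<open>\<epsilon>'\<close> makes \<open>F\<close> and its inverse elements of \<open>U'{\<hbar>/\<epsilon>'}\<close>.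
\<close>

section \<open>Norms\<close>

locale nonarch_banach_algebra = complete_nonarch_field av for av :: "'k::field_char_0 \<Rightarrow> real" +
  fixes U :: "('k, 'u::ring_1, 'z) nspace_scheme"
  assumes banach_algebra: "banach_algebra av U"
begin

lemma
  shows carr_UNIV [simp]: "carr U = UNIV"
    and nrm_nonneg [simp]: "0 \<le> nrm U x"
    and nrm_eq_0_iff [simp]: "nrm U x = 0 \<longleftrightarrow> x = 0"
    and nrm_add_le: "nrm U (x + y) \<le> max (nrm U x) (nrm U y)"
    and nrm_scl: "nrm U (scl U c x) = av c * nrm U x"
    and nrm_mult_le: "nrm U (x * y) \<le> nrm U x * nrm U y"
    and nrm_one_le: "nrm U 1 \<le> 1"
    and scl_mult_left: "scl U c (x * y) = scl U c x * y"
  using banach_algebra by (simp_all add: banach_algebra_def banach_space_def)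

lemma scl_mult_right: "scl U c (x * y) = x * scl U c y"
  using banach_algebra unfolding banach_algebra_def by blast

lemma nrm_zero [simp]: "nrm U 0 = 0"
  by simp

sublocale vector_space "scl U"
  using banach_algebra by (simp add: banach_algebra_def banach_space_def)

lemma nrm_minus [simp]: "nrm U (- x) = nrm U x"
  using nrm_scl[of "- 1" x] by (simp add: av_minus av_1)

lemma nrm_minus_commute: "nrm U (x - y) = nrm U (y - x)"
  using nrm_minus[of "x - y"] by simp

lemma nrm_diff_le: "nrm U (x - y) \<le> max (nrm U x) (nrm U y)"
  using nrm_add_le[of x "- y"] by simp

lemma nrm_sum_le: "0 \<le> B \<Longrightarrow> (\<And>i. i \<in> S \<Longrightarrow> nrm U (f i) \<le> B) \<Longrightarrow> nrm U (sum f S) \<le> B"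
proof (induction S rule: infinite_finite_induct)
  case (insert i S)
  then show ?case using nrm_add_le[of "f i" "sum f S"] by (auto simp: max_def split: if_splits intro: order_trans)
qed auto

text \<open>\<open>norm_closed\<close> speaks of sequences, while the density lemmas supply one
  approximant for each error; choosing one for every error 1/(n+1) connects the two.\<close>

lemma norm_closedD:
  assumes "norm_closed U S" and "\<And>e. e > 0 \<Longrightarrow> \<exists>y\<in>S. nrm U (x - y) < e"
  shows "x \<in> S"
proof -
  have "\<forall>n. \<exists>y\<in>S. nrm U (x - y) < 1 / real (Suc n)" by (intro allI assms(2)) simp
  then obtain X where X: "\<And>n. X n \<in> S" "\<And>n. nrm U (x - X n) < 1 / real (Suc n)" by metis
  have "(\<lambda>n. nrm U (X n - x)) \<longlonglongrightarrow> 0"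
  proof (rule tendsto_sandwich[OF _ _ tendsto_const])
    show "(\<lambda>n. 1 / real (Suc n)) \<longlonglongrightarrow> 0" by (rule LIMSEQ_Suc[OF lim_1_over_n])
  qed (use X(2) nrm_minus_commute[of _ x] in \<open>auto intro!: always_eventually less_imp_le\<close>)
  then show ?thesis using assms(1) X(1) by (auto simp: norm_closed_def)
qed

end


section \<open>Density of the subalgebra spanned by the generators\<close>

text \<open>
  \<open>Sup\<close> takes one and the same value on all unbounded sets of reals. This spares a proof that the
  ideal of a quotient norm is contained in the algebra.
\<close>

lemma bdd_below_nrm_coprod1: "bdd_below (range (nrm (coprod1 N V)))"
proof (rule bdd_belowI)
  fix a assume "a \<in> range (nrm (coprod1 N V))"
  then obtain f where a: "a = Sup (insert 0 ((\<lambda>n. nrm (V n) (f n)) ` N))" (is "_ = Sup ?S")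
    by (auto simp: coprod1_def)
  show "min 0 (LEAST z::real. False) \<le> a"
  proof (cases "bdd_above ?S")
    case True then show ?thesis using cSup_upper[of 0 ?S] by (simp add: a)
  next
    case False
    then have "(\<forall>x\<in>?S. x \<le> z) = False" for z by (metis False bdd_above.I)
    then show ?thesis unfolding a Sup_real_def by (simp only: min.cobounded2)
  qed
qed

context nonarch_banach_algebra
begin

text \<open>Taking j = 0 in the infimum bounds the quotient norm by the norm of \<open>A\<close>, so
  \<open>h\<close> is contracting. Approximations in \<open>A\<close> by the span of
  \<open>S\<close> therefore become approximations in \<open>U\<close> by elements of
  \<open>B\<close>, which is closed.\<close>

lemma embeds_quotient_image_subset:
  fixes A :: "('k, 'a::ab_group_add, 'y) nalgebra_scheme"
  assumes h: "embeds_quotient A J U h" and J: "0 \<in> J" and bdd: "bdd_below (range (nrm A))"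
    and A: "module (scl A)" "module.subspace (scl A) (carr A)"
    and B: "subspace B" "norm_closed U B"
    and S: "S \<subseteq> carr A" "h ` S \<subseteq> B"
    and dense: "\<And>x e. x \<in> carr A \<Longrightarrow> e > 0 \<Longrightarrow> \<exists>p\<in>module.span (scl A) S. nrm A (x - p) < e"
  shows "h ` carr A \<subseteq> B"
proof clarify
  interpret A: module "scl A" by (rule A)
  have h_add: "h (x + y) = h x + h y" if "x \<in> carr A" "y \<in> carr A" for x y
    using h that by (simp add: embeds_quotient_def alg_hom_def)
  have h_scl: "h (scl A c x) = scl U c (h x)" if "x \<in> carr A" for x c
    using h that by (simp add: embeds_quotient_def alg_hom_def)
  have h_nrm: "nrm U (h x) \<le> nrm A x" if "x \<in> carr A" for x
  proof -
    have "nrm U (h x) = quot_norm A J x" using h that by (simp add: embeds_quotient_def)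
    also have "\<dots> \<le> nrm A x" unfolding quot_norm_def
      using J bdd by (intro cInf_lower bdd_below_mono[OF bdd]) (auto intro!: exI[of _ 0])
    finally show ?thesis .
  qed
  have "h 0 = 0" using h_scl[OF A.subspace_0[OF A(2)], of 0] by simp
  then have "A.subspace {x \<in> carr A. h x \<in> B}"
    using A(2) by (auto simp: A.subspace_def h_add h_scl intro: subspace_0 subspace_add subspace_scale B(1))
  then have span: "A.span S \<subseteq> {x \<in> carr A. h x \<in> B}" using S by (intro A.span_minimal) auto
  fix x assume x: "x \<in> carr A"
  show "h x \<in> B"
  proof (rule norm_closedD[OF B(2)])
    fix e :: real assume "e > 0"
    then obtain p where p: "p \<in> A.span S" "nrm A (x - p) < e" using dense x by blast
    then have pc: "p \<in> carr A" "h p \<in> B" using span by auto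
    have xp: "x - p \<in> carr A" using A.subspace_diff[OF A(2) x pc(1)] .
    have "h x - h p = h (x - p)" using h_add[OF xp pc(1)] by simp
    then show "\<exists>y\<in>B. nrm U (h x - y) < e" using h_nrm[OF xp] p pc by (intro bexI[of _ "h p"]) auto
  qed
qed

end

section \<open>Words and monomials span dense subspaces\<close>

context complete_nonarch_field
begin

abbreviation (input) word_set :: "'i set \<Rightarrow> nat \<Rightarrow> 'i list set" where
  "word_set I n \<equiv> {w. length w = n \<and> set w \<subseteq> I}"

lemma T_alg_carr: "f \<in> carr (T_alg av I r) \<longleftrightarrow>
    (\<forall>n. f n \<in> carr (V0_pow av I n)) \<and> (\<forall>e>0. finite {n. e \<le> r ^ n * nrm (V0_pow av I n) (f n)})"
  and T_alg_scl: "scl (T_alg av I r) = (\<lambda>c f n w. c * f n w)"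
  and T_alg_nrm: "nrm (T_alg av I r) f = Sup (insert 0 (range (\<lambda>n. r ^ n * nrm (V0_pow av I n) (f n))))"
  by (simp_all add: T_alg_def nspace.defs coprod1_def[of UNIV] rescale_def V0_pow_def c0_scl)

lemma T_alg_module: "module (scl (T_alg av I r))"
  by standard (auto simp: T_alg_scl algebra_simps fun_eq_iff)

lemma V0_pow_nrm:
  assumes "f \<in> carr (V0_pow av I n)"
  shows "g \<in> carr (V0_pow av I n) \<Longrightarrow>
      nrm (V0_pow av I n) (f + g) \<le> max (nrm (V0_pow av I n) f) (nrm (V0_pow av I n) g)"
    and "nrm (V0_pow av I n) (\<lambda>w. c * f w) = av c * nrm (V0_pow av I n) f"
  using banach_c0[of "word_set I n"] assms c0_scl[of "word_set I n"]
  unfolding banach_space_def V0_pow_def by (auto dest!: bspec[of _ _ f])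

lemma T_alg_subspace:
  assumes "0 < r" shows "module.subspace (scl (T_alg av I r)) (carr (T_alg av I r))"
proof -
  interpret T: module "scl (T_alg av I r)" by (rule T_alg_module)
  interpret P: module "scl (V0_pow av I n)" for n by (rule mod_pow)
  have sub: "P.subspace n (carr (V0_pow av I n))" for n unfolding V0_pow_def by (rule c0_subspace)
  have scale: "(\<lambda>w. c * f w) \<in> carr (V0_pow av I n)" if "f \<in> carr (V0_pow av I n)" for f c n
    using P.subspace_scale[OF sub that, of c] by (simp add: V0_pow_def c0_scl)
  have zero: "nrm (V0_pow av I n) 0 = 0" for n
    using V0_pow_nrm(2)[OF P.subspace_0[OF sub], where c = 0] by (simp add: av_0 zero_fun_def)
  show ?thesis unfolding T.subspace_def
  proof (intro conjI ballI allI)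
    show "0 \<in> carr (T_alg av I r)"
      using P.subspace_0[OF sub] by (auto simp: T_alg_carr zero)
    fix f assume f: "f \<in> carr (T_alg av I r)"
    show "f + g \<in> carr (T_alg av I r)" if g: "g \<in> carr (T_alg av I r)" for g
      unfolding T_alg_carr
    proof (intro conjI allI impI)
      show "(f + g) n \<in> carr (V0_pow av I n)" for n
        using P.subspace_add[OF sub] f g by (simp add: T_alg_carr)
      fix e :: real assume e: "e > 0"
      have "{n. e \<le> r ^ n * nrm (V0_pow av I n) ((f + g) n)} \<subseteq>
        {n. e \<le> r ^ n * nrm (V0_pow av I n) (f n)} \<union> {n. e \<le> r ^ n * nrm (V0_pow av I n) (g n)}"
      proof
        fix n assume "n \<in> {n. e \<le> r ^ n * nrm (V0_pow av I n) ((f + g) n)}"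
        moreover have "nrm (V0_pow av I n) (f n + g n) \<le> max (nrm (V0_pow av I n) (f n)) (nrm (V0_pow av I n) (g n))"
          using f g by (intro V0_pow_nrm) (auto simp: T_alg_carr)
        then have "r ^ n * nrm (V0_pow av I n) (f n + g n) \<le>
          max (r ^ n * nrm (V0_pow av I n) (f n)) (r ^ n * nrm (V0_pow av I n) (g n))"
          using assms by (simp add: le_max_iff_disj)
        ultimately show "n \<in> {n. e \<le> r ^ n * nrm (V0_pow av I n) (f n)} \<union> {n. e \<le> r ^ n * nrm (V0_pow av I n) (g n)}"
          by (auto simp: le_max_iff_disj)
      qed
      then show "finite {n. e \<le> r ^ n * nrm (V0_pow av I n) ((f + g) n)}"
        by (rule finite_subset) (use e f g in \<open>simp add: T_alg_carr\<close>)
    qed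
    show "scl (T_alg av I r) c f \<in> carr (T_alg av I r)" for c
      unfolding T_alg_carr
    proof (intro conjI allI impI)
      show "scl (T_alg av I r) c f n \<in> carr (V0_pow av I n)" for n
        using scale f by (simp add: T_alg_scl T_alg_carr)
      fix e :: real assume e: "e > 0"
      have nrm: "nrm (V0_pow av I n) (scl (T_alg av I r) c f n) = av c * nrm (V0_pow av I n) (f n)" for n
        using V0_pow_nrm(2)[where f = "f n" and c = c] f by (simp add: T_alg_scl T_alg_carr)
      show "finite {n. e \<le> r ^ n * nrm (V0_pow av I n) (scl (T_alg av I r) c f n)}"
      proof (cases "c = 0")
        case True then show ?thesis using e by (simp add: nrm av_0 zero)
      next
        case False
        then have c: "av c > 0" using av_nonneg[of c] av_eq_0_iff[of c] by linarith
        then have "{n. e \<le> r ^ n * nrm (V0_pow av I n) (scl (T_alg av I r) c f n)} =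
          {n. e / av c \<le> r ^ n * nrm (V0_pow av I n) (f n)}"
          by (auto simp: nrm field_simps)
        then show ?thesis using f e c by (simp add: T_alg_carr)
      qed
    qed
  qed
qed

lemma T_word_carr: "set u \<subseteq> I \<Longrightarrow> T_word u \<in> carr (T_alg av I r)"
proof -
  assume u: "set u \<subseteq> I"
  have "finite {w. (length w = n \<and> set w \<subseteq> I) \<and> e \<le> av (T_word u n w)}" if "e > 0" for n e
    by (rule finite_subset[of _ "{u}"]) (use that in \<open>auto simp: T_word_def av_0 split: if_splits\<close>)
  then have c: "T_word u n \<in> carr (V0_pow av I n)" for n
    using u by (auto simp: V0_pow_def c0_carr T_word_def)
  have z: "nrm (V0_pow av I n) (T_word u n) = 0" if "n \<noteq> length u" for n
    using V0_pow_nrm(2)[OF c, where c = 0] that by (simp add: T_word_def[abs_def] av_0)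
  show ?thesis unfolding T_alg_carr
  proof (intro conjI allI impI c)
    fix e :: real assume e: "e > 0"
    have "n = length u" if "e \<le> r ^ n * nrm (V0_pow av I n) (T_word u n)" for n
      using that e z[of n] by (cases "n = length u") auto
    then have "{n. e \<le> r ^ n * nrm (V0_pow av I n) (T_word u n)} \<subseteq> {length u}" by auto
    then show "finite {n. e \<le> r ^ n * nrm (V0_pow av I n) (T_word u n)}"
      by (rule finite_subset) simp
  qed
qed

lemma T_word_mult: "mlt (T_alg av I r) (T_word u) (T_word v) = T_word (u @ v)"
proof (intro ext)
  fix n w
  have "mlt (T_alg av I r) (T_word u) (T_word v) n w =
      (\<Sum>m\<le>n. T_word u m (take m w) * T_word v (n - m) (drop m w))"
    by (simp add: T_alg_def nspace.defs)
  also have "\<dots> = (\<Sum>m\<le>n. if m = length u then T_word (u @ v) n w else 0)"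
  proof (rule sum.cong[OF refl])
    fix m assume "m \<in> {..n}"
    moreover have "take (length u) w = u \<and> drop (length u) w = v \<longleftrightarrow> w = u @ v"
      by (metis append_eq_conv_conj append_take_drop_id)
    ultimately show "T_word u m (take m w) * T_word v (n - m) (drop m w) =
        (if m = length u then T_word (u @ v) n w else (0::'k))"
      by (auto simp: T_word_def)
  qed
  also have "\<dots> = T_word (u @ v) n w" by (auto simp: T_word_def)
  finally show "mlt (T_alg av I r) (T_word u) (T_word v) n w = T_word (u @ v) n w" .
qed

text \<open>The truncation keeps the words whose weighted coefficient has size at least e/2. They
  are finite in number: \<open>f\<close> is null along the degrees, which leaves finitely many
  degrees, and null within each of them. The rest is bounded only weakly, hence e/2.\<close>

lemma T_word_dense:
  assumes r: "0 < r" and f: "f \<in> carr (T_alg av I r)" and e: "e > 0"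
  shows "\<exists>p\<in>module.span (scl (T_alg av I r)) (T_word ` {u. set u \<subseteq> I}). nrm (T_alg av I r) (f - p) < e"
proof -
  interpret T: module "scl (T_alg av I r)" by (rule T_alg_module)
  define d where "d = e / 2"
  have d: "d > 0" "d < e" using e by (auto simp: d_def)
  define A where "A = {w. set w \<subseteq> I \<and> d / r ^ length w \<le> av (f (length w) w)}"
  have fn: "f n \<in> carr (c0 (word_set I n))" for n using f by (simp add: T_alg_carr V0_pow_def)
  have "finite A"
  proof (rule finite_subset)
    show "A \<subseteq> (\<Union>n\<in>{n. d \<le> r ^ n * nrm (V0_pow av I n) (f n)}.
      {w \<in> word_set I n. d / r ^ n \<le> av (f n w)})"
    proof
      fix w assume w: "w \<in> A"
      then have "d / r ^ length w \<le> nrm (V0_pow av I (length w)) (f (length w))"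
        using c0_nrm_ge(1)[OF fn, of "length w" w] by (simp add: A_def V0_pow_def)
      then have "d \<le> r ^ length w * nrm (V0_pow av I (length w)) (f (length w))"
        using r by (simp add: field_simps)
      with w show "w \<in> (\<Union>n\<in>{n. d \<le> r ^ n * nrm (V0_pow av I n) (f n)}.
          {w \<in> word_set I n. d / r ^ n \<le> av (f n w)})"
        by (auto simp: A_def)
    qed
    show "finite (\<Union>n\<in>{n. d \<le> r ^ n * nrm (V0_pow av I n) (f n)}. {w \<in> word_set I n. d / r ^ n \<le> av (f n w)})"
      using d r f fn by (auto simp: T_alg_carr c0_carr)
  qed
  define p where "p = (\<Sum>u\<in>A. scl (T_alg av I r) (f (length u) u) (T_word u))"
  have "p \<in> T.span (T_word ` {u. set u \<subseteq> I})"
    unfolding p_def by (intro T.span_sum T.span_scale T.span_base) (simp add: A_def)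
  moreover have "p n w = (if n = length w \<and> w \<in> A then f n w else 0)" for n w
  proof -
    have ev: "(\<Sum>i\<in>S. F i) n w = (\<Sum>i\<in>S. F i n w)" for S and F :: "'a list \<Rightarrow> nat \<Rightarrow> 'a list \<Rightarrow> 'k"
      by (induction S rule: infinite_finite_induct) auto
    have "p n w = (\<Sum>u\<in>A. if u = w then (if n = length w then f n w else 0) else 0)"
      unfolding p_def ev by (rule sum.cong) (auto simp: T_alg_scl T_word_def)
    then show ?thesis using \<open>finite A\<close> by simp
  qed
  note p = this
  have "nrm (T_alg av I r) (f - p) \<le> d"
    unfolding T_alg_nrm
  proof (rule cSup_least)
    have "r ^ n * nrm (V0_pow av I n) ((f - p) n) \<le> d" for n
    proof -
      have "nrm (V0_pow av I n) ((f - p) n) \<le> d / r ^ n"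
        unfolding V0_pow_def
        by (rule c0_nrm_le) (use d r in \<open>auto simp: p A_def av_0\<close>)
      then show ?thesis using r by (simp add: field_simps)
    qed
    then show "x \<le> d" if "x \<in> insert 0 (range (\<lambda>n. r ^ n * nrm (V0_pow av I n) ((f - p) n)))" for x
      using that d by auto
  qed simp
  ultimately show ?thesis using d(2) by (intro bexI[of _ p]) auto
qed

definition H0_monom :: "('i \<Rightarrow>\<^sub>0 nat) \<Rightarrow> ('i \<Rightarrow>\<^sub>0 nat) \<Rightarrow> 'k" where
  "H0_monom m n = (if n = m then 1 else 0)"

lemma H0_alg_simps:
  "carr (H0_alg av I) = carr (c0 {n. Poly_Mapping.keys n \<subseteq> I})"
  "scl (H0_alg av I) = scl (c0 {n. Poly_Mapping.keys n \<subseteq> I})"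
  "nrm (H0_alg av I) = nrm (c0 {n. Poly_Mapping.keys n \<subseteq> I})"
  by (simp_all add: H0_alg_def nspace.defs)

lemma H0_monom_carr: "Poly_Mapping.keys m \<subseteq> I \<Longrightarrow> H0_monom m \<in> carr (H0_alg av I)"
  unfolding H0_alg_simps c0_carr
proof (intro conjI allI impI)
  fix e :: real assume e: "e > 0"
  have "n = m" if "e \<le> av (H0_monom m n)" for n
    using that e by (cases "n = m") (auto simp: H0_monom_def av_0)
  then have "{n \<in> {n. Poly_Mapping.keys n \<subseteq> I}. e \<le> av (H0_monom m n)} \<subseteq> {m}" by auto
  then show "finite {n \<in> {n. Poly_Mapping.keys n \<subseteq> I}. e \<le> av (H0_monom m n)}"
    by (rule finite_subset) simp
qed (auto simp: H0_monom_def)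

text \<open>Both summands are bounded by \<open>n\<close> at every index, so they vanish off its
  keys and take finitely many values on them. Over an infinite set of pairs the sum defining the
  product of \<open>H0_alg\<close> would be 0 by convention.\<close>

lemma finite_sums_poly_mapping: "finite {(a, b). a + b = (n :: 'i \<Rightarrow>\<^sub>0 nat)}"
proof (rule finite_subset)
  let ?K = "Poly_Mapping.keys n"
  let ?g = "\<lambda>a. restrict (Poly_Mapping.lookup a) ?K"
  have le: "Poly_Mapping.lookup a i \<le> Poly_Mapping.lookup n i" if "a + b = n" for a b i
    using that by (auto simp: lookup_add)
  let ?D = "{a. \<forall>i. Poly_Mapping.lookup a i \<le> Poly_Mapping.lookup n i}"
  show "{(a, b). a + b = n} \<subseteq> ?D \<times> ?D"
  proof (rule subsetI)
    fix x assume "x \<in> {(a, b). a + b = n}"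
    then have "fst x + snd x = n" "snd x + fst x = n" by (auto simp: add.commute)
    then show "x \<in> ?D \<times> ?D" using le by (simp add: mem_Times_iff)
  qed
  have "inj_on ?g ?D"
  proof (rule inj_onI, rule poly_mapping_eqI)
    fix a b i assume "a \<in> ?D" "b \<in> ?D" and eq: "?g a = ?g b"
    then have "Poly_Mapping.lookup a i \<le> Poly_Mapping.lookup n i" "Poly_Mapping.lookup b i \<le> Poly_Mapping.lookup n i"
      by auto
    then show "Poly_Mapping.lookup a i = Poly_Mapping.lookup b i"
      using fun_cong[OF eq, of i] by (cases "i \<in> ?K") (auto simp: in_keys_iff)
  qed
  moreover have "?g ` ?D \<subseteq> (\<Pi>\<^sub>E i\<in>?K. {..Poly_Mapping.lookup n i})" by auto
  then have "finite (?g ` ?D)" by (rule finite_subset) (auto intro: finite_PiE)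
  ultimately have "finite ?D" using finite_imageD by blast
  then show "finite (?D \<times> ?D)" by simp
qed

lemma H0_monom_mult: "mlt (H0_alg av I) (H0_monom m) (H0_monom m') = H0_monom (m + m')"
proof
  fix n
  have "mlt (H0_alg av I) (H0_monom m) (H0_monom m') n =
      (\<Sum>(a, b)\<in>{(a, b). a + b = n}. H0_monom m a * H0_monom m' b)"
    by (simp add: H0_alg_def nspace.defs)
  also have "\<dots> = (\<Sum>x\<in>{(a, b). a + b = n}. if x = (m, m') then 1 else 0)"
    by (rule sum.cong) (auto simp: H0_monom_def split: if_splits)
  also have "\<dots> = H0_monom (m + m') n"
    using finite_sums_poly_mapping[of n] by (auto simp: H0_monom_def)
  finally show "mlt (H0_alg av I) (H0_monom m) (H0_monom m') n = H0_monom (m + m') n" .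
qed

lemma H0_monom_dense:
  assumes f: "f \<in> carr (H0_alg av I)" and e: "e > 0"
  shows "\<exists>p\<in>module.span (scl (H0_alg av I)) (H0_monom ` {m. Poly_Mapping.keys m \<subseteq> I}). nrm (H0_alg av I) (f - p) < e"
proof -
  let ?N = "{m. Poly_Mapping.keys m \<subseteq> I}"
  interpret H: vector_space "scl (c0 ?N)" by (rule c0_vs)
  define A where "A = {n \<in> ?N. e / 2 \<le> av (f n)}"
  have A: "finite A" using f half_gt_zero[OF e] unfolding H0_alg_simps c0_carr A_def by blast
  define p where "p = (\<Sum>m\<in>A. scl (c0 ?N) (f m) (H0_monom m))"
  have "p \<in> H.span (H0_monom ` ?N)"
    unfolding p_def by (intro H.span_sum H.span_scale H.span_base) (simp add: A_def)
  moreover have "p n = (if n \<in> A then f n else 0)" for n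
  proof -
    have ev: "(\<Sum>i\<in>S. F i) n = (\<Sum>i\<in>S. F i n)" for S and F :: "_ \<Rightarrow> _ \<Rightarrow> 'k"
      by (induction S rule: infinite_finite_induct) auto
    have "p n = (\<Sum>m\<in>A. if m = n then f n else 0)"
      unfolding p_def ev by (rule sum.cong) (auto simp: c0_scl H0_monom_def)
    then show ?thesis using A by simp
  qed
  then have "nrm (c0 ?N) (f - p) \<le> e / 2"
    by (intro c0_nrm_le) (use e in \<open>auto simp: A_def av_0\<close>)
  moreover have "e / 2 < e" using e by simp
  ultimately show ?thesis unfolding H0_alg_simps by (intro bexI[of _ p]) auto
qed

end

lemma zero_in_closed_ideal: "module (scl A) \<Longrightarrow> 0 \<in> closed_ideal A S"
  by (auto simp: closed_ideal_def intro: module.subspace_0)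

section \<open>Closed subalgebras of \<open>U\<close> that contain the generators\<close>

context nonarch_banach_algebra
begin

text \<open>A word is the product of its letters, so \<open>B\<close> contains the images of all
  words, and words span a dense subspace.\<close>

lemma T_alg_image_subset:
  assumes r: "0 < r" and h: "embeds_quotient (T_alg av I r) (closed_ideal (T_alg av I r) S) U h"
    and B: "subspace B" "norm_closed U B" "1 \<in> B" "\<And>x y. x \<in> B \<Longrightarrow> y \<in> B \<Longrightarrow> x * y \<in> B"
    and gen: "\<And>i. i \<in> I \<Longrightarrow> h (T_word [i]) \<in> B"
  shows "h ` carr (T_alg av I r) \<subseteq> B"
proof (rule embeds_quotient_image_subset[OF h zero_in_closed_ideal[OF T_alg_module] _ T_alg_module T_alg_subspace[OF r] B(1,2)])
  have hom: "alg_hom (T_alg av I r) U h" using h by (simp add: embeds_quotient_def)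
  have "h (T_word u) \<in> B" if "set u \<subseteq> I" for u
    using that
  proof (induction u)
    case Nil
    have "unt (T_alg av I r) = T_word []" by (simp add: T_alg_def nspace.defs T_word_def fun_eq_iff)
    then show ?case using hom B(3) by (simp add: alg_hom_def)
  next
    case (Cons i u)
    have "h (T_word ([i] @ u)) = h (T_word [i]) * h (T_word u)"
      using hom T_word_carr[of "[i]" I r] T_word_carr[of u I r] Cons.prems
      unfolding T_word_mult[of I r, symmetric] alg_hom_def by auto
    then show ?case using Cons gen B(4) by simp
  qed
  then show "h ` T_word ` {u. set u \<subseteq> I} \<subseteq> B" by auto
  show "T_word ` {u. set u \<subseteq> I} \<subseteq> carr (T_alg av I r)" using T_word_carr by auto
  show "bdd_below (range (nrm (T_alg av I r)))"
    using bdd_below_nrm_coprod1 by (simp add: T_alg_def nspace.defs)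
qed (rule T_word_dense[OF r])

text \<open>A monomial is a finite product of powers of generators: one induction on the exponent of
  a single variable, one on the set of variables, then density.\<close>

lemma H0_alg_image_subset:
  assumes h: "embeds_quotient (H0_alg av I) {0} U h"
    and B: "subspace B" "norm_closed U B" "1 \<in> B" "\<And>x y. x \<in> B \<Longrightarrow> y \<in> B \<Longrightarrow> x * y \<in> B"
    and gen: "\<And>i. i \<in> I \<Longrightarrow> h (H0_gen i) \<in> B"
  shows "h ` carr (H0_alg av I) \<subseteq> B"
proof (rule embeds_quotient_image_subset[OF h _ _ _ _ B(1,2)])
  have hom: "alg_hom (H0_alg av I) U h" using h by (simp add: embeds_quotient_def)
  have mult: "h (H0_monom (m + m')) = h (H0_monom m) * h (H0_monom m')"
    if "Poly_Mapping.keys m \<subseteq> I" "Poly_Mapping.keys m' \<subseteq> I" for m m'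
    using hom H0_monom_carr that unfolding H0_monom_mult[of I, symmetric] alg_hom_def by blast
  have one: "h (H0_monom 0) = 1"
  proof -
    have "unt (H0_alg av I) = H0_monom 0" by (simp add: H0_alg_def nspace.defs H0_monom_def fun_eq_iff)
    then show ?thesis using hom by (simp add: alg_hom_def)
  qed
  have single: "h (H0_monom (Poly_Mapping.single i k)) \<in> B" if i: "i \<in> I" for i k
  proof (induction k)
    case 0 then show ?case using B(3) one by simp
  next
    case (Suc k)
    have "H0_monom (Poly_Mapping.single i 1) = H0_gen i" by (simp add: H0_monom_def H0_gen_def fun_eq_iff)
    then have "h (H0_monom (Poly_Mapping.single i 1 + Poly_Mapping.single i k)) = h (H0_gen i) * h (H0_monom (Poly_Mapping.single i k))"
      using mult[of "Poly_Mapping.single i 1" "Poly_Mapping.single i k"] i by simp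
    then show ?case using Suc B(4) gen[OF i] by (simp add: single_add[symmetric])
  qed
  have "h (H0_monom m) \<in> B" if "Poly_Mapping.keys m \<subseteq> I" for m
  proof -
    \<comment> \<open>The support is carried along because \<open>mult\<close> applies only to
      monomials in the variables indexed by \<open>I\<close>.\<close>
    have "h (H0_monom (\<Sum>i\<in>S. Poly_Mapping.single i (Poly_Mapping.lookup m i))) \<in> B
        \<and> Poly_Mapping.keys (\<Sum>i\<in>S. Poly_Mapping.single i (Poly_Mapping.lookup m i)) \<subseteq> I"
      if "finite S" "S \<subseteq> I" for S
      using that
    proof (induction S)
      case empty then show ?case using one B(3) by simp
    next
      case (insert i S)
      let ?s = "Poly_Mapping.single i (Poly_Mapping.lookup m i)"
      let ?t = "\<Sum>i\<in>S. Poly_Mapping.single i (Poly_Mapping.lookup m i)"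
      have i: "i \<in> I" and t: "h (H0_monom ?t) \<in> B" "Poly_Mapping.keys ?t \<subseteq> I"
        using insert by auto
      have s: "Poly_Mapping.keys ?s \<subseteq> I" using i by auto
      have "h (H0_monom (?s + ?t)) \<in> B"
        unfolding mult[OF s t(2)] by (rule B(4)[OF single[OF i] t(1)])
      moreover have "Poly_Mapping.keys (?s + ?t) \<subseteq> I"
        using s t(2) Poly_Mapping.keys_add[of ?s ?t] by blast
      ultimately show ?case using insert.hyps by simp
    qed
    moreover have "(\<Sum>i\<in>Poly_Mapping.keys m. Poly_Mapping.single i (Poly_Mapping.lookup m i)) = m"
      by (rule poly_mapping_eqI) (simp add: lookup_sum lookup_single when_def in_keys_iff)
    ultimately show ?thesis using that by (metis finite_keys)
  qed
  then show "h ` H0_monom ` {m. Poly_Mapping.keys m \<subseteq> I} \<subseteq> B" by auto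
  show "H0_monom ` {m. Poly_Mapping.keys m \<subseteq> I} \<subseteq> carr (H0_alg av I)" using H0_monom_carr by auto
  show "bdd_below (range (nrm (H0_alg av I)))"
    using bdd_below_nrm_coprod1 by (simp add: H0_alg_simps)
  show "module (scl (H0_alg av I))" "module.subspace (scl (H0_alg av I)) (carr (H0_alg av I))"
    unfolding H0_alg_simps by (auto simp: module_iff_vector_space c0_vs c0_subspace)
qed (auto intro: H0_monom_dense)

end

text \<open>\<open>B\<close> contains the three factors, hence all products y h x, which are the
  pure tensors; their linear combinations are dense in the completed tensor product
  \<open>U\<close>. This is applied to the set on which two derivations agree.\<close>

lemma (in complete_nonarch_field) is_U_an_generated:
  fixes U :: "('k, 'u::ring_1, 'i) envelope"
  assumes U: "is_U_an av R r s U" and rs: "0 < r" "0 < s"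
    and B: "module.subspace (scl U) B" "norm_closed U B" "1 \<in> B" "\<And>x y. x \<in> B \<Longrightarrow> y \<in> B \<Longrightarrow> x * y \<in> B"
    and gen: "genF U ` idx R \<union> genH U ` idx R \<union> genE U ` idx R \<subseteq> B"
  shows "x \<in> B"
proof -
  interpret nonarch_banach_algebra av U by unfold_locales (use U in \<open>simp add: is_U_an_def\<close>)
  obtain hm h0 hp where
    hm: "embeds_quotient (T_alg av (idx R) r) (serre_ideal av R r) U hm" and
    h0: "embeds_quotient (H0_alg av (idx R)) {0} U h0" and
    hp: "embeds_quotient (T_alg av (idx R) s) (serre_ideal av R s) U hp" and
    g: "\<forall>i\<in>idx R. genF U i = hm (T_word [i]) \<and> genH U i = h0 (H0_gen i) \<and> genE U i = hp (T_word [i])" and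
    t: "is_completed_tensor av
          [subsp U (hm ` carr (T_alg av (idx R) r)), subsp U (h0 ` carr (H0_alg av (idx R))),
           subsp U (hp ` carr (T_alg av (idx R) s))] U prod_list" (is "is_completed_tensor _ ?Vs _ _")
    using U unfolding is_U_an_def by blast
  have "hm ` carr (T_alg av (idx R) r) \<subseteq> B"
    using gen g by (intro T_alg_image_subset[OF rs(1) hm[unfolded serre_ideal_def] B]) auto
  moreover have "h0 ` carr (H0_alg av (idx R)) \<subseteq> B"
    using gen g by (intro H0_alg_image_subset[OF h0 B]) auto
  moreover have "hp ` carr (T_alg av (idx R) s) \<subseteq> B"
    using gen g by (intro T_alg_image_subset[OF rs(2) hp[unfolded serre_ideal_def] B]) auto
  ultimately have factors: "carr (?Vs ! i) \<subseteq> B" if "i < 3" for i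
    using that by (auto simp: subsp_def less_Suc_eq numeral_3_eq_3)
  have prods: "prod_list xs \<in> B" if "set xs \<subseteq> B" for xs
    using that B(3,4) by (induction xs) auto
  have dom: "set xs \<subseteq> B" if "xs \<in> tens_dom ?Vs" for xs
  proof
    fix y assume "y \<in> set xs"
    then obtain i where "i < length xs" "y = xs ! i" by (auto simp: in_set_conv_nth)
    then show "y \<in> B" using that factors[of i] by (auto simp: tens_dom_def)
  qed
  have "\<forall>x\<in>carr U. \<forall>e>0. \<exists>z. Poly_Mapping.keys z \<subseteq> tens_dom ?Vs \<and> nrm U (x - tens_ext U prod_list z) < e"
    using t unfolding is_completed_tensor_def by (elim conjE)
  then have dense: "\<exists>z. Poly_Mapping.keys z \<subseteq> tens_dom ?Vs \<and> nrm U (x - tens_ext U prod_list z) < e" if "e > 0" for e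
    unfolding carr_UNIV using that by (elim ballE allE impE) auto
  show ?thesis
  proof (rule norm_closedD[OF B(2)])
    fix e :: real assume "e > 0"
    then obtain z where z: "Poly_Mapping.keys z \<subseteq> tens_dom ?Vs" "nrm U (x - tens_ext U prod_list z) < e"
      using dense by blast
    have "tens_ext U prod_list z \<in> B"
      unfolding tens_ext_def using z(1) dom prods
      by (intro subspace_sum[OF B(1)] subspace_scale[OF B(1)]) blast
    then show "\<exists>y\<in>B. nrm U (x - y) < e" using z(2) by blast
  qed
qed

section \<open>Derivations as cocycles\<close>

lemma tuples_1: "xs \<in> tuples G 1 \<longleftrightarrow> (\<exists>x\<in>carr G. xs = [x])"
  by (cases xs) (auto simp: tuples_def)

lemma tuples_2: "xs \<in> tuples G 2 \<longleftrightarrow> (\<exists>x\<in>carr G. \<exists>y\<in>carr G. xs = [x, y])"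
  by (auto simp: tuples_def length_Suc_conv numeral_2_eq_2)

lemma alt_sign_0 [simp]: "alt_sign n 0 = 0"
  by (simp add: alt_sign_def)

lemma cobound_0:
  assumes "x \<in> carr G" shows "cobound G act 0 f [x] = act x (f [])"
proof -
  have "{(i, j). i < j \<and> j < Suc 0} = {}" by auto
  then show ?thesis
    unfolding cobound_def using assms by (simp only:) (simp add: tuples_def alt_sign_def)
qed

text \<open>Positions count from 0, so the minus signs belong to the pair (0, 1) and to the position
  1.\<close>

lemma cobound_1:
  assumes "x \<in> carr G" "y \<in> carr G"
  shows "cobound G act 1 f [x, y] = act x (f [y]) - act y (f [x]) - f [lie_bracket x y]"
proof -
  have "{(i, j). i < j \<and> j < Suc 1} = {(0::nat, 1::nat)}" by auto
  moreover have "nths [x, y] (- {0, 1}) = []" "nths [x, y] (- {0}) = [y]" "nths [x, y] (- {1}) = [x]"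
    by (auto simp: nths_Cons)
  ultimately show ?thesis
    using assms by (simp add: cobound_def tuples_def alt_sign_def lessThan_Suc)
qed

text \<open>The empty product is 1, so the admissible constants form a closed ray starting at the
  norm of the value at \<open>[]\<close>.\<close>

lemma (in nonarch_banach_algebra) cochain_norm_0: "cochain_norm G U 0 f = nrm U (f [])"
proof -
  have "{C. 0 \<le> C \<and> (\<forall>xs\<in>tuples G 0. nrm U (f xs) \<le> C * (\<Prod>i<0. nrm G (xs ! i)))} = {nrm U (f [])..}"
    using order_trans[OF nrm_nonneg] by (auto simp: tuples_def)
  then show ?thesis by (simp add: cochain_norm_def)
qed

lemma cochain_norm_1_le:
  assumes "0 \<le> C" "\<And>x. x \<in> carr G \<Longrightarrow> nrm M (f [x]) \<le> C * nrm G x"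
  shows "cochain_norm G M 1 f \<le> C"
  unfolding cochain_norm_def
  by (rule cInf_lower) (use assms in \<open>auto simp: tuples_1[unfolded One_nat_def] intro!: bdd_belowI[of _ 0]\<close>)

lemma closed_lie_span:
  fixes U :: "('k::field_char_0, 'u::ring_1, 'z) nspace_scheme"
  assumes "module (scl U)"
  shows "module.subspace (scl U) (closed_lie_span U S)"
    and "S \<subseteq> closed_lie_span U S"
    and "x \<in> closed_lie_span U S \<Longrightarrow> y \<in> closed_lie_span U S \<Longrightarrow> lie_bracket x y \<in> closed_lie_span U S"
proof -
  interpret module "scl U" by fact
  show "subspace (closed_lie_span U S)"
    unfolding closed_lie_span_def by (rule subspace_Inter) auto
  show "S \<subseteq> closed_lie_span U S" unfolding closed_lie_span_def by blast
  show "lie_bracket x y \<in> closed_lie_span U S" if "x \<in> closed_lie_span U S" "y \<in> closed_lie_span U S"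
    using that unfolding closed_lie_span_def by blast
qed

text \<open>\<open>D\<close> is a derivation into \<open>U'\<close>, a bimodule over
  \<open>U\<close> through \<phi>. In the application \<phi> is the reduction of \<alpha> modulo
  \<hbar>, \<open>D\<close> is the obstruction at \<open>\<hbar>\<^sup>n\<close> and
  \<open>C\<close> is \<open>\<rho>\<^sup>-\<^sup>n\<close>.\<close>

locale bounded_derivation =
  U: nonarch_banach_algebra av U + U': nonarch_banach_algebra av U'
  for av :: "'k::field_char_0 \<Rightarrow> real"
    and U :: "('k, 'u::ring_1, 'i) envelope" and U' :: "('k, 'v::ring_1, 'z) nspace_scheme" +
  fixes \<phi> :: "'u \<Rightarrow> 'v" and D :: "'u \<Rightarrow> 'v" and C :: real
  assumes \<phi>_add: "\<phi> (x + y) = \<phi> x + \<phi> y" and \<phi>_mult: "\<phi> (x * y) = \<phi> x * \<phi> y" and \<phi>_one: "\<phi> 1 = 1"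
    and \<phi>_scl: "\<phi> (scl U c x) = scl U' c (\<phi> x)" and \<phi>_bound: "nrm U' (\<phi> x) \<le> nrm U x"
    and D_add: "D (x + y) = D x + D y" and D_scl: "D (scl U c x) = scl U' c (D x)"
    and D_mult: "D (x * y) = \<phi> x * D y + D x * \<phi> y"
    and D_bound: "nrm U' (D x) \<le> C * nrm U x" and C_nonneg: "0 \<le> C"
begin

lemma D_0: "D 0 = 0"
  using D_add[of 0 0] by simp

lemma D_diff: "D (x - y) = D x - D y"
  using D_add[of "x - y" y] by simp

lemma \<phi>_diff: "\<phi> (x - y) = \<phi> x - \<phi> y"
  using \<phi>_add[of "x - y" y] by simp

abbreviation (input) act :: "'u \<Rightarrow> 'v \<Rightarrow> 'v" where
  "act x u \<equiv> lie_bracket (\<phi> x) u"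

lemma act_add: "act (x + y) m = act x m + act y m"
  by (simp add: lie_bracket_def \<phi>_add algebra_simps)

lemma act_diff: "act (x - y) m = act x m - act y m"
  by (simp add: lie_bracket_def \<phi>_diff algebra_simps)

text \<open>An inner derivation obeys the same Leibniz rule as \<open>D\<close>, so the set on which
  the two agree is closed under products.\<close>

lemma act_mult: "act (x * y) m = \<phi> x * act y m + act x m * \<phi> y"
  by (simp add: lie_bracket_def \<phi>_mult algebra_simps)

lemma act_scl: "act (scl U c x) m = scl U' c (act x m)"
  by (simp add: lie_bracket_def \<phi>_scl U'.scale_right_diff_distrib
      U'.scl_mult_left[of c "\<phi> x" m] U'.scl_mult_right[of c m "\<phi> x"])

text \<open>The ultrametric inequality bounds the commutator by the larger of its two terms, without
  a factor 2.\<close>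

lemma nrm_act_le: "nrm U' (act x m) \<le> nrm U' m * nrm U x"
proof -
  have "nrm U' (\<phi> x * m) \<le> nrm U' m * nrm U x"
    using U'.nrm_mult_le mult_right_mono[OF \<phi>_bound[of x] U'.nrm_nonneg[of m]]
    by (simp add: mult.commute) (metis order_trans mult.commute)
  moreover have "nrm U' (m * \<phi> x) \<le> nrm U' m * nrm U x"
    using U'.nrm_mult_le mult_left_mono[OF \<phi>_bound[of x] U'.nrm_nonneg[of m]] by (rule order_trans)
  ultimately show ?thesis
    using U'.nrm_diff_le[of "\<phi> x * m" "m * \<phi> x"] by (simp add: lie_bracket_def)
qed

definition cocycle :: "('i, 'p) root_datum \<Rightarrow> 'u list \<Rightarrow> 'v" where
  "cocycle R xs = (if xs \<in> tuples (g_an R U) 1 then D (hd xs) else 0)"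

lemma g_an_simps [simp]: "scl (g_an R U) = scl U" "nrm (g_an R U) = nrm U"
  by (simp_all add: g_an_def subsp_def)

lemma g_an_carr:
  shows "U.subspace (carr (g_an R U))"
    and "genF U ` idx R \<union> genH U ` idx R \<union> genE U ` idx R \<subseteq> carr (g_an R U)"
    and "x \<in> carr (g_an R U) \<Longrightarrow> y \<in> carr (g_an R U) \<Longrightarrow> lie_bracket x y \<in> carr (g_an R U)"
  using closed_lie_span[OF U.module_axioms] by (simp_all add: g_an_def subsp_def)

lemma cocycle_single: "x \<in> carr (g_an R U) \<Longrightarrow> cocycle R [x] = D x"
  by (simp add: cocycle_def tuples_def)

text \<open>The coboundary at x, y is [\<phi> x, D y] - [\<phi> y, D x] - D [x, y], which vanishes
  by the Leibniz rule for x y and y x. In degree 1 the alternating condition is vacuous.\<close>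

lemma cocycle_in_cocycles: "cocycle R \<in> cocycles (g_an R U) U' act 1"
proof -
  let ?G = "g_an R U"
  note sub = g_an_carr(1)[of R]
  have upd: "xs[i := x] = [x]" if "xs \<in> tuples ?G 1" "i < 1" for xs i x
    using that by (auto simp: tuples_1[unfolded One_nat_def])
  have "cocycle R \<in> carr (cochains ?G U' 1)"
    unfolding cochains_def nspace.simps mem_Collect_eq
  proof (intro conjI ballI allI impI)
    fix xs assume xs: "xs \<in> tuples ?G 1"
    fix i :: nat assume i: "i < 1"
    fix x assume x: "x \<in> carr ?G"
    show "cocycle R (xs[i := x + y]) = cocycle R (xs[i := x]) + cocycle R (xs[i := y])" if "y \<in> carr ?G" for y
      using U.subspace_add[OF sub x that] x that by (simp only: upd[OF xs i] cocycle_single D_add)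
    show "cocycle R (xs[i := scl ?G c x]) = scl U' c (cocycle R (xs[i := x]))" for c
      using U.subspace_scale[OF sub x] x by (simp only: upd[OF xs i] cocycle_single g_an_simps D_scl)
  next
    show "\<exists>C. \<forall>xs\<in>tuples ?G 1. nrm U' (cocycle R xs) \<le> C * (\<Prod>i<1. nrm ?G (xs ! i))"
      using D_bound by (intro exI[of _ C]) (auto simp: tuples_1[unfolded One_nat_def] cocycle_single)
  next
    fix xs :: "'u list" and i j :: nat assume "i < 1" "j < 1" "i \<noteq> j \<and> xs ! i = xs ! j"
    then show "cocycle R xs = 0" by simp
  qed (auto simp: cocycle_def)
  moreover have "cobound ?G act 1 (cocycle R) xs = 0" for xs
  proof (cases "xs \<in> tuples ?G 2")
    case True
    then obtain x y where xy: "xs = [x, y]" "x \<in> carr ?G" "y \<in> carr ?G" unfolding tuples_2 by blast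
    show ?thesis
      unfolding xy(1) cobound_1[OF xy(2,3)] cocycle_single[OF xy(2)] cocycle_single[OF xy(3)]
        cocycle_single[OF g_an_carr(3)[OF xy(2,3)]]
      by (simp add: lie_bracket_def D_diff D_mult)
  next
    case False
    then show ?thesis by (simp add: cobound_def numeral_2_eq_2)
  qed
  ultimately show ?thesis by (auto simp: cocycles_def)
qed

text \<open>Exactness writes the cocycle as the coboundary of some \<open>f\<close>, and contraction
  bounds the class of \<open>f\<close> by \<open>C\<close>. The infimum need not be attained, so a
  representative f + j is only found below a larger \<open>C'\<close>. Since \<open>j\<close> is a
  0-cocycle, the action kills its value and the coboundary is unchanged.\<close>

lemma inner_on_g_an:
  assumes exact: "strictly_exact_at (g_an R U) U' act 1"
    and contr: "inverse_contracting (g_an R U) U' act 1"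
    and C': "C < C'"
  obtains m where "nrm U' m < C'" and "\<And>x. x \<in> carr (g_an R U) \<Longrightarrow> D x = act x m"
proof -
  let ?G = "g_an R U"
  let ?B = "cochains ?G U' 0" and ?Z = "cocycles ?G U' act 0"
  obtain f where f: "f \<in> carr ?B" "cocycle R = cobound ?G act 0 f"
    using cocycle_in_cocycles[of R] exact by (auto simp: strictly_exact_at_def)
  have "quot_norm ?B ?Z f \<le> nrm (cochains ?G U' 1) (cocycle R)"
    using contr f by (simp add: inverse_contracting_def)
  also have "\<dots> \<le> C"
    unfolding cochains_def nspace.simps
    using D_bound C_nonneg by (intro cochain_norm_1_le) (simp_all add: cocycle_single)
  finally have lt: "Inf {nrm ?B (f + j) |j. j \<in> ?Z} < C'" using C' by (simp add: quot_norm_def)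
  \<comment> \<open>The zero cochain makes the set under the infimum nonempty, as
    \<open>cInf_lessD\<close> requires.\<close>
  have "cobound ?G act 0 (\<lambda>_. 0) = 0"
    by (rule ext) (simp add: cobound_def lie_bracket_def split_beta)
  then have "(\<lambda>_. 0) \<in> ?Z"
    by (auto simp: cocycles_def cochains_def intro!: exI[of _ 0])
  then have "{nrm ?B (f + j) |j. j \<in> ?Z} \<noteq> {}" by auto
  from cInf_lessD[OF this lt] obtain j where j: "j \<in> ?Z" "nrm ?B (f + j) < C'" by auto
  show thesis
  proof
    show "nrm U' (f [] + j []) < C'"
      using j(2) by (simp add: cochains_def U'.cochain_norm_0)
    fix x assume x: "x \<in> carr ?G"
    have "act x (j []) = 0"
      using j(1) cobound_0[OF x, of act j] by (simp add: cocycles_def)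
    moreover have "act x (f []) = D x"
      using cobound_0[OF x, of act f] cocycle_single[OF x] by (simp flip: f(2))
    ultimately show "D x = act x (f [] + j [])"
      by (simp add: lie_bracket_def algebra_simps)
  qed
qed

text \<open>The set where \<open>D\<close> agrees with the inner derivation is a closed subalgebra,
  since both are bounded derivations, and it contains the generators; hence it is all of
  \<open>U\<close>.\<close>

lemma inner:
  assumes U_an: "is_U_an av R r s U" "0 < r" "0 < s"
    and exact: "strictly_exact_at (g_an R U) U' act 1"
    and contr: "inverse_contracting (g_an R U) U' act 1"
    and C': "C < C'"
  obtains m where "nrm U' m < C'" and "\<And>x. D x = act x m"
proof -
  obtain m where m: "nrm U' m < C'" and on_g: "\<And>x. x \<in> carr (g_an R U) \<Longrightarrow> D x = act x m"
    using inner_on_g_an[OF exact contr C'] by blast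
  define B where "B = {x. D x = act x m}"
  have "act 0 m = 0" using act_diff[of 0 0 m] by simp
  then have "U.subspace B"
    by (auto simp: U.subspace_def B_def D_0 D_add D_scl act_add act_scl)
  moreover have "norm_closed U B"
    unfolding norm_closed_def
  proof (intro allI ballI impI)
    fix X x assume X: "(\<forall>n. X n \<in> B) \<and> (\<lambda>n. nrm U (X n - x)) \<longlonglongrightarrow> 0"
    let ?K = "max C (nrm U' m)"
    have "nrm U' (D x - act x m) \<le> ?K * nrm U (X n - x)" for n
    proof -
      \<comment> \<open>The two derivations agree at \<open>X n\<close>, so their difference at
        \<open>x\<close> can be estimated at \<open>X n - x\<close>, which tends to 0.\<close>
      have "D x - act x m = act (X n - x) m - D (X n - x)"
        using X by (simp add: B_def D_diff act_diff)
      then have "nrm U' (D x - act x m) \<le> max (nrm U' (act (X n - x) m)) (nrm U' (D (X n - x)))"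
        by (simp only: U'.nrm_diff_le)
      also have "\<dots> \<le> ?K * nrm U (X n - x)"
      proof (rule max.boundedI)
        have "nrm U' m * nrm U (X n - x) \<le> ?K * nrm U (X n - x)"
          by (rule mult_right_mono) simp_all
        then show "nrm U' (act (X n - x) m) \<le> ?K * nrm U (X n - x)"
          using nrm_act_le by (rule order_trans[rotated])
        have "C * nrm U (X n - x) \<le> ?K * nrm U (X n - x)"
          by (rule mult_right_mono) simp_all
        then show "nrm U' (D (X n - x)) \<le> ?K * nrm U (X n - x)"
          using D_bound by (rule order_trans[rotated])
      qed
      finally show ?thesis .
    qed
    moreover have "(\<lambda>n. ?K * nrm U (X n - x)) \<longlonglongrightarrow> ?K * 0"
      using X by (intro tendsto_mult_left) simp
    ultimately have "nrm U' (D x - act x m) \<le> 0"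
      by (intro LIMSEQ_le_const[of _ 0]) auto
    then have "nrm U' (D x - act x m) = 0" using U'.nrm_nonneg[of "D x - act x m"] by linarith
    then show "x \<in> B" by (simp add: B_def)
  qed
  moreover have "1 \<in> B" using D_mult[of 1 1] by (simp add: B_def \<phi>_one lie_bracket_def)
  moreover have "x * y \<in> B" if "x \<in> B" "y \<in> B" for x y
    using that by (simp add: B_def D_mult act_mult)
  moreover have "genF U ` idx R \<union> genH U ` idx R \<union> genE U ` idx R \<subseteq> B"
    using g_an_carr(2)[of R] on_g by (auto simp: B_def)
  ultimately have "x \<in> B" for x by (rule U.is_U_an_generated[OF U_an])
  then show thesis using that m by (simp add: B_def)
qed

end

unbundle fps_syntax

section \<open>Power series\<close>

lemma fps_decompose: "a = fps_const (a $ 0) + fps_X * fps_shift 1 a" for a :: "'u::ring_1 fps"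
  by (rule fps_ext) (simp add: fps_X_mult_nth)

text \<open>The recursion expresses coefficient n + 1 at \<open>a\<close> through coefficient n at
  \<open>s a\<close>, so induction determines the whole series. This replaces computations with
  convolution sums when maps on power series are compared; \<open>Q\<close> allows a restriction to
  convergent series.\<close>

lemma fps_recursion_unique:
  fixes L M :: "'a \<Rightarrow> 'v::ring_1 fps"
  assumes "Q a" and "\<And>a. Q a \<Longrightarrow> Q (s a)"
    and "\<And>a. Q a \<Longrightarrow> L a = p a + fps_X * L (s a)"
    and "\<And>a. Q a \<Longrightarrow> M a = p a + fps_X * M (s a)"
  shows "L a = M a"
proof (rule fps_ext)
  show "L a $ n = M a $ n" for n
    using assms(1)
  proof (induction n arbitrary: a)
    case 0
    have "(p a + fps_X * L (s a)) $ 0 = (p a + fps_X * M (s a)) $ 0" by simp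
    then show ?case using assms(3,4)[OF 0] by simp
  next
    case (Suc n)
    have "(p a + fps_X * L (s a)) $ Suc n = (p a + fps_X * M (s a)) $ Suc n"
      using Suc.IH[OF assms(2)[OF Suc.prems]] by simp
    then show ?case using assms(3,4)[OF Suc.prems] by simp
  qed
qed

context nonarch_banach_algebra
begin

lemma hser_iff: "a \<in> hser U \<rho> \<longleftrightarrow> (\<lambda>n. nrm U (a $ n) * \<rho> ^ n) \<longlonglongrightarrow> 0"
  by (simp add: hser_def)

lemma hnorm_ge:
  assumes "a \<in> hser U \<rho>" shows "nrm U (a $ n) * \<rho> ^ n \<le> hnorm U \<rho> a"
proof -
  have "Bseq (\<lambda>n. nrm U (a $ n) * \<rho> ^ n)"
    using assms by (auto simp: hser_iff intro: convergent_imp_Bseq convergentI)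
  then show ?thesis unfolding hnorm_def by (intro cSUP_upper Bseq_bdd_above) auto
qed

lemma hnorm_le: "(\<And>n. nrm U (a $ n) * \<rho> ^ n \<le> B) \<Longrightarrow> hnorm U \<rho> a \<le> B"
  unfolding hnorm_def by (rule cSUP_least) auto

lemma hser_finite:
  assumes "\<And>n. n > N \<Longrightarrow> a $ n = 0" shows "a \<in> hser U \<rho>"
proof -
  have "\<forall>\<^sub>F n in sequentially. nrm U (a $ n) * \<rho> ^ n = 0"
    using eventually_gt_at_top[of N] by eventually_elim (simp add: assms)
  then show ?thesis unfolding hser_iff by (rule tendsto_eventually)
qed

lemma fps_const_hser: "fps_const u \<in> hser U \<rho>"
  by (rule hser_finite[of 0]) simp

lemma hnorm_fps_const_le: "hnorm U \<rho> (fps_const u) \<le> nrm U u"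
  by (rule hnorm_le) (simp add: fps_nth_fps_const)

lemma fps_shift_hser:
  assumes "0 < \<rho>" "a \<in> hser U \<rho>" shows "fps_shift 1 a \<in> hser U \<rho>"
proof -
  have "(\<lambda>n. nrm U (a $ Suc n) * \<rho> ^ Suc n) \<longlonglongrightarrow> 0"
    using assms(2) LIMSEQ_Suc unfolding hser_iff by blast
  then have "(\<lambda>n. nrm U (a $ Suc n) * \<rho> ^ Suc n / \<rho>) \<longlonglongrightarrow> 0 / \<rho>"
    by (rule tendsto_divide) (use assms in auto)
  then show ?thesis using assms(1) by (simp add: hser_iff field_simps)
qed

lemma hser_mono:
  assumes "0 \<le> \<rho>" "a \<in> hser U \<rho>" "\<And>n. nrm U (b $ n) \<le> nrm U (a $ n)"
  shows "b \<in> hser U \<rho>"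
  unfolding hser_iff
proof (rule tendsto_sandwich[OF _ _ tendsto_const])
  show "(\<lambda>n. nrm U (a $ n) * \<rho> ^ n) \<longlonglongrightarrow> 0" using assms(2) by (simp add: hser_iff)
qed (use assms in \<open>auto intro!: always_eventually mult_right_mono\<close>)

text \<open>A bound at radius \<rho> becomes geometric decay with ratio \<sigma> / \<rho> at the
  smaller radius.\<close>

lemma hser_of_bounded:
  assumes "0 < \<sigma>" "\<sigma> < \<rho>" and bound: "\<And>n. nrm U (a $ n) * \<rho> ^ n \<le> C"
  shows "a \<in> hser U \<sigma>"
  unfolding hser_iff
proof (rule tendsto_sandwich[OF _ _ tendsto_const])
  show "(\<lambda>n. C * (\<sigma> / \<rho>) ^ n) \<longlonglongrightarrow> 0"
    using assms by (intro tendsto_mult_right_zero LIMSEQ_power_zero) simp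
  have "nrm U (a $ n) * \<sigma> ^ n \<le> C * (\<sigma> / \<rho>) ^ n" for n
  proof -
    have "nrm U (a $ n) * \<sigma> ^ n = (nrm U (a $ n) * \<rho> ^ n) * (\<sigma> / \<rho>) ^ n"
      using assms by (simp add: power_divide)
    also have "\<dots> \<le> C * (\<sigma> / \<rho>) ^ n" using assms by (intro mult_right_mono bound) simp
    finally show ?thesis .
  qed
  then show "\<forall>\<^sub>F n in sequentially. nrm U (a $ n) * \<sigma> ^ n \<le> C * (\<sigma> / \<rho>) ^ n" by simp
qed (use assms in auto)

text \<open>With scalar series viewed inside \<open>U\<close>, \<open>hscl\<close> becomes a
  product, and linearity follows from multiplicativity.\<close>

definition scalar_fps :: "'k fps \<Rightarrow> 'u fps" where
  "scalar_fps c = Abs_fps (\<lambda>n. scl U (c $ n) 1)"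

lemma scalar_fps_nth [simp]: "scalar_fps c $ n = scl U (c $ n) 1"
  by (simp add: scalar_fps_def)

lemma hscl_eq_mult: "hscl U c a = scalar_fps c * a"
  by (rule fps_ext) (simp add: hscl_def fps_mult_nth atLeast0AtMost flip: scl_mult_left)

text \<open>Submultiplicativity of the Gauss norm, localized at one coefficient: each term of the
  convolution distributes \<open>\<rho> ^ n\<close> over its two factors, and the ultrametric
  inequality handles the sum.\<close>

lemma fps_mult_bound:
  assumes "0 < \<rho>" "0 \<le> K" "\<And>i. i \<le> n \<Longrightarrow> nrm U (a $ i) * \<rho> ^ i \<le> K"
    "\<And>i. i \<le> n \<Longrightarrow> nrm U (b $ i) * \<rho> ^ i \<le> 1"
  shows "nrm U ((a * b) $ n) * \<rho> ^ n \<le> K" and "nrm U ((b * a) $ n) * \<rho> ^ n \<le> K"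
proof -
  have *: "nrm U (x * y) * \<rho> ^ n \<le> K"
    if "i \<le> n" "nrm U x * \<rho> ^ i * (nrm U y * \<rho> ^ (n - i)) \<le> K" for i x y
  proof -
    have "nrm U (x * y) * \<rho> ^ n \<le> nrm U x * nrm U y * \<rho> ^ n"
      using assms(1) by (intro mult_right_mono nrm_mult_le) simp
    also have "\<dots> = nrm U x * \<rho> ^ i * (nrm U y * \<rho> ^ (n - i))"
      using power_add[of \<rho> i "n - i"] that(1) by simp
    finally show ?thesis using that(2) by simp
  qed
  have **: "nrm U (sum f {0..n}) * \<rho> ^ n \<le> K" if "\<And>i. i \<le> n \<Longrightarrow> nrm U (f i) * \<rho> ^ n \<le> K" for f
  proof -
    have "nrm U (sum f {0..n}) \<le> K / \<rho> ^ n"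
      using that assms by (intro nrm_sum_le) (auto simp: field_simps)
    then show ?thesis using assms(1) by (simp add: field_simps)
  qed
  have pos: "0 \<le> nrm U x * \<rho> ^ i" for x i using assms(1) by simp
  show "nrm U ((a * b) $ n) * \<rho> ^ n \<le> K"
    unfolding fps_mult_nth
  proof (rule **)
    fix i assume i: "i \<le> n"
    have "nrm U (a $ i) * \<rho> ^ i * (nrm U (b $ (n - i)) * \<rho> ^ (n - i)) \<le> K * 1"
      using assms(2) by (intro mult_mono assms(3,4) pos i) auto
    then show "nrm U (a $ i * b $ (n - i)) * \<rho> ^ n \<le> K" using *[OF i] by simp
  qed
  show "nrm U ((b * a) $ n) * \<rho> ^ n \<le> K"
    unfolding fps_mult_nth
  proof (rule **)
    fix i assume i: "i \<le> n"
    have "nrm U (b $ i) * \<rho> ^ i * (nrm U (a $ (n - i)) * \<rho> ^ (n - i)) \<le> 1 * K"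
      using assms(2) by (intro mult_mono assms(3,4) pos i) auto
    then show "nrm U (b $ i * a $ (n - i)) * \<rho> ^ n \<le> K" using *[OF i] by simp
  qed
qed

text \<open>Coefficient n of the inverse is minus the sum of \<open>F $ i\<close> times its
  coefficient n - i, for i from 1 to n. Only earlier coefficients occur, so strong induction and the
  ultrametric inequality preserve the bound 1.\<close>

lemma fps_right_inverse_bound:
  assumes \<rho>: "0 < \<rho>" and F: "\<And>n. nrm U (F $ n) * \<rho> ^ n \<le> 1"
  shows "nrm U (fps_right_inverse F 1 $ n) * \<rho> ^ n \<le> 1"
proof (induction n rule: less_induct)
  case (less n)
  show ?case
  proof (cases n)
    \<comment> \<open>The second argument of \<open>fps_right_inverse\<close> is the constant
      coefficient of the inverse, here 1.\<close>
    case 0 then show ?thesis by (simp add: nrm_one_le)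
  next
    case (Suc m)
    let ?G = "fps_right_inverse F 1"
    have "nrm U (F $ i * ?G $ (n - i)) \<le> 1 / \<rho> ^ n" if i: "i \<in> {1..n}" for i
    proof -
      have "nrm U (F $ i) * \<rho> ^ i * (nrm U (?G $ (n - i)) * \<rho> ^ (n - i)) \<le> 1 * 1"
        using \<rho> i by (intro mult_mono F less) auto
      also have "nrm U (F $ i) * \<rho> ^ i * (nrm U (?G $ (n - i)) * \<rho> ^ (n - i)) =
          nrm U (F $ i) * nrm U (?G $ (n - i)) * \<rho> ^ (i + (n - i))"
        by (simp only: power_add ac_simps)
      also have "i + (n - i) = n" using i by simp
      finally have "nrm U (F $ i) * nrm U (?G $ (n - i)) \<le> 1 / \<rho> ^ n"
        using \<rho> by (simp add: field_simps)
      then show ?thesis using nrm_mult_le by (rule order_trans[rotated])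
    qed
    then have "nrm U (\<Sum>i\<in>{1..n}. F $ i * ?G $ (n - i)) \<le> 1 / \<rho> ^ n"
      using \<rho> by (intro nrm_sum_le) auto
    moreover have "?G $ n = - (\<Sum>i\<in>{1..n}. F $ i * ?G $ (n - i))" by (simp add: Suc)
    ultimately have "nrm U (?G $ n) \<le> 1 / \<rho> ^ n" by (simp only: nrm_minus)
    then show ?thesis using \<rho> by (simp add: field_simps)
  qed
qed

end

text \<open>
  For \<open>\<Phi>\<close> the restriction of \<open>\<alpha>\<close> to \<open>U\<close> this is \<open>\<alpha>\<close> on \<open>U{\<hbar>/\<epsilon>}\<close> and its base change on
  \<open>U{\<hbar>/\<epsilon>'}\<close>; no convergence is involved, since each coefficient is a finite sum.
\<close>

definition hext :: "('u::ring_1 \<Rightarrow> 'v::ring_1 fps) \<Rightarrow> 'u fps \<Rightarrow> 'v fps" where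
  "hext \<Phi> a = Abs_fps (\<lambda>n. \<Sum>i\<le>n. \<Phi> (a $ i) $ (n - i))"

lemma hext_nth: "hext \<Phi> a $ n = (\<Sum>i\<le>n. \<Phi> (a $ i) $ (n - i))"
  by (simp add: hext_def)

text \<open>The terms with i = 0 form the first summand, the others are shifted by one degree. This
  is the shape that \<open>fps_recursion_unique\<close> requires.\<close>

lemma hext_decompose: "hext \<Phi> a = \<Phi> (a $ 0) + fps_X * hext \<Phi> (fps_shift 1 a)"
proof (rule fps_ext)
  fix n show "hext \<Phi> a $ n = (\<Phi> (a $ 0) + fps_X * hext \<Phi> (fps_shift 1 a)) $ n"
    by (cases n) (simp_all add: hext_nth sum.atMost_Suc_shift del: sum.atMost_Suc)
qed

text \<open>What a contracting morphism gives on the constants: an algebra homomorphism into power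
  series whose coefficient at \<open>\<hbar>\<^sup>n\<close> has norm at most
  \<open>\<epsilon>\<^sup>-\<^sup>n\<close>.\<close>

locale bounded_deformation =
  U: nonarch_banach_algebra av U + U': nonarch_banach_algebra av U'
  for av :: "'k::field_char_0 \<Rightarrow> real"
    and U :: "('k, 'u::ring_1, 'y) nspace_scheme" and U' :: "('k, 'v::ring_1, 'z) nspace_scheme" +
  fixes \<epsilon> :: real and \<Phi> :: "'u \<Rightarrow> 'v fps"
  assumes \<epsilon>_pos: "0 < \<epsilon>"
    and add: "\<Phi> (x + y) = \<Phi> x + \<Phi> y"
    and mult: "\<Phi> (x * y) = \<Phi> x * \<Phi> y"
    and one: "\<Phi> 1 = 1"
    and scl: "\<Phi> (scl U c x) $ n = scl U' c (\<Phi> x $ n)"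
    and bound: "nrm U' (\<Phi> x $ n) * \<epsilon> ^ n \<le> nrm U x"
begin

lemma zero: "\<Phi> 0 = 0"
  using add[of 0 0] by simp

lemma bound':
  assumes "0 < \<rho>" "\<rho> \<le> \<epsilon>" shows "nrm U' (\<Phi> x $ n) * \<rho> ^ n \<le> nrm U x"
proof -
  have "nrm U' (\<Phi> x $ n) * \<rho> ^ n \<le> nrm U' (\<Phi> x $ n) * \<epsilon> ^ n"
    using assms by (intro mult_left_mono power_mono) auto
  then show ?thesis using bound by (rule order_trans)
qed

lemma hext_fps_const: "hext \<Phi> (fps_const u) = \<Phi> u"
proof -
  have "hext \<Phi> 0 = 0" by (rule fps_ext) (simp add: hext_nth zero)
  moreover have "fps_shift 1 (fps_const u) = 0" by (rule fps_ext) simp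
  ultimately show ?thesis by (subst hext_decompose) simp
qed

lemma hext_add: "hext \<Phi> (a + b) = hext \<Phi> a + hext \<Phi> b"
  by (rule fps_ext) (simp add: hext_nth add sum.distrib)

lemma hext_fps_X: "hext \<Phi> (fps_X * a) = fps_X * hext \<Phi> a"
proof -
  have "fps_shift 1 (fps_X * a) = a" by (rule fps_ext) simp
  then show ?thesis by (subst hext_decompose) (simp add: zero)
qed

text \<open>The recursion runs over \<open>b\<close> here; in \<open>hext_mult\<close> it runs over
  \<open>a\<close>, with this case as its first term. Moving \<hbar> past \<open>\<Phi> u\<close>
  uses that \<hbar> is central.\<close>

lemma hext_mult_fps_const: "hext \<Phi> (fps_const u * b) = \<Phi> u * hext \<Phi> b"
proof (rule fps_recursion_unique[where Q = "\<lambda>_. True" and s = "fps_shift 1" and p = "\<lambda>b. \<Phi> u * \<Phi> (b $ 0)"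
      and L = "\<lambda>b. hext \<Phi> (fps_const u * b)" and M = "\<lambda>b. \<Phi> u * hext \<Phi> b"])
  fix b :: "'u fps"
  have "fps_shift 1 (fps_const u * b) = fps_const u * fps_shift 1 b"
    by (rule fps_ext) simp
  then show "hext \<Phi> (fps_const u * b) = \<Phi> u * \<Phi> (b $ 0) + fps_X * hext \<Phi> (fps_const u * fps_shift 1 b)"
    by (subst hext_decompose) (simp add: mult)
  show "\<Phi> u * hext \<Phi> b = \<Phi> u * \<Phi> (b $ 0) + fps_X * (\<Phi> u * hext \<Phi> (fps_shift 1 b))"
    by (subst hext_decompose) (simp add: distrib_left fps_mult_fps_X_commute mult.assoc)
qed auto

lemma hext_mult: "hext \<Phi> (a * b) = hext \<Phi> a * hext \<Phi> b"
proof (rule fps_recursion_unique[where Q = "\<lambda>_. True" and s = "fps_shift 1" and p = "\<lambda>a. \<Phi> (a $ 0) * hext \<Phi> b"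
      and L = "\<lambda>a. hext \<Phi> (a * b)" and M = "\<lambda>a. hext \<Phi> a * hext \<Phi> b"])
  fix a :: "'u fps"
  have "a * b = fps_const (a $ 0) * b + fps_X * (fps_shift 1 a * b)"
    by (subst fps_decompose[of a]) (simp only: distrib_right mult.assoc)
  then show "hext \<Phi> (a * b) = \<Phi> (a $ 0) * hext \<Phi> b + fps_X * hext \<Phi> (fps_shift 1 a * b)"
    by (simp only: hext_add hext_fps_X hext_mult_fps_const)
  show "hext \<Phi> a * hext \<Phi> b = \<Phi> (a $ 0) * hext \<Phi> b + fps_X * (hext \<Phi> (fps_shift 1 a) * hext \<Phi> b)"
    by (subst hext_decompose) (simp only: distrib_right mult.assoc)
qed auto

lemma hext_scalar_fps: "hext \<Phi> (U.scalar_fps c) = U'.scalar_fps c"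
proof (rule fps_ext)
  fix n
  \<comment> \<open>\<open>\<Phi>\<close> sends scalar multiples of 1 to constant series, so only i
    = n contributes.\<close>
  have "hext \<Phi> (U.scalar_fps c) $ n = (\<Sum>i\<le>n. if i = n then scl U' (c $ n) 1 else 0)"
    unfolding hext_nth by (rule sum.cong) (auto simp: scl one U'.scale_zero_right)
  then show "hext \<Phi> (U.scalar_fps c) $ n = U'.scalar_fps c $ n" by simp
qed

lemma hext_hscl: "hext \<Phi> (hscl U c a) = hscl U' c (hext \<Phi> a)"
  by (simp add: U.hscl_eq_mult U'.hscl_eq_mult hext_mult hext_scalar_fps)

lemma hext_bound:
  assumes \<rho>: "0 < \<rho>" "\<rho> \<le> \<epsilon>" and a: "\<And>n. nrm U (a $ n) * \<rho> ^ n \<le> B"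
  shows "nrm U' (hext \<Phi> a $ n) * \<rho> ^ n \<le> B"
proof -
  have B: "0 \<le> B" using a[of 0] U.nrm_nonneg[of "a $ 0"] by (simp del: U.nrm_nonneg)
  have "nrm U' (\<Phi> (a $ i) $ (n - i)) \<le> B / \<rho> ^ n" if i: "i \<le> n" for i
  proof -
    have "nrm U' (\<Phi> (a $ i) $ (n - i)) * \<rho> ^ (i + (n - i)) =
        nrm U' (\<Phi> (a $ i) $ (n - i)) * \<rho> ^ (n - i) * \<rho> ^ i"
      by (simp only: power_add ac_simps)
    also have "\<dots> \<le> nrm U (a $ i) * \<rho> ^ i" using \<rho> by (intro mult_right_mono bound') auto
    also have "\<dots> \<le> B" by (rule a)
    finally show ?thesis using \<rho> i by (simp add: field_simps)
  qed
  then have "nrm U' (hext \<Phi> a $ n) \<le> B / \<rho> ^ n"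
    unfolding hext_nth using B \<rho> by (intro U'.nrm_sum_le) auto
  then show ?thesis using \<rho> by (simp add: field_simps)
qed

text \<open>In each term of coefficient n either i is large, and \<open>a $ i\<close> is small at
  radius \<rho>, or n - i is large, and the power n - i of \<rho> / \<epsilon> is small because
  \<rho> is strictly below \<epsilon>.\<close>

lemma hext_hser:
  assumes \<rho>: "0 < \<rho>" "\<rho> < \<epsilon>" and a: "a \<in> hser U \<rho>"
  shows "hext \<Phi> a \<in> hser U' \<rho>"
  unfolding U'.hser_iff
proof (rule LIMSEQ_I)
  fix e :: real assume e: "e > 0"
  \<comment> \<open>The 1 keeps \<open>K\<close> positive, since it becomes a divisor.\<close>
  define K where "K = max 1 (hnorm U \<rho> a)"
  have K: "nrm U (a $ n) * \<rho> ^ n \<le> K" for n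
    using U.hnorm_ge[OF a, of n] by (simp add: K_def)
  have Kpos: "K > 0" by (simp add: K_def)
  have "(\<lambda>n. (\<rho> / \<epsilon>) ^ n) \<longlonglongrightarrow> 0" using \<rho> by (intro LIMSEQ_power_zero) simp
  then obtain M where M: "(\<rho> / \<epsilon>) ^ n < e / 2 / K" if "n \<ge> M" for n
    using order_tendstoD(2)[of _ 0 sequentially "e / 2 / K"] e Kpos
    by (fastforce simp: eventually_sequentially)
  obtain N where N: "nrm U (a $ n) * \<rho> ^ n < e / 2" if "n \<ge> N" for n
    using a order_tendstoD(2)[of _ 0 sequentially "e / 2"] e unfolding U.hser_iff
    by (fastforce simp: eventually_sequentially)
  have "nrm U' (hext \<Phi> a $ n) * \<rho> ^ n \<le> e / 2" if n: "n \<ge> N + M" for n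
  proof -
    have "nrm U' (\<Phi> (a $ i) $ (n - i)) \<le> e / 2 / \<rho> ^ n" if i: "i \<le> n" for i
    proof -
      have "nrm U' (\<Phi> (a $ i) $ (n - i)) * \<rho> ^ n =
          (nrm U' (\<Phi> (a $ i) $ (n - i)) * \<epsilon> ^ (n - i)) * (\<rho> ^ i * (\<rho> / \<epsilon>) ^ (n - i))"
      proof -
        have "\<rho> ^ n = \<rho> ^ i * \<rho> ^ (n - i)" using i by (simp flip: power_add)
        then show ?thesis using \<epsilon>_pos by (simp add: power_divide)
      qed
      also have "\<dots> \<le> nrm U (a $ i) * (\<rho> ^ i * (\<rho> / \<epsilon>) ^ (n - i))"
        using \<rho> by (intro mult_right_mono bound) auto
      also have "\<dots> = (nrm U (a $ i) * \<rho> ^ i) * (\<rho> / \<epsilon>) ^ (n - i)" by simp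
      also have "\<dots> \<le> e / 2"
      proof (cases "i \<ge> N")
        case True
        have "(nrm U (a $ i) * \<rho> ^ i) * (\<rho> / \<epsilon>) ^ (n - i) \<le> e / 2 * 1"
          using N[OF True] \<rho> e by (intro mult_mono power_le_one) auto
        then show ?thesis by simp
      next
        case False
        then have "(\<rho> / \<epsilon>) ^ (n - i) < e / 2 / K" using n by (intro M) simp
        then have "(nrm U (a $ i) * \<rho> ^ i) * (\<rho> / \<epsilon>) ^ (n - i) \<le> K * (e / 2 / K)"
          using K[of i] \<rho> Kpos by (intro mult_mono) auto
        then show ?thesis using Kpos by simp
      qed
      finally show ?thesis using \<rho> by (simp add: field_simps)
    qed
    then have "nrm U' (hext \<Phi> a $ n) \<le> e / 2 / \<rho> ^ n"
      unfolding hext_nth using \<rho> e by (intro U'.nrm_sum_le) auto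
    then show ?thesis using \<rho> by (simp add: field_simps)
  qed
  then have "norm (nrm U' (hext \<Phi> a $ n) * \<rho> ^ n - 0) < e" if "n \<ge> N + M" for n
    using that e \<rho> by (simp add: abs_mult) (smt (verit) field_sum_of_halves)
  then show "\<exists>n0. \<forall>n\<ge>n0. norm (nrm U' (hext \<Phi> a $ n) * \<rho> ^ n - 0) < e" by blast
qed

lemma h_morphism_hext:
  assumes "0 < \<rho>" "\<rho> < \<epsilon>" shows "h_morphism av U U' \<rho> (hext \<Phi>)"
  unfolding h_morphism_def
proof (intro conjI ballI)
  show "hext \<Phi> ` hser U \<rho> \<subseteq> hser U' \<rho>" using hext_hser[OF assms] by auto
  show "hext \<Phi> 1 = 1" using hext_fps_const[of 1] by (simp add: one)
  show "\<exists>C. \<forall>a\<in>hser U \<rho>. hnorm U' \<rho> (hext \<Phi> a) \<le> C * hnorm U \<rho> a"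
    using assms by (intro exI[of _ 1] ballI U'.hnorm_le) (auto intro!: hext_bound U.hnorm_ge)
qed (simp_all add: hext_add hext_mult hext_hscl)

end

text \<open>Contraction on constants gives the coefficient bounds. Linearity for the scalar series
  \<hbar> makes \<alpha> commute with \<hbar>, so \<alpha> satisfies the recursion of
  \<open>hext\<close> and coincides with it.\<close>

lemma h_morphism_deformation:
  assumes "complete_nonarch_field av" "banach_algebra av U" "banach_algebra av U'"
    and \<epsilon>: "0 < \<epsilon>" and \<alpha>: "h_morphism av U U' \<epsilon> \<alpha>" "h_contracting U U' \<epsilon> \<alpha>"
  defines "\<Phi> \<equiv> \<lambda>u. \<alpha> (fps_const u)"
  shows "bounded_deformation av U U' \<epsilon> \<Phi>"
    and "a \<in> hser U \<epsilon> \<Longrightarrow> \<alpha> a = hext \<Phi> a"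
proof -
  interpret complete_nonarch_field av by fact
  interpret U: nonarch_banach_algebra av U by unfold_locales fact
  interpret U': nonarch_banach_algebra av U' by unfold_locales fact
  have maps: "\<alpha> a \<in> hser U' \<epsilon>" if "a \<in> hser U \<epsilon>" for a
    using \<alpha>(1) that by (auto simp: h_morphism_def)
  have \<alpha>_add: "\<alpha> (a + b) = \<alpha> a + \<alpha> b" and \<alpha>_mult: "\<alpha> (a * b) = \<alpha> a * \<alpha> b"
    if "a \<in> hser U \<epsilon>" "b \<in> hser U \<epsilon>" for a b
    using \<alpha>(1) that by (auto simp: h_morphism_def)
  \<comment> \<open>The scalar series used below are the constants and \<hbar>; both have degree at
    most 1.\<close>
  have lin: "\<alpha> (hscl U c a) = hscl U' c (\<alpha> a)" if "a \<in> hser U \<epsilon>" "\<And>n. n > 1 \<Longrightarrow> c $ n = 0" for a c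
  proof -
    have "\<forall>\<^sub>F n in sequentially. av (c $ n) * \<epsilon> ^ n = 0"
      using eventually_gt_at_top[of 1] by eventually_elim (simp add: that av_0)
    then have "c \<in> hser (ground av) \<epsilon>"
      by (simp add: hser_def ground_def tendsto_eventually)
    then show ?thesis using \<alpha>(1) that(1) by (simp add: h_morphism_def)
  qed
  interpret bounded_deformation av U U' \<epsilon> \<Phi>
  proof
    show "0 < \<epsilon>" by fact
    fix x y :: 'b and c n
    show "\<Phi> (x + y) = \<Phi> x + \<Phi> y" "\<Phi> (x * y) = \<Phi> x * \<Phi> y"
      using \<alpha>_add[OF U.fps_const_hser U.fps_const_hser, of x y] \<alpha>_mult[OF U.fps_const_hser U.fps_const_hser, of x y]
      by (simp_all add: \<Phi>_def)
    show "\<Phi> 1 = 1" using \<alpha>(1) by (simp add: \<Phi>_def h_morphism_def)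
    have s: "U.scalar_fps (fps_const c) * fps_const x = fps_const (scl U c x)"
      by (rule fps_ext) (simp flip: U.scl_mult_left)
    have "\<Phi> (scl U c x) = U'.scalar_fps (fps_const c) * \<Phi> x"
      using lin[OF U.fps_const_hser[of x], of "fps_const c"]
      by (simp add: \<Phi>_def U.hscl_eq_mult U'.hscl_eq_mult s)
    also have "U'.scalar_fps (fps_const c) = fps_const (scl U' c 1)" by (rule fps_ext) simp
    finally show "\<Phi> (scl U c x) $ n = scl U' c (\<Phi> x $ n)" by (simp flip: U'.scl_mult_left)
    have "nrm U' (\<Phi> x $ n) * \<epsilon> ^ n \<le> hnorm U' \<epsilon> (\<Phi> x)"
      unfolding \<Phi>_def by (intro U'.hnorm_ge maps U.fps_const_hser)
    also have "\<dots> \<le> hnorm U \<epsilon> (fps_const x)"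
      using \<alpha>(2) U.fps_const_hser by (simp add: h_contracting_def \<Phi>_def)
    also have "\<dots> \<le> nrm U x" by (rule U.hnorm_fps_const_le)
    finally show "nrm U' (\<Phi> x $ n) * \<epsilon> ^ n \<le> nrm U x" .
  qed
  show "bounded_deformation av U U' \<epsilon> \<Phi>" ..
  have X: "U.scalar_fps fps_X = fps_X" "U'.scalar_fps fps_X = fps_X"
    by (auto intro!: fps_ext simp: fps_X_def)
  have shift: "fps_shift 1 a \<in> hser U \<epsilon>" if "a \<in> hser U \<epsilon>" for a
    using \<epsilon> that by (rule U.fps_shift_hser)
  assume "a \<in> hser U \<epsilon>"
  then show "\<alpha> a = hext \<Phi> a"
  proof (rule fps_recursion_unique[where Q = "\<lambda>a. a \<in> hser U \<epsilon>" and s = "fps_shift 1" and p = "\<lambda>a. \<Phi> (a $ 0)"])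
    fix a assume a: "a \<in> hser U \<epsilon>"
    \<comment> \<open>This is \<open>a\<close> without its constant coefficient, hence dominated by
      \<open>a\<close>.\<close>
    have Xa: "fps_X * fps_shift 1 a \<in> hser U \<epsilon>"
      by (rule U.hser_mono[OF _ a]) (use \<epsilon> in \<open>auto simp: fps_X_mult_nth\<close>)
    have "\<alpha> a = \<alpha> (fps_const (a $ 0) + fps_X * fps_shift 1 a)" by (rule arg_cong[OF fps_decompose])
    also have "\<dots> = \<Phi> (a $ 0) + \<alpha> (fps_X * fps_shift 1 a)"
      unfolding \<Phi>_def by (rule \<alpha>_add[OF U.fps_const_hser Xa])
    also have "\<alpha> (fps_X * fps_shift 1 a) = fps_X * \<alpha> (fps_shift 1 a)"
      using lin[OF shift[OF a], of fps_X] by (simp add: U.hscl_eq_mult U'.hscl_eq_mult X)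
    finally show "\<alpha> a = \<Phi> (a $ 0) + fps_X * \<alpha> (fps_shift 1 a)" .
  qed (assumption | rule shift hext_decompose)+
qed


section \<open>The intertwiner\<close>

text \<open>One term of the convolution survives because \<open>f\<close> has order at least n. For
  the defect \<open>E\<close> below, this turns a twisted Leibniz rule into that of a
  derivation.\<close>

lemma fps_mult_nth_first:
  fixes f g :: "'v::ring_1 fps"
  assumes "\<And>m. m < n \<Longrightarrow> f $ m = 0"
  shows "(f * g) $ n = f $ n * g $ 0" and "(g * f) $ n = g $ 0 * f $ n"
proof -
  have "(f * g) $ n = (\<Sum>i\<in>{0..n}. if i = n then f $ n * g $ 0 else 0)"
    unfolding fps_mult_nth using assms by (intro sum.cong) auto
  then show "(f * g) $ n = f $ n * g $ 0" by simp
  have "(g * f) $ n = (\<Sum>i\<in>{0..n}. if i = 0 then g $ 0 * f $ n else 0)"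
    unfolding fps_mult_nth using assms by (intro sum.cong) auto
  then show "(g * f) $ n = g $ 0 * f $ n" by simp
qed

lemma fps_mult_nth_cong:
  fixes f g h :: "'v::ring_1 fps"
  assumes "\<And>m. m \<le> n \<Longrightarrow> f $ m = g $ m"
  shows "(f * h) $ n = (g * h) $ n" and "(h * f) $ n = (h * g) $ n"
  unfolding fps_mult_nth using assms by (auto intro!: sum.cong)

locale deformation_pair =
  \<Phi>: bounded_deformation av U U' \<epsilon> \<Phi> + \<Phi>': bounded_deformation av U U' \<epsilon> \<Phi>'
  for av :: "'k::field_char_0 \<Rightarrow> real"
    and U :: "('k, 'u::ring_1, 'i) envelope" and U' :: "('k, 'v::ring_1, 'z) nspace_scheme"
    and \<epsilon> :: real and \<Phi> \<Phi>' :: "'u \<Rightarrow> 'v fps" +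
  fixes R :: "('i, 'p::ab_group_add) root_datum" and r s :: real
  assumes U_an: "is_U_an av R r s U" "0 < r" "0 < s"
    and congruent: "\<Phi>' x $ 0 = \<Phi> x $ 0"
    and exact: "strictly_exact_at (g_an R U) U' (\<lambda>x. lie_bracket (\<Phi> x $ 0)) 1"
    and contracting: "inverse_contracting (g_an R U) U' (\<lambda>x. lie_bracket (\<Phi> x $ 0)) 1"
begin

text \<open>
  The first coefficient at which \<open>P\<close> fails to intertwine \<open>\<Phi>\<close> and \<open>\<Phi>'\<close> is a derivation, and a
  primitive of it corrects \<open>P\<close>. Passing from \<open>\<rho>\<close> to \<open>\<sigma>\<close> makes room for the primitive, whose norm is
  only close to the infimum that the hypothesis bounds.
\<close>

lemma intertwiner_step:
  assumes \<sigma>: "0 < \<sigma>" "\<sigma> < \<rho>" and \<rho>: "\<rho> \<le> \<epsilon>" and n: "0 < n"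
    and P: "\<And>i. nrm U' (P $ i) * \<rho> ^ i \<le> 1"
    and comm: "\<And>x m. m < n \<Longrightarrow> (\<Phi>' x * P) $ m = (P * \<Phi> x) $ m"
  obtains u where "nrm U' u * \<sigma> ^ n \<le> 1"
    and "\<And>x m. m \<le> n \<Longrightarrow>
      (\<Phi>' x * (P + fps_X ^ n * fps_const u)) $ m = ((P + fps_X ^ n * fps_const u) * \<Phi> x) $ m"
proof -
  have \<rho>0: "0 < \<rho>" using \<sigma> by simp
  define E where "E x = P * \<Phi> x - \<Phi>' x * P" for x
  have E_low: "E x $ m = 0" if "m < n" for x m using comm[OF that, of x] by (simp add: E_def)
  \<comment> \<open>Insert and cancel \<open>\<Phi>' x * P * \<Phi> y\<close>.\<close>
  have E_mult: "E (x * y) = \<Phi>' x * E y + E x * \<Phi> y" for x y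
    by (simp add: E_def \<Phi>.mult \<Phi>'.mult algebra_simps)
  interpret bounded_derivation av U U' "\<lambda>x. \<Phi> x $ 0" "\<lambda>x. E x $ n" "1 / \<rho> ^ n"
  proof
    fix x y c
    show "\<Phi> (x + y) $ 0 = \<Phi> x $ 0 + \<Phi> y $ 0" by (simp add: \<Phi>.add)
    show "\<Phi> (x * y) $ 0 = \<Phi> x $ 0 * \<Phi> y $ 0" by (simp add: \<Phi>.mult)
    show "\<Phi> 1 $ 0 = 1" by (simp add: \<Phi>.one)
    show "\<Phi> (scl U c x) $ 0 = scl U' c (\<Phi> x $ 0)" by (rule \<Phi>.scl)
    show "nrm U' (\<Phi> x $ 0) \<le> nrm U x" using \<Phi>.bound[of x 0] by simp
    show "E (x + y) $ n = E x $ n + E y $ n"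
      by (simp add: E_def \<Phi>.add \<Phi>'.add algebra_simps)
    show "E (scl U c x) $ n = scl U' c (E x $ n)"
      by (simp add: E_def fps_mult_nth \<Phi>.scl \<Phi>'.scl \<Phi>.U'.scale_right_diff_distrib \<Phi>.U'.scale_sum_right
          flip: \<Phi>.U'.scl_mult_left \<Phi>.U'.scl_mult_right)
    \<comment> \<open>The congruence modulo \<hbar> lets the left and right actions come from the
      same homomorphism.\<close>
    show "E (x * y) $ n = \<Phi> x $ 0 * E y $ n + E x $ n * \<Phi> y $ 0"
      by (simp add: E_mult fps_mult_nth_first[where f = "E _", OF E_low] congruent)
    have "nrm U' ((P * \<Phi> x) $ n) * \<rho> ^ n \<le> nrm U x"
      by (rule \<Phi>.U'.fps_mult_bound(2)[OF \<rho>0 _ _ P]) (auto intro: \<Phi>.bound'[OF \<rho>0 \<rho>])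
    moreover have "nrm U' ((\<Phi>' x * P) $ n) * \<rho> ^ n \<le> nrm U x"
      by (rule \<Phi>.U'.fps_mult_bound(1)[OF \<rho>0 _ _ P]) (auto intro: \<Phi>'.bound'[OF \<rho>0 \<rho>])
    ultimately have "nrm U' ((P * \<Phi> x) $ n) \<le> nrm U x / \<rho> ^ n" "nrm U' ((\<Phi>' x * P) $ n) \<le> nrm U x / \<rho> ^ n"
      using \<rho>0 by (simp_all add: field_simps)
    then show "nrm U' (E x $ n) \<le> 1 / \<rho> ^ n * nrm U x"
      using \<Phi>.U'.nrm_diff_le[of "(P * \<Phi> x) $ n" "(\<Phi>' x * P) $ n"] by (simp add: E_def)
    show "0 \<le> 1 / \<rho> ^ n" using \<rho>0 by simp
  qed
  \<comment> \<open>Strict because n is positive; this is the gap between \<open>C\<close> and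
    \<open>C'\<close> in \<open>inner\<close>.\<close>
  have "\<sigma> ^ n < \<rho> ^ n" using \<sigma> n by (intro power_strict_mono) auto
  then have "1 / \<rho> ^ n < 1 / \<sigma> ^ n" using \<sigma> by (intro divide_strict_left_mono) auto
  from inner[OF U_an exact contracting this]
  obtain u where u: "nrm U' u < 1 / \<sigma> ^ n" "\<And>x. E x $ n = lie_bracket (\<Phi> x $ 0) u" by blast
  show thesis
  proof
    show "nrm U' u * \<sigma> ^ n \<le> 1" using u(1) \<sigma> by (simp add: field_simps)
    fix x m assume m: "m \<le> n"
    \<comment> \<open>As \<hbar> is central, the correction changes nothing below degree n, and in
      degree n it subtracts \<open>lie_bracket (\<Phi> x $ 0) u\<close> from the defect, cancelling
      it.\<close>
    have "\<Phi>' x * (fps_X ^ n * fps_const u) = fps_X ^ n * (\<Phi>' x * fps_const u)"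
      using fps_mult_fps_X_power_commute[of n "\<Phi>' x"] by (metis mult.assoc)
    moreover have "E x $ m = (\<Phi>' x * fps_const u) $ 0 - (fps_const u * \<Phi> x) $ 0" if "m = n"
      using u(2)[of x] that by (simp add: lie_bracket_def congruent)
    ultimately show "(\<Phi>' x * (P + fps_X ^ n * fps_const u)) $ m = ((P + fps_X ^ n * fps_const u) * \<Phi> x) $ m"
      using m E_low[of m x]
      by (cases "m = n") (simp_all add: distrib_left distrib_right mult.assoc fps_X_power_mult_nth E_def algebra_simps)
  qed
qed

lemma intertwiner:
  assumes \<tau>: "0 < \<tau>" "\<tau> < \<epsilon>"
  obtains F where "F $ 0 = 1" and "\<And>n. nrm U' (F $ n) * \<tau> ^ n \<le> 1" and "\<And>x. \<Phi>' x * F = F * \<Phi> x"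
proof -
  \<comment> \<open>The radii start at \<epsilon> and decrease strictly towards \<tau>, so every
    step has room and all bounds survive at \<tau>.\<close>
  define \<rho> where "\<rho> n = \<tau> + (\<epsilon> - \<tau>) / real (Suc n)" for n
  have \<rho>: "\<tau> < \<rho> n" "\<rho> n \<le> \<epsilon>" "\<rho> (Suc n) < \<rho> n" for n
    using \<tau> by (auto simp: \<rho>_def field_simps intro: mult_right_mono)
  \<comment> \<open>Vanishing above n guarantees that the next step puts \<open>u\<close> into an
    empty coefficient.\<close>
  define good where "good n P \<longleftrightarrow> P $ 0 = 1 \<and> (\<forall>i. nrm U' (P $ i) * \<rho> n ^ i \<le> 1) \<and> (\<forall>i>n. P $ i = 0) \<and>
    (\<forall>x. \<forall>m\<le>n. (\<Phi>' x * P) $ m = (P * \<Phi> x) $ m)" for n P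
  have "\<exists>f. \<forall>n. good n (f n) \<and> (\<forall>i\<le>n. f (Suc n) $ i = f n $ i)"
  proof (rule dependent_nat_choice)
    \<comment> \<open>For the series 1, intertwining in degree 0 is the congruence modulo
      \<hbar>.\<close>
    show "\<exists>P. good 0 P"
      by (rule exI[of _ 1]) (auto simp: good_def congruent \<Phi>.U'.nrm_one_le)
    fix P n assume P: "good n P"
    have "nrm U' (P $ i) * \<rho> n ^ i \<le> 1" "m < Suc n \<Longrightarrow> (\<Phi>' x * P) $ m = (P * \<Phi> x) $ m" for i x m
      using P by (auto simp: good_def)
    then obtain u where u: "nrm U' u * \<rho> (Suc n) ^ Suc n \<le> 1"
      "\<And>x m. m \<le> Suc n \<Longrightarrow>
        (\<Phi>' x * (P + fps_X ^ Suc n * fps_const u)) $ m = ((P + fps_X ^ Suc n * fps_const u) * \<Phi> x) $ m"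
      using intertwiner_step[of "\<rho> (Suc n)" "\<rho> n" "Suc n" P] \<rho>(1)[of "Suc n"] \<rho>(2)[of n] \<rho>(3)[of n] \<tau>
      by (metis less_trans zero_less_Suc)
    define Q where "Q = P + fps_X ^ Suc n * fps_const u"
    have Q: "Q $ i = (if i = Suc n then u else P $ i)" for i
      using P by (auto simp: Q_def good_def fps_X_power_mult_nth simp del: power_Suc)
    have "nrm U' (Q $ i) * \<rho> (Suc n) ^ i \<le> 1" for i
    proof (cases "i = Suc n")
      case True then show ?thesis using u(1) by (simp add: Q)
    next
      case False
      have "nrm U' (P $ i) * \<rho> (Suc n) ^ i \<le> nrm U' (P $ i) * \<rho> n ^ i"
        using \<rho>(1)[of "Suc n"] \<rho>(3)[of n] \<tau> by (intro mult_left_mono power_mono) auto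
      also have "\<dots> \<le> 1" using P by (simp add: good_def)
      finally show ?thesis using False by (simp add: Q)
    qed
    moreover have "Q $ 0 = 1" "\<forall>i>Suc n. Q $ i = 0" using P by (auto simp: Q good_def)
    ultimately have "good (Suc n) Q" using u(2) unfolding good_def Q_def[symmetric] by blast
    then show "\<exists>Q. good (Suc n) Q \<and> (\<forall>i\<le>n. Q $ i = P $ i)" by (intro exI[of _ Q]) (simp add: Q)
  qed
  then obtain f where good: "\<And>n. good n (f n)" and stable: "\<And>n i. i \<le> n \<Longrightarrow> f (Suc n) $ i = f n $ i"
    by blast
  \<comment> \<open>Coefficient n no longer changes from \<open>f n\<close> on, so the diagonal
    collects the final values.\<close>
  define F where "F = Abs_fps (\<lambda>n. f n $ n)"
  have F: "F $ i = f n $ i" if "i \<le> n" for i n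
    using that by (induction n rule: dec_induct) (simp_all add: F_def stable)
  show thesis
  proof
    show "F $ 0 = 1" using good[of 0] by (simp add: F[of 0 0] good_def)
    fix n
    have "nrm U' (F $ n) * \<tau> ^ n \<le> nrm U' (f n $ n) * \<rho> n ^ n"
      unfolding F[OF order_refl] using \<rho>(1)[of n] \<tau> by (intro mult_left_mono power_mono) auto
    also have "\<dots> \<le> 1" using good[of n] by (simp add: good_def)
    finally show "nrm U' (F $ n) * \<tau> ^ n \<le> 1" .
  next
    fix x
    show "\<Phi>' x * F = F * \<Phi> x"
    proof (rule fps_ext)
      fix n
      have "(\<Phi>' x * F) $ n = (\<Phi>' x * f n) $ n" by (rule fps_mult_nth_cong) (rule F)
      also have "\<dots> = (f n * \<Phi> x) $ n" using good[of n] by (simp add: good_def)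
      also have "\<dots> = (F * \<Phi> x) $ n" by (rule fps_mult_nth_cong) (simp add: F)
      finally show "(\<Phi>' x * F) $ n = (F * \<Phi> x) $ n" .
    qed
  qed
qed

lemma hext_conjugate:
  assumes "0 < \<rho>" "\<rho> < \<epsilon>"
  shows "\<exists>F\<in>hser U' \<rho>. \<exists>G\<in>hser U' \<rho>. F * G = 1 \<and> G * F = 1 \<and> (\<forall>a. hext \<Phi>' a = F * hext \<Phi> a * G)"
proof -
  \<comment> \<open>The midpoint leaves room on both sides: below \<epsilon> for
    \<open>intertwiner\<close>, above \<rho> for \<open>hser_of_bounded\<close>.\<close>
  define \<tau> where "\<tau> = (\<rho> + \<epsilon>) / 2"
  have \<tau>: "0 < \<tau>" "\<tau> < \<epsilon>" "\<rho> < \<tau>" using assms by (auto simp: \<tau>_def)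
  obtain F where F: "F $ 0 = 1" "\<And>n. nrm U' (F $ n) * \<tau> ^ n \<le> 1" "\<And>x. \<Phi>' x * F = F * \<Phi> x"
    using intertwiner[OF \<tau>(1,2)] by blast
  define G where "G = fps_right_inverse F 1"
  have FG: "F * G = 1" unfolding G_def by (rule fps_right_inverse) (simp add: F)
  \<comment> \<open>The left and the right inverse with constant coefficient 1 coincide.\<close>
  have GF: "G * F = 1"
    unfolding G_def using fps_left_inverse_eq_fps_right_inverse[of 1 F 1] fps_left_inverse[of 1 F] F(1) by simp
  \<comment> \<open>The relation on constants extends to power series by the same recursion
    principle.\<close>
  have "hext \<Phi>' a * F = F * hext \<Phi> a" for a
  proof (rule fps_recursion_unique[where Q = "\<lambda>_. True" and s = "fps_shift 1" and p = "\<lambda>a. F * \<Phi> (a $ 0)"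
        and L = "\<lambda>a. hext \<Phi>' a * F" and M = "\<lambda>a. F * hext \<Phi> a"])
    fix a
    show "hext \<Phi>' a * F = F * \<Phi> (a $ 0) + fps_X * (hext \<Phi>' (fps_shift 1 a) * F)"
      by (subst hext_decompose) (simp only: distrib_right mult.assoc F(3))
    have "F * (fps_X * hext \<Phi> (fps_shift 1 a)) = fps_X * (F * hext \<Phi> (fps_shift 1 a))"
      using fps_mult_fps_X_commute[of F] by (metis mult.assoc)
    then show "F * hext \<Phi> a = F * \<Phi> (a $ 0) + fps_X * (F * hext \<Phi> (fps_shift 1 a))"
      by (subst hext_decompose) (simp only: distrib_left)
  qed auto
  then have "hext \<Phi>' a = F * hext \<Phi> a * G" for a
    using FG by (metis mult.assoc mult.right_neutral)
  moreover have "F \<in> hser U' \<rho>"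
    using assms(1) \<tau>(3) F(2) by (rule \<Phi>.U'.hser_of_bounded)
  moreover have "G \<in> hser U' \<rho>"
    unfolding G_def using assms(1) \<tau>(3) \<Phi>.U'.fps_right_inverse_bound[OF \<tau>(1) F(2)] by (rule \<Phi>.U'.hser_of_bounded)
  ultimately show ?thesis using FG GF by blast
qed

end

theorem theorem3p52:
  fixes av :: "'k::field_char_0 \<Rightarrow> real"
    and R :: "('i, 'p::ab_group_add) root_datum" and R' :: "('j, 'q::ab_group_add) root_datum"
    and U :: "('k, 'u::ring_1, 'i) envelope" and U' :: "('k, 'v::ring_1, 'j) envelope"
    and r s r' s' \<epsilon> \<epsilon>' :: real
    and \<alpha> \<alpha>' :: "'u fps \<Rightarrow> 'v fps"
  defines "act \<equiv> \<lambda>x u. lie_bracket (h_reduction \<alpha> x) u"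
  assumes "complete_nonarch_field av"
    and "is_root_datum R" and "0 < r" and "0 < s" and "1 \<le> r * s" and "is_U_an av R r s U"
    and "is_root_datum R'" and "0 < r'" and "0 < s'" and "1 \<le> r' * s'" and "is_U_an av R' r' s' U'"
    and "0 < \<epsilon>" and "\<epsilon> < 1"
    and "h_morphism av U U' \<epsilon> \<alpha>" and "h_morphism av U U' \<epsilon> \<alpha>'"
    and "h_congruent U \<epsilon> \<alpha> \<alpha>'"
    and "h_contracting U U' \<epsilon> \<alpha>" and "h_contracting U U' \<epsilon> \<alpha>'"
    and "strictly_exact_at (g_an R U) U' act 1"
    and "inverse_contracting (g_an R U) U' act 1"
    and "0 < \<epsilon>'" and "\<epsilon>' < \<epsilon>"
  shows "\<exists>\<beta> \<beta>'. is_base_change av U U' \<epsilon> \<epsilon>' \<alpha> \<beta> \<and> is_base_change av U U' \<epsilon> \<epsilon>' \<alpha>' \<beta>' \<and>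
           (\<exists>F\<in>hser U' \<epsilon>'. \<exists>G\<in>hser U' \<epsilon>'. F * G = 1 \<and> G * F = 1 \<and>
              (\<forall>x\<in>hser U \<epsilon>'. \<beta>' x = F * \<beta> x * G))"
proof -
  have U: "banach_algebra av U" and U': "banach_algebra av U'"
    using assms by (simp_all add: is_U_an_def)
  define \<Phi> where "\<Phi> = (\<lambda>u. \<alpha> (fps_const u))"
  define \<Phi>' where "\<Phi>' = (\<lambda>u. \<alpha>' (fps_const u))"
  note \<alpha> = h_morphism_deformation[OF assms(2) U U' \<open>0 < \<epsilon>\<close> \<open>h_morphism av U U' \<epsilon> \<alpha>\<close>
      \<open>h_contracting U U' \<epsilon> \<alpha>\<close>, folded \<Phi>_def]
  note \<alpha>' = h_morphism_deformation[OF assms(2) U U' \<open>0 < \<epsilon>\<close> \<open>h_morphism av U U' \<epsilon> \<alpha>'\<close>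
      \<open>h_contracting U U' \<epsilon> \<alpha>'\<close>, folded \<Phi>'_def]
  interpret \<Phi>: bounded_deformation av U U' \<epsilon> \<Phi> by (rule \<alpha>(1))
  interpret \<Phi>': bounded_deformation av U U' \<epsilon> \<Phi>' by (rule \<alpha>'(1))
  have act: "act = (\<lambda>x. lie_bracket (\<Phi> x $ 0))" by (simp add: act_def h_reduction_def \<Phi>_def)
  interpret deformation_pair av U U' \<epsilon> \<Phi> \<Phi>' R r s
  proof
    show "\<Phi>' x $ 0 = \<Phi> x $ 0" for x
      using \<open>h_congruent U \<epsilon> \<alpha> \<alpha>'\<close> \<Phi>.U.fps_const_hser by (simp add: h_congruent_def \<Phi>_def \<Phi>'_def)
  qed (use assms in \<open>simp_all flip: act\<close>)
  \<comment> \<open>\<open>hext\<close> is linear over all formal scalar series, and it equals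
    \<alpha> on series convergent at \<epsilon>; together these give the base change
    identity.\<close>
  have "is_base_change av U U' \<epsilon> \<epsilon>' \<alpha> (hext \<Phi>)" "is_base_change av U U' \<epsilon> \<epsilon>' \<alpha>' (hext \<Phi>')"
    unfolding is_base_change_def
    using \<Phi>.h_morphism_hext \<Phi>'.h_morphism_hext \<open>0 < \<epsilon>'\<close> \<open>\<epsilon>' < \<epsilon>\<close>
    by (auto simp: \<Phi>.hext_hscl \<Phi>'.hext_hscl \<alpha>(2) \<alpha>'(2))
  then show ?thesis using hext_conjugate[OF \<open>0 < \<epsilon>'\<close> \<open>\<epsilon>' < \<epsilon>\<close>] by blast
qed

end
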